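(* Let $q,z,a,b,c,h$ be non-zero complex numbers with $|q|<1$, $|z|<1$, and assume there are no vanishing denominator factors. Then $${}_5W_4(a;b,c;q,z)=\frac{(qa,\frac{b^2c^2z^2}{qa},\frac{qa}{bc};q)_\infty}{\vartheta(h,h\frac{qa}{bcz};q)\,(\frac{b^2c^2z^2}a,\frac{qa}b,\frac{qa}c;q)_\infty}\Big(S_1+S_2+S_3+S_4+S_5\Big),$$ where $$S_1=\frac{\vartheta(h\sqrt{qa},h\frac{\sqrt{qa}}{bcz};q)(\frac{\sqrt{qa}}b,\frac{\sqrt{qa}}c,bcz\sqrt{\frac qa};q)_\infty}{(-1,\pm\sqrt q,\sqrt{qa},\frac{\sqrt{qa}}{bc},\frac{bcz}{\sqrt{qa}};q)_\infty}\,{}_5\phi_4\!\left(\sqrt{qa},\tfrac{qb}{\sqrt{qa}},\tfrac{qc}{\sqrt{qa}},\tfrac{bcz}{\sqrt{qa}},\tfrac{\sqrt{qa}}{bcz};-q,\pm\sqrt q,\tfrac{\sqrt q\,bc}{\sqrt a};q,q\right),$$ $$S_2=\frac{\vartheta(-h\sqrt{qa},-h\frac{\sqrt{qa}}{bcz};q)(-\frac{\sqrt{qa}}b,-\frac{\sqrt{qa}}c,-bcz\sqrt{\frac qa};q)_\infty}{(-1,\pm\sqrt q,-\sqrt{qa},-\frac{\sqrt{qa}}{bc},-\frac{bcz}{\sqrt{qa}};q)_\infty}\,{}_5\phi_4\!\left(-\sqrt{qa},-\tfrac{\sqrt qb}{\sqrt a},-\tfrac{\sqrt qc}{\sqrt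 a},-\tfrac{bcz}{\sqrt{qa}},-\tfrac{\sqrt{qa}}{bcz};-q,\pm\sqrt q,-\tfrac{\sqrt q\,bc}{\sqrt a};q,q\right),$$ $$S_3=\frac{\vartheta(hq\sqrt a,h\frac{\sqrt a}{bcz};q)(\frac{\sqrt a}b,\frac{\sqrt a}c,\frac{bcz}{\sqrt a};q)_\infty}{(-1,\pm\frac1{\sqrt q},q\sqrt a,\frac{\sqrt a}{bc},\frac{bcz}{\sqrt a};q)_\infty}\,{}_5\phi_4\!\left(q\sqrt a,\tfrac{qb}{\sqrt a},\tfrac{qc}{\sqrt a},\tfrac{bcz}{\sqrt a},\tfrac{q\sqrt a}{bcz};-q,\pm q^{3/2},\tfrac{qbc}{\sqrt a};q,q\right),$$ $$S_4=\frac{\vartheta(-hq\sqrt a,-h\frac{\sqrt a}{bcz};q)(-\frac{\sqrt a}b,-\frac{\sqrt a}c,-\frac{bcz}{\sqrt a};q)_\infty}{(-1,\pm\frac1{\sqrt q},-q\sqrt a,-\frac{\sqrt a}{bc},-\frac{bcz}{\sqrt a};q)_\infty}\,{}_5\phi_4\!\left(-q\sqrt a,-\tfrac{qb}{\sqrt a},-\tfrac{qc}{\sqrt a},-\tfrac{bcz}{\sqrt a},-\tfrac{q\sqrt a}{bcz};-q,\pm q^{3/2},-\tfrac{qbc}{\sqrt a};q,q\right),$$ $$S_5=\frac{\vartheta(\frac hz,h\frac{qa}{bc};q)(b,c,\frac{b^2c^2z}a;q)_\infty}{(z,\frac{qa}{bc},\frac{b^2c^2}{qa};q)_\infty}\,{}_5\phi_4\!\left(\tfrac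 qb,\tfrac qc,\tfrac{qa}{bc},z,\tfrac{qa}{b^2c^2z};\pm\tfrac{q\sqrt a}{bc},\pm\tfrac{q^{3/2}\sqrt a}{bc};q,q\right).$$
   Context: Notation. $(a;q)_k=\prod_{j=0}^{k-1}(1-aq^j)$, $(a;q)_\infty=\prod_{j\ge0}(1-aq^j)$, $(a_1,\dots,a_r;q)_k=\prod_j(a_j;q)_k$ for $k\in\mathbb N_0\cup\{\infty\}$. In a list, $\pm x$ stands for the two entries $x,-x$. $\vartheta(x;q)=(x,q/x;q)_\infty$ for $x\ne0$, $\vartheta(x_1,\dots,x_k;q)=\prod_j\vartheta(x_j;q)$. ${}_{r+1}\phi_r(a_1,\dots,a_{r+1};b_1,\dots,b_r;q,z)=\sum_{k\ge0}\frac{(a_1,\dots,a_{r+1};q)_k}{(q,b_1,\dots,b_r;q)_k}z^k$ for $|z|<1$, and $${}_5W_4(a;b,c;q,z)={}_5\phi_4\!\left(a,\pm q\sqrt a,b,c;\pm\sqrt a,\tfrac{qa}b,\tfrac{qa}c;q,z\right).$$ Fix square roots $\sqrt q,\sqrt a$; $\sqrt{qa}=\sqrt q\sqrt a$, $\sqrt{q/a}=\sqrt q/\sqrt a$, $q^{3/2}=(\sqrt q)^3$. Convention "no vanishing denominator factors": every infinite $q$-shifted factorial and every theta function appearing in a denominator is non-zero, and no denominator parameter of any series lies in $\{q^{-k}:k\in\mathbb N_0\}$. *)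

theory Defs
  imports "HOL-Analysis.Analysis"
begin

definition qpoch :: "complex \<Rightarrow> complex \<Rightarrow> nat \<Rightarrow> complex" where
  "qpoch a q k = (\<Prod>j<k. 1 - a * q ^ j)"

definition qpoch_inf :: "complex \<Rightarrow> complex \<Rightarrow> complex" where
  "qpoch_inf a q = (\<Prod>j. 1 - a * q ^ j)"

definition qpochs :: "complex list \<Rightarrow> complex \<Rightarrow> nat \<Rightarrow> complex" where
  "qpochs as q k = (\<Prod>a\<leftarrow>as. qpoch a q k)"

definition qpochs_inf :: "complex list \<Rightarrow> complex \<Rightarrow> complex" where
  "qpochs_inf as q = (\<Prod>a\<leftarrow>as. qpoch_inf a q)"

text \<open>The modified theta function, intended for nonzero arguments only.\<close>

definition theta :: "complex \<Rightarrow> complex \<Rightarrow> complex" where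
  "theta x q = qpochs_inf [x, q / x] q"

definition thetas :: "complex list \<Rightarrow> complex \<Rightarrow> complex" where
  "thetas xs q = (\<Prod>x\<leftarrow>xs. theta x q)"

text \<open>
  The basic hypergeometric series with \<open>r + 1\<close> upper parameters \<open>as\<close> and \<open>r\<close> lower
  parameters \<open>bs\<close>. It is only used with \<open>length as = length bs + 1\<close> and \<open>norm z < 1\<close>.
\<close>

definition phi :: "complex list \<Rightarrow> complex list \<Rightarrow> complex \<Rightarrow> complex \<Rightarrow> complex" where
  "phi as bs q z = (\<Sum>k. qpochs as q k / qpochs (q # bs) q k * z ^ k)"

text \<open>
  The argument \<open>sa\<close> is the chosen square root of \<open>a\<close>. Replacing it by \<open>- sa\<close> only permutes
  the parameters of the series.
\<close>

definition W54 :: "complex \<Rightarrow> complex \<Rightarrow> complex \<Rightarrow> complex \<Rightarrow> complex \<Rightarrow> complex \<Rightarrow> complex" where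
  "W54 a sa b c q z =
     phi [a, q * sa, - (q * sa), b, c] [sa, - sa, q * a / b, q * a / c] q z"

text \<open>No lower parameter makes a denominator of a term of the series vanish.\<close>

definition admissible :: "complex list \<Rightarrow> complex \<Rightarrow> bool" where
  "admissible bs q \<longleftrightarrow> set bs \<inter> range (\<lambda>k::nat. inverse (q ^ k)) = {}"

end

theory Submission
  imports Defs "HOL-Complex_Analysis.Complex_Analysis"
begin

text \<open>
  Put \<open>w = b c z / (q a)\<close>. The function
  \<open>f x = theta (h x) theta (h / (w x)) (q a / (b x), q a / (c x), q\<^sup>2 a w / x)\<^sub>\<infinity> /
  (x, w x, q a / x\<^sup>2, q a / (b c x))\<^sub>\<infinity>\<close>
  has seven geometric progressions of poles. The residues of \<open>f x / x\<close> add up to zero: on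
  circles of radius \<open>s |q|\<^sup>n\<close> the function \<open>f\<close> decays geometrically for \<open>n\<close> tending to both
  infinities. The five progressions accumulating at 0 give the summands \<open>S1\<close>, \<dots>, \<open>S5\<close>, the
  other two, \<open>x = q\<^sup>-\<^sup>j\<close> and \<open>x = q\<^sup>-\<^sup>j / w\<close>, give \<open>theta h theta (h / w)\<close> times a sum over
  \<open>y = 1 / x\<close>. In that sum the quotient \<open>(q a y / b, q a y / c)\<^sub>\<infinity> / (q a y, q a y / (b c))\<^sub>\<infinity>\<close>
  is expanded by the very-well-poised \<open>6\<phi>5\<close> summation with third parameter \<open>1 / y\<close>. After
  interchanging the summations, each inner sum is, after a shift by \<open>q\<^sup>k\<close>, the same sum with
  \<open>(a, w)\<close> replaced by \<open>(a q\<^sup>2\<^sup>k, w / q\<^sup>k)\<close> and equals \<open>w\<^sup>k / (1 - q a w\<^sup>2)\<close>, so the outer sum is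
  the series on the left-hand side. The poles are simple only if \<open>w\<close> is not a power of \<open>q\<close>; the
  remaining values of \<open>z\<close> follow by continuity.
\<close>

section \<open>Infinite and finite shifted factorials\<close>

text \<open>Under \<open>x -> q x\<close> the two thetas of \<open>f\<close> acquire the factors
  \<open>- 1 / (h x)\<close> and \<open>- h / (q w x)\<close>, whose product is free of
  \<open>h\<close>. Hence \<open>h\<close> cancels inside every residue series and survives only in
  the prefactors, so it is a free parameter of the identity. The numerator factor with
  \<open>q\<^sup>2 a w / x\<close> balances \<open>f\<close>: the product of the numerator
  parameters over that of the denominator parameters is \<open>q\<close>, both for the factors in
  \<open>x\<close> and for those in \<open>1 / x\<close>. This gives every residue series the
  argument \<open>q\<close>, and \<open>|q| < 1\<close> gives the decay on the circles. The hard
  part is the value of the inner sum. It is a Jackson q-integral in disguise, and summation by parts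
  shows that \<open>1 - q a w\<^sup>2\<close> times it is unchanged by \<open>a -> q a\<close>, up
  to an auxiliary sum that has to be shown to vanish separately. Pushing \<open>a\<close> to 0
  leaves the total mass of the weight. This mass does not involve \<open>a\<close>, so it can be
  read off from the same identity at the one value of \<open>a\<close> where nearly all terms
  vanish.\<close>

locale nome =
  fixes q :: complex
  assumes q_nz [simp]: "q \<noteq> 0" and q_less: "norm q < 1"
begin

abbreviation P :: "complex \<Rightarrow> complex" where "P a \<equiv> qpoch_inf a q"
abbreviation poch :: "complex \<Rightarrow> nat \<Rightarrow> complex" where "poch a n \<equiv> qpoch a q n"

lemma poch_0 [simp]: "poch a 0 = 1"
  by (simp add: qpoch_def)

lemma poch_Suc: "poch a (Suc n) = poch a n * (1 - a * q ^ n)"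
  by (simp add: qpoch_def)

lemma poch_add: "poch a (m + n) = poch a m * poch (a * q ^ m) n"
  by (induction n) (simp_all add: poch_Suc power_add mult_ac)

lemma poch_Suc_shift: "poch a (Suc n) = (1 - a) * poch (a * q) n"
  using poch_add [of a 1 n] by (simp add: poch_Suc)

lemma summable_norm_qpow: "summable (\<lambda>j. norm (a * q ^ j))"
  using q_less by (simp add: norm_mult norm_power summable_mult summable_geometric)

lemma qpow_tendsto_0: "(\<lambda>n. q ^ n) \<longlonglongrightarrow> 0"
  using q_less by (rule LIMSEQ_power_zero)

lemma P_has_prod: "(\<lambda>j. 1 - a * q ^ j) has_prod P a"
proof -
  have "abs_convergent_prod (\<lambda>j. 1 - a * q ^ j)"
    using summable_norm_qpow [of a] by (simp add: abs_convergent_prod_conv_summable)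
  then show ?thesis
    unfolding qpoch_inf_def by (intro convergent_prod_has_prod abs_convergent_prod_imp_convergent_prod)
qed

lemma poch_tendsto: "(\<lambda>n. poch a n) \<longlonglongrightarrow> P a"
  unfolding qpoch_def using has_prod_imp_tendsto' [OF P_has_prod] .

lemma P_0 [simp]: "P 0 = 1"
  by (simp add: qpoch_inf_def)

lemma P_split: "P a = poch a n * P (a * q ^ n)"
proof -
  have "(\<lambda>m. poch a (n + m)) \<longlonglongrightarrow> poch a n * P (a * q ^ n)"
    unfolding poch_add by (intro tendsto_intros poch_tendsto)
  moreover have "(\<lambda>m. poch a (n + m)) \<longlonglongrightarrow> P a"
    using LIMSEQ_ignore_initial_segment [OF poch_tendsto, of a n] by (simp add: add.commute)
  ultimately show ?thesis
    using LIMSEQ_unique by blast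
qed

lemma P_step: "P a = (1 - a) * P (a * q)"
  using P_split [of a 1] by (simp add: poch_Suc)

lemma P_eq_0_iff: "P a = 0 \<longleftrightarrow> (\<exists>k. a * q ^ k = 1)"
  using has_prod_eq_0_iff [OF P_has_prod [of a]] by auto

lemma poch_nonzero: "P a \<noteq> 0 \<Longrightarrow> poch a n \<noteq> 0"
  using P_split [of a n] by auto

lemma P_shift_nonzero: "P a \<noteq> 0 \<Longrightarrow> P (a * q ^ n) \<noteq> 0"
  using P_split [of a n] by auto

lemma P_nonzero_if_norm_less: "norm a < 1 \<Longrightarrow> P a \<noteq> 0"
proof
  assume a: "norm a < 1" and "P a = 0"
  then obtain k where "a * q ^ k = 1" by (auto simp: P_eq_0_iff)
  then have "norm a * norm q ^ k = 1" by (metis norm_mult norm_one norm_power)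
  moreover have "norm a * norm q ^ k \<le> norm a * 1"
    using q_less by (intro mult_left_mono power_le_one) auto
  ultimately show False using a by simp
qed

lemma P_q_nonzero [simp]: "P q \<noteq> 0"
  using P_nonzero_if_norm_less q_less .

lemma one_minus_qpow_nonzero [simp]: "1 - q * q ^ n \<noteq> 0"
  using P_q_nonzero by (auto simp: P_eq_0_iff)

lemma poch_q_nonzero [simp]: "poch q n \<noteq> 0"
  by (simp add: poch_nonzero)

text \<open>The numbers \<open>inverse (q ^ k)\<close> are exactly the zeros of \<open>P\<close>. So
  the convention on lower parameters takes the same form as the one on infinite products, and
  \<open>poch_nonzero\<close> then clears the denominators of a series.\<close>

lemma admissible_iff: "admissible bs q \<longleftrightarrow> (\<forall>b\<in>set bs. P b \<noteq> 0)"
proof -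
  have "b \<in> range (\<lambda>k::nat. inverse (q ^ k)) \<longleftrightarrow> P b = 0" for b
    by (auto simp: P_eq_0_iff field_simps)
  then show ?thesis
    by (auto simp: admissible_def)
qed

section \<open>Bounds uniform in the number of factors and along geometric progressions\<close>

definition pbound :: "real \<Rightarrow> real" where
  "pbound r = exp (r / (1 - norm q))"

lemma pbound_pos [simp]: "pbound r > 0"
  by (simp add: pbound_def)

lemma pbound_mono: "r \<le> s \<Longrightarrow> pbound r \<le> pbound s"
  using q_less by (simp add: pbound_def divide_right_mono)

lemma pbound_0 [simp]: "pbound 0 = 1"
  by (simp add: pbound_def)

text \<open>The estimate \<open>1 + t \<le> exp t\<close> turns the product into the exponential of
  a geometric series, hence the shape of \<open>pbound\<close>.\<close>

lemma prod_norm_le_pbound: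
  assumes "r \<ge> 0"
  shows "(\<Prod>j<n. 1 + r * norm q ^ j) \<le> pbound r"
proof -
  have "(\<Prod>j<n. 1 + r * norm q ^ j) \<le> exp (\<Sum>j<n. r * norm q ^ j)"
    using assms by (intro prod_le_exp_sum) auto
  also have "(\<Sum>j<n. r * norm q ^ j) \<le> (\<Sum>j. r * norm q ^ j)"
    using assms q_less by (intro sum_le_suminf summable_mult summable_geometric) auto
  also have "(\<Sum>j. r * norm q ^ j) = r / (1 - norm q)"
    using q_less by (simp add: suminf_mult summable_geometric suminf_geometric)
  finally show ?thesis by (simp add: pbound_def)
qed

lemma norm_poch_le:
  assumes "norm a \<le> r"
  shows "norm (poch a n) \<le> pbound r"
proof -
  have r: "r \<ge> 0" using assms norm_ge_zero order_trans by blast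
  have "norm (poch a n) \<le> (\<Prod>j<n. 1 + r * norm q ^ j)"
    unfolding qpoch_def prod_norm [symmetric]
  proof (intro prod_mono conjI)
    fix j
    have "norm (1 - a * q ^ j) \<le> 1 + norm a * norm q ^ j"
      using norm_triangle_ineq4 [of 1 "a * q ^ j"] by (simp add: norm_mult norm_power)
    also have "\<dots> \<le> 1 + r * norm q ^ j"
      using assms by (simp add: mult_right_mono)
    finally show "norm (1 - a * q ^ j) \<le> 1 + r * norm q ^ j" .
  qed simp
  also have "\<dots> \<le> pbound r" by (rule prod_norm_le_pbound [OF r])
  finally show ?thesis .
qed

lemma norm_P_le: "norm a \<le> r \<Longrightarrow> norm (P a) \<le> pbound r"
  by (rule LIMSEQ_le_const2 [OF tendsto_norm [OF poch_tendsto]]) (auto intro: norm_poch_le)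

lemma norm_P_shift_le: "norm a \<le> r \<Longrightarrow> norm (P (a * q ^ n)) \<le> pbound r"
proof -
  assume "norm a \<le> r"
  moreover have "norm a * norm q ^ n \<le> norm a * 1"
    using q_less by (intro mult_left_mono power_le_one) auto
  ultimately show ?thesis by (intro norm_P_le) (simp add: norm_mult norm_power)
qed

text \<open>Unlike the bound in \<open>norm_poch_le\<close>, this one tends to 0 with
  \<open>r\<close>; it controls the tails \<open>P (a * q ^ n)\<close>.\<close>

lemma norm_poch_minus_1_le:
  assumes "norm a \<le> r"
  shows "norm (poch a n - 1) \<le> pbound r - 1"
proof -
  have r: "r \<ge> 0" using assms norm_ge_zero order_trans by blast
  have "norm (poch a n - 1) \<le> (\<Prod>j<n. 1 + norm (- a * q ^ j)) - 1"
    using norm_prod_minus1_le_prod_minus1 [of "\<lambda>j. - a * q ^ j" "{..<n}"] by (simp add: qpoch_def)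
  also have "(\<Prod>j<n. 1 + norm (- a * q ^ j)) \<le> (\<Prod>j<n. 1 + r * norm q ^ j)"
    using assms by (intro prod_mono) (auto simp: norm_mult norm_power mult_right_mono)
  also have "\<dots> \<le> pbound r" by (rule prod_norm_le_pbound [OF r])
  finally show ?thesis by simp
qed

lemma norm_P_minus_1_le: "norm a \<le> r \<Longrightarrow> norm (P a - 1) \<le> pbound r - 1"
  by (rule LIMSEQ_le_const2 [OF tendsto_norm [OF tendsto_diff [OF poch_tendsto tendsto_const]]])
     (auto intro: norm_poch_minus_1_le)

section \<open>Locally uniform convergence and analyticity of the infinite product\<close>

lemma uniform_limit_poch: "uniform_limit (cball 0 r) (\<lambda>n a. poch a n) P sequentially"
proof (rule uniform_limitI)
  fix e :: real assume e: "e > 0"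
  have "(\<lambda>n. pbound r * (pbound (r * norm q ^ n) - 1)) \<longlonglongrightarrow> pbound r * (pbound (r * 0) - 1)"
    unfolding pbound_def using q_less by (intro tendsto_intros LIMSEQ_power_zero) auto
  then have "\<forall>\<^sub>F n in sequentially. pbound r * (pbound (r * norm q ^ n) - 1) < e"
    using e by (intro order_tendstoD(2)) auto
  then show "\<forall>\<^sub>F n in sequentially. \<forall>a\<in>cball 0 r. dist (poch a n) (P a) < e"
  proof eventually_elim
    case (elim n)
    show ?case
    proof
      fix a :: complex assume "a \<in> cball 0 r"
      then have a: "norm a \<le> r" by simp
      \<comment> \<open>By \<open>P_split\<close> the error is the partial product times the
        deviation of the tail from 1, and the argument of the tail lies in the disc of radius
        \<open>r * norm q ^ n\<close>.\<close>
      have "dist (poch a n) (P a) = norm (poch a n) * norm (P (a * q ^ n) - 1)"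
        by (subst P_split [of a n])
           (simp add: dist_norm norm_minus_commute norm_mult [symmetric] algebra_simps)
      also have "\<dots> \<le> pbound r * (pbound (r * norm q ^ n) - 1)"
        using a by (intro mult_mono norm_poch_le norm_P_minus_1_le)
          (auto simp: norm_mult norm_power mult_right_mono less_imp_le)
      also have "\<dots> < e" by (rule elim)
      finally show "dist (poch a n) (P a) < e" .
    qed
  qed
qed

lemma poch_holomorphic: "(\<lambda>a. poch a n) holomorphic_on S"
  unfolding qpoch_def by (intro holomorphic_intros)

lemma P_holomorphic_UNIV: "P holomorphic_on UNIV"
proof (rule holomorphic_uniform_sequence)
  fix x :: complex
  have "cball x 1 \<subseteq> cball 0 (norm x + 1)"
  proof
    fix y assume "y \<in> cball x 1"
    then show "y \<in> cball 0 (norm x + 1)"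
      using norm_triangle_ineq2 [of y x] by (simp add: dist_norm norm_minus_commute)
  qed
  then show "\<exists>d>0. cball x d \<subseteq> UNIV \<and> uniform_limit (cball x d) (\<lambda>n a. poch a n) P sequentially"
    using uniform_limit_on_subset [OF uniform_limit_poch] by (intro exI [of _ 1]) auto
qed (auto intro: poch_holomorphic)

lemma P_holomorphic [holomorphic_intros]:
  "f holomorphic_on S \<Longrightarrow> (\<lambda>x. P (f x)) holomorphic_on S"
  using holomorphic_on_compose_gen [OF _ P_holomorphic_UNIV, of f S] by (simp add: o_def)

lemma P_continuous_on [continuous_intros]:
  "continuous_on S f \<Longrightarrow> continuous_on S (\<lambda>x. P (f x))"
  using continuous_on_compose2 [OF holomorphic_on_imp_continuous_on [OF P_holomorphic_UNIV], of S f] by simp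

lemma P_tendsto [tendsto_intros]: "(f \<longlongrightarrow> l) F \<Longrightarrow> ((\<lambda>x. P (f x)) \<longlongrightarrow> P l) F"
  using continuous_on_tendsto_compose [OF holomorphic_on_imp_continuous_on [OF P_holomorphic_UNIV]] by simp

lemma poch_tendsto_param [tendsto_intros]:
  "(f \<longlongrightarrow> l) F \<Longrightarrow> ((\<lambda>x. poch (f x) n) \<longlongrightarrow> poch l n) F"
  unfolding qpoch_def by (intro tendsto_intros)

lemma inverse_poch_bounded:
  assumes "P a \<noteq> 0"
  obtains C where "C > 0" "\<And>n. norm (inverse (poch a n)) \<le> C"
proof -
  have "(\<lambda>n. inverse (poch a n)) \<longlonglongrightarrow> inverse (P a)"
    by (intro tendsto_intros poch_tendsto assms)
  then have "Bseq (\<lambda>n. inverse (poch a n))"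
    by (intro convergent_imp_Bseq) (auto simp: convergent_def)
  then show ?thesis using that by (auto elim: BseqE)
qed

text \<open>The reciprocal equals \<open>poch a n / P a\<close>, a bounded finite product over a
  fixed number. Non-vanishing at the first point of a progression therefore bounds the reciprocal on
  the whole progression.\<close>

lemma norm_inverse_P_shift_le:
  assumes "P a \<noteq> 0" "norm a \<le> r"
  shows "norm (inverse (P (a * q ^ n))) \<le> pbound r / norm (P a)"
proof -
  have "P (a * q ^ n) = P a / poch a n"
    using P_split [of a n] poch_nonzero [OF assms(1), of n] by (simp add: field_simps)
  then have "norm (inverse (P (a * q ^ n))) = norm (poch a n) / norm (P a)"
    by (simp add: norm_divide)
  also have "\<dots> \<le> pbound r / norm (P a)"
    using assms by (intro divide_right_mono norm_poch_le) auto
  finally show ?thesis .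
qed

text \<open>Each of the \<open>k\<close> new factors is rewritten as
  \<open>1 - y / q ^ i = (1 - q ^ i / y) * (- y / q ^ i)\<close>. The Gaussian factor
  \<open>q ^ (Suc k choose 2)\<close> depends on \<open>k\<close> only, so it cancels between
  equally many numerator and denominator factors.\<close>

lemma P_reflect:
  assumes "y \<noteq> 0"
  shows "P (y / q ^ k) = P y * (poch (q / y) k * (- y) ^ k / q ^ (Suc k choose 2))"
proof (induction k)
  case (Suc k)
  have "P (y / q ^ Suc k) = (1 - y / q ^ Suc k) * P (y / q ^ k)"
    using P_step [of "y / q ^ Suc k"] by simp
  also have "1 - y / q ^ Suc k = (1 - q / y * q ^ k) * (- y / q ^ Suc k)"
    using assms by (simp add: field_simps)
  also have "(1 - q / y * q ^ k) * (- y / q ^ Suc k) * P (y / q ^ k) =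
     P y * (poch (q / y) (Suc k) * (- y) ^ Suc k / (q ^ (Suc k choose 2) * q ^ Suc k))"
    unfolding Suc.IH poch_Suc by (simp add: mult_ac)
  also have "q ^ (Suc k choose 2) * q ^ Suc k = q ^ (Suc (Suc k) choose 2)"
    by (simp add: power_add numeral_2_eq_2)
  finally show ?case .
qed (simp add: binomial_eq_0)

lemma theta_eq: "theta x q = P x * P (q / x)"
  by (simp add: theta_def qpochs_inf_def)

text \<open>Even-numbered factors of the left-hand side split over \<open>y\<close> and
  \<open>- y\<close>, odd-numbered ones over \<open>s * y\<close> and \<open>- (s * y)\<close>. This
  resolves the denominator \<open>q a / x\<^sup>2\<close> into four progressions of simple
  poles.\<close>

lemma P_square:
  assumes "s ^ 2 = q"
  shows "P (y ^ 2) = P y * P (- y) * P (s * y) * P (- (s * y))"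
proof -
  have "poch (y ^ 2) (2 * n) = poch y n * poch (- y) n * poch (s * y) n * poch (- (s * y)) n" for n
  proof (induction n)
    case (Suc n)
    define Q where "Q = q ^ n"
    have Q: "q ^ (2 * n) = Q ^ 2" "q ^ Suc (2 * n) = s ^ 2 * Q ^ 2"
      by (simp_all add: Q_def power_mult mult.commute assms flip: power_mult)
    have "(1 - y\<^sup>2 * q ^ (2 * n)) * (1 - y\<^sup>2 * q ^ Suc (2 * n)) =
      (1 - y * Q) * (1 - - y * Q) * (1 - s * y * Q) * (1 - - (s * y) * Q)"
      unfolding Q by algebra
    moreover have "poch (y ^ 2) (2 * Suc n) =
      poch (y ^ 2) (2 * n) * ((1 - y\<^sup>2 * q ^ (2 * n)) * (1 - y\<^sup>2 * q ^ Suc (2 * n)))"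
      by (simp add: poch_Suc)
    ultimately show ?case
      unfolding Suc by (simp add: poch_Suc mult_ac flip: Q_def)
  qed simp
  moreover have "(\<lambda>n. poch (y ^ 2) (2 * n)) \<longlonglongrightarrow> P (y ^ 2)"
    using LIMSEQ_subseq_LIMSEQ [OF poch_tendsto, of "\<lambda>n. 2 * n"] by (simp add: strict_mono_def o_def)
  moreover have "(\<lambda>n. poch y n * poch (- y) n * poch (s * y) n * poch (- (s * y)) n)
     \<longlonglongrightarrow> P y * P (- y) * P (s * y) * P (- (s * y))"
    by (intro tendsto_intros poch_tendsto)
  ultimately show ?thesis using LIMSEQ_unique by simp
qed

end

section \<open>Bilateral sums over two geometric progressions\<close>

context nome
begin

text \<open>Says that \<open>w\<close> is not an integer power of \<open>q\<close>: the second
  condition excludes the exponents at most 0, the third the positive ones.\<close>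

definition generic :: "complex \<Rightarrow> bool" where
  "generic w \<longleftrightarrow> w \<noteq> 0 \<and> P w \<noteq> 0 \<and> P (q / w) \<noteq> 0"

definition weight :: "complex \<Rightarrow> nat \<Rightarrow> complex" where
  "weight w j = q ^ j / (poch q j * poch (q / w) j * P w)"

text \<open>A normalised Jackson q-integral. \<open>weight w j\<close> is
  \<open>q ^ j * P (q * y) * P (q * y / w)\<close> at \<open>y = q ^ j\<close>, divided by
  \<open>P q * P w * P (q / w)\<close>; by \<open>P_inverse_eq\<close> the second half has the same
  normalisation up to the factor \<open>- w\<close>. So this is the q-integral of
  \<open>P (q * y) * P (q * y / w) * \<psi> y\<close> from \<open>w\<close> to 1, divided by
  \<open>(1 - q) * P q * P w * P (q / w)\<close>.\<close>

definition lat_sum :: "complex \<Rightarrow> (complex \<Rightarrow> complex) \<Rightarrow> complex" where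
  "lat_sum w \<psi> = (\<Sum>j. weight w j * \<psi> (q ^ j)) + (\<Sum>j. weight (1 / w) j * \<psi> (w * q ^ j))"

definition lat :: "complex \<Rightarrow> complex set" where
  "lat w = range (\<lambda>j. q ^ j) \<union> range (\<lambda>j. w * q ^ j)"

definition lat_bdd :: "complex \<Rightarrow> (complex \<Rightarrow> complex) \<Rightarrow> bool" where
  "lat_bdd w \<psi> \<longleftrightarrow> bounded (\<psi> ` lat w)"

text \<open>The inversion \<open>theta (1 / w) q = - theta w q / w\<close>. Its sign is what makes
  the boundary terms at the common limit point 0 cancel.\<close>

lemma P_inverse_eq: "w \<noteq> 0 \<Longrightarrow> P (q * w) * P (1 / w) * w = - (P w * P (q / w))"
  unfolding P_step [of w] P_step [of "1 / w"] by (simp add: field_simps)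

lemma generic_inverse:
  assumes "generic w" shows "generic (1 / w)"
proof -
  have "P (q * w) * P (1 / w) \<noteq> 0"
    using P_inverse_eq [of w] assms by (auto simp: generic_def)
  then show ?thesis using assms by (simp add: generic_def)
qed

lemma generic_div_q:
  assumes "generic w" shows "generic (w / q)"
proof -
  have "w \<noteq> q" using assms P_step [of 1] by (auto simp: generic_def)
  then have "P (w / q) \<noteq> 0" "P (q / (w / q)) \<noteq> 0"
    using P_step [of "w / q"] P_step [of "q / w"] assms by (auto simp: generic_def field_simps)
  then show ?thesis using assms by (simp add: generic_def)
qed

lemma generic_div_qpow: "generic w \<Longrightarrow> generic (w / q ^ k)"
proof (induction k)
  case (Suc k)
  then show ?case using generic_div_q [of "w / q ^ k"] by (simp add: field_simps)
qed simp

section \<open>Boundedness on the two progressions and convergence of the sums over them\<close>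

lemma lat_intros [simp]: "q ^ j \<in> lat w" "w * q ^ j \<in> lat w"
  by (auto simp: lat_def)

lemma lat_q: "y \<in> lat w \<Longrightarrow> q * y \<in> lat w"
  by (auto simp: lat_def mult.left_commute simp flip: power_Suc)

lemma lat_bddI: "(\<And>y. y \<in> lat w \<Longrightarrow> norm (\<psi> y) \<le> C) \<Longrightarrow> lat_bdd w \<psi>"
  unfolding lat_bdd_def by (auto simp: bounded_iff)

lemma lat_bddE:
  assumes "lat_bdd w \<psi>"
  obtains C where "C > 0" "\<And>y. y \<in> lat w \<Longrightarrow> norm (\<psi> y) \<le> C"
  using assms unfolding lat_bdd_def bounded_pos by auto

lemma norm_lat_le:
  assumes "y \<in> lat w" shows "norm y \<le> 1 + norm w"
proof -
  have "norm q ^ j \<le> 1" for j using q_less by (intro power_le_one) auto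
  then have "norm (q ^ j) \<le> 1 + norm w" "norm (w * q ^ j) \<le> 1 + norm w" for j
    using mult_left_mono [of "norm q ^ j" 1 "norm w"]
    by (auto simp: norm_mult norm_power intro: add_increasing2 add_increasing)
  then show ?thesis using assms by (auto simp: lat_def)
qed

lemma norm_mult_lat_le:
  assumes "y \<in> lat w" shows "norm (x * q ^ n * y) \<le> norm x * (1 + norm w)"
proof -
  have "norm x * norm q ^ n * norm y \<le> norm x * 1 * (1 + norm w)"
    using norm_lat_le [OF assms] q_less by (intro mult_mono power_le_one) auto
  then show ?thesis by (simp add: norm_mult norm_power)
qed

lemma lat_bdd_const [intro]: "lat_bdd w (\<lambda>y. c)"
  by (rule lat_bddI [of _ _ "norm c"]) auto

lemma lat_bdd_ident [intro]: "lat_bdd w (\<lambda>y. y)"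
  by (rule lat_bddI [of _ _ "1 + norm w"]) (simp add: norm_lat_le)

lemma lat_bdd_mult [intro]:
  assumes "lat_bdd w f" "lat_bdd w g" shows "lat_bdd w (\<lambda>y. f y * g y)"
proof -
  obtain C D where "C > 0" "\<And>y. y \<in> lat w \<Longrightarrow> norm (f y) \<le> C"
    "D > 0" "\<And>y. y \<in> lat w \<Longrightarrow> norm (g y) \<le> D"
    using assms by (metis lat_bddE)
  then show ?thesis
    by (intro lat_bddI [of _ _ "C * D"]) (auto simp: norm_mult intro!: mult_mono)
qed

lemma lat_bdd_add [intro]:
  assumes "lat_bdd w f" "lat_bdd w g" shows "lat_bdd w (\<lambda>y. f y + g y)"
proof -
  obtain C D where "C > 0" "\<And>y. y \<in> lat w \<Longrightarrow> norm (f y) \<le> C"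
    "D > 0" "\<And>y. y \<in> lat w \<Longrightarrow> norm (g y) \<le> D"
    using assms by (metis lat_bddE)
  then show ?thesis
    by (intro lat_bddI [of _ _ "C + D"]) (auto intro!: norm_triangle_le add_mono)
qed

lemma lat_bdd_diff [intro]:
  assumes "lat_bdd w f" "lat_bdd w g" shows "lat_bdd w (\<lambda>y. f y - g y)"
  using lat_bdd_add [OF assms(1) lat_bdd_mult [OF lat_bdd_const [of w "-1"] assms(2)]] by simp

lemma lat_bdd_prod [intro]: "(\<And>i. i \<in> I \<Longrightarrow> lat_bdd w (f i)) \<Longrightarrow> lat_bdd w (\<lambda>y. \<Prod>i\<in>I. f i y)"
  by (induction I rule: infinite_finite_induct) auto

lemma lat_bdd_P [intro]:
  assumes "lat_bdd w f" shows "lat_bdd w (\<lambda>y. P (f y))"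
proof -
  obtain C where "\<And>y. y \<in> lat w \<Longrightarrow> norm (f y) \<le> C" using assms by (metis lat_bddE)
  then show ?thesis by (intro lat_bddI [of _ _ "pbound C"] norm_P_le)
qed

text \<open>The two hypotheses are non-vanishing at the first points, 1 and \<open>w\<close>, of the
  two progressions; \<open>norm_inverse_P_shift_le\<close> covers the rest.\<close>

lemma lat_bdd_div_P:
  assumes f: "lat_bdd w f" and "P c \<noteq> 0" "P (c * w) \<noteq> 0"
  shows "lat_bdd w (\<lambda>y. f y / P (c * y))"
proof -
  define C where "C = max (pbound (norm c) / norm (P c)) (pbound (norm (c * w)) / norm (P (c * w)))"
  have "norm (inverse (P (c * y))) \<le> C" if "y \<in> lat w" for y
  proof -
    from that consider j where "y = q ^ j" | j where "y = w * q ^ j"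
      by (auto simp: lat_def)
    then show ?thesis
      using norm_inverse_P_shift_le [OF assms(2) order_refl]
        norm_inverse_P_shift_le [OF assms(3) order_refl]
      unfolding C_def by cases (auto simp: mult.assoc [symmetric] intro: max.coboundedI1 max.coboundedI2)
  qed
  then have "lat_bdd w (\<lambda>y. inverse (P (c * y)))" by (rule lat_bddI)
  with f have "lat_bdd w (\<lambda>y. f y * inverse (P (c * y)))" ..
  then show ?thesis by (simp add: divide_inverse)
qed

text \<open>At lattice points the argument is \<open>c\<close> or \<open>c * w ^ 2\<close> times a
  power of \<open>q\<close>. The bound is uniform in \<open>n\<close> as well, as required when
  \<open>a\<close> is replaced by \<open>a * q ^ n\<close> with \<open>n\<close> tending to
  infinity.\<close>

lemma norm_inverse_P_square_le:
  assumes "P c \<noteq> 0" "P (c * w ^ 2) \<noteq> 0"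
  obtains C where "C > 0" "\<And>n y. y \<in> lat w \<Longrightarrow> norm (inverse (P (c * q ^ n * y ^ 2))) \<le> C"
proof -
  define C where "C = max (pbound (norm c) / norm (P c)) (pbound (norm (c * w ^ 2)) / norm (P (c * w ^ 2)))"
  have "norm (inverse (P (c * q ^ n * y ^ 2))) \<le> C" if "y \<in> lat w" for n y
  proof -
    from that consider j where "c * q ^ n * y ^ 2 = c * q ^ (n + j * 2)"
      | j where "c * q ^ n * y ^ 2 = c * w ^ 2 * q ^ (n + j * 2)"
      by (fastforce simp: lat_def power_mult power_mult_distrib power_add)
    then show ?thesis
    proof cases
      case 1
      then show ?thesis
        unfolding C_def by (simp only: max.coboundedI1 norm_inverse_P_shift_le [OF assms(1) order_refl])
    next
      case 2
      then show ?thesis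
        unfolding C_def by (simp only: max.coboundedI2 norm_inverse_P_shift_le [OF assms(2) order_refl])
    qed
  qed
  moreover have "C > 0" using assms by (simp add: C_def less_max_iff_disj)
  ultimately show ?thesis using that by blast
qed

lemma lat_bdd_div_P_square:
  assumes f: "lat_bdd w f" and "P c \<noteq> 0" "P (c * w ^ 2) \<noteq> 0"
  shows "lat_bdd w (\<lambda>y. f y / P (c * y ^ 2))"
proof -
  obtain C where "\<And>n y. y \<in> lat w \<Longrightarrow> norm (inverse (P (c * q ^ n * y ^ 2))) \<le> C"
    using norm_inverse_P_square_le [OF assms(2,3)] by blast
  from this [of _ 0] have "lat_bdd w (\<lambda>y. inverse (P (c * y ^ 2)))" by (intro lat_bddI) simp
  with f have "lat_bdd w (\<lambda>y. f y * inverse (P (c * y ^ 2)))" ..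
  then show ?thesis by (simp add: divide_inverse)
qed

lemma weight_bound:
  assumes "generic w"
  obtains C where "C > 0" "\<And>j. norm (weight w j) \<le> C * norm q ^ j"
proof -
  obtain C1 where C1: "C1 > 0" "\<And>j. norm (inverse (poch q j)) \<le> C1"
    using inverse_poch_bounded [OF P_q_nonzero] by blast
  obtain C2 where C2: "C2 > 0" "\<And>j. norm (inverse (poch (q / w) j)) \<le> C2"
    using inverse_poch_bounded [of "q / w"] assms unfolding generic_def by blast
  have "norm (weight w j) \<le> C1 * C2 * norm (inverse (P w)) * norm q ^ j" for j
  proof -
    have "norm (weight w j) = norm (inverse (poch q j)) * norm (inverse (poch (q / w) j)) *
        norm (inverse (P w)) * norm q ^ j"
      by (simp add: weight_def norm_divide norm_mult norm_power norm_inverse divide_inverse)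
    also have "\<dots> \<le> C1 * C2 * norm (inverse (P w)) * norm q ^ j"
      using C1 C2 by (intro mult_right_mono mult_mono) auto
    finally show ?thesis .
  qed
  moreover have "C1 * C2 * norm (inverse (P w)) > 0"
    using C1 C2 assms by (simp add: generic_def)
  ultimately show ?thesis using that by blast
qed

lemma weight_summable:
  assumes "generic w" and "\<And>j. norm (x j) \<le> C"
  shows "summable (\<lambda>j. norm (weight w j * x j))"
proof -
  obtain D where D: "D > 0" "\<And>j. norm (weight w j) \<le> D * norm q ^ j" using weight_bound [OF assms(1)] by blast
  have "summable (\<lambda>j. D * norm q ^ j * C)"
    using q_less by (intro summable_mult summable_mult2 summable_geometric) auto
  then show ?thesis
    by (rule summable_comparison_test')
       (use D assms(2) in \<open>auto simp: norm_mult intro!: mult_mono order_trans [OF norm_ge_zero D(2)]\<close>)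
qed

lemma lat_sum_summable:
  assumes "generic w" "lat_bdd w \<psi>"
  shows "summable (\<lambda>j. weight w j * \<psi> (q ^ j))" "summable (\<lambda>j. weight (1 / w) j * \<psi> (w * q ^ j))"
proof -
  obtain C where "\<And>y. y \<in> lat w \<Longrightarrow> norm (\<psi> y) \<le> C" using assms by (metis lat_bddE)
  then show "summable (\<lambda>j. weight w j * \<psi> (q ^ j))" "summable (\<lambda>j. weight (1 / w) j * \<psi> (w * q ^ j))"
    using assms generic_inverse by (auto intro!: summable_norm_cancel [OF weight_summable [where C = C]])
qed

lemma lat_sum_cong: "(\<And>y. y \<in> lat w \<Longrightarrow> f y = g y) \<Longrightarrow> lat_sum w f = lat_sum w g"
  by (simp add: lat_sum_def)

lemma lat_sum_add: "generic w \<Longrightarrow> lat_bdd w f \<Longrightarrow> lat_bdd w g \<Longrightarrow> lat_sum w (\<lambda>y. f y + g y) = lat_sum w f + lat_sum w g"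
  unfolding lat_sum_def by (simp add: lat_sum_summable suminf_add [symmetric] distrib_left)

lemma lat_sum_cmult: "generic w \<Longrightarrow> lat_bdd w f \<Longrightarrow> lat_sum w (\<lambda>y. c * f y) = c * lat_sum w f"
  unfolding lat_sum_def by (simp add: lat_sum_summable suminf_mult [symmetric] distrib_left mult_ac)

lemma lat_sum_diff: "generic w \<Longrightarrow> lat_bdd w f \<Longrightarrow> lat_bdd w g \<Longrightarrow> lat_sum w (\<lambda>y. f y - g y) = lat_sum w f - lat_sum w g"
  using lat_sum_add [of w f "\<lambda>y. - 1 * g y"] lat_sum_cmult [of w g "-1"] lat_bdd_mult [OF lat_bdd_const [of w "-1"], of g]
  by simp

text \<open>The q-Pearson equation of the weight: the factor on the left is
  \<open>(1 - y) * (1 - y / w)\<close> at \<open>y = q ^ Suc j\<close>. It is the source of all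
  summations by parts over the lattice.\<close>

lemma weight_Suc:
  assumes "generic w"
  shows "weight w (Suc j) * ((1 - q ^ Suc j) * (1 - q ^ Suc j / w)) = q * weight w j"
proof -
  have "poch (q / w) (Suc j) \<noteq> 0" using assms by (simp add: generic_def poch_nonzero)
  then have "poch (q / w) (Suc j) = poch (q / w) j * (1 - q ^ Suc j / w)" "1 - q ^ Suc j / w \<noteq> 0"
    by (simp_all add: poch_Suc)
  moreover have "poch q (Suc j) = poch q j * (1 - q ^ Suc j)" "1 - q ^ Suc j \<noteq> 0"
    using one_minus_qpow_nonzero [of j] by (simp_all add: poch_Suc)
  moreover have "w \<noteq> 0" using assms by (simp add: generic_def)
  ultimately show ?thesis
    by (simp add: weight_def)
qed

lemma weight_tendsto:
  assumes "generic w"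
  shows "(\<lambda>j. weight w j / q ^ j) \<longlonglongrightarrow> 1 / (P q * P (q / w) * P w)"
proof -
  have "(\<lambda>j. 1 / (poch q j * poch (q / w) j * P w)) \<longlonglongrightarrow> 1 / (P q * P (q / w) * P w)"
    using assms by (intro tendsto_intros poch_tendsto) (auto simp: generic_def)
  then show ?thesis by (simp add: weight_def)
qed

text \<open>By \<open>weight_Suc\<close> the partial sums collapse to their last boundary term.
  There is no boundary term at the start, because \<open>1 - q ^ 0\<close> vanishes, and the one at
  infinity is the limit of \<open>\<psi>\<close> times that of
  \<open>weight w j / q ^ j\<close>.\<close>

lemma half_telescope:
  assumes w: "generic w" and \<psi>: "(\<lambda>j. \<psi> (Suc j)) \<longlonglongrightarrow> l"
    and \<xi>: "\<And>j. \<xi> j * q ^ j = (1 - q ^ j) * (1 - q ^ j / w) * \<psi> j - \<psi> (Suc j)"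
  shows "(\<lambda>j. weight w j * \<xi> j) sums (- l / (P q * P (q / w) * P w))"
proof -
  define E where "E j = weight w j / q ^ j * \<psi> (Suc j)" for j
  have "(\<Sum>j<Suc n. weight w j * \<xi> j) = - E n" for n
  proof (induction n)
    case 0
    then show ?case using \<xi> [of 0] by (simp add: E_def)
  next
    case (Suc n)
    have "weight w (Suc n) * \<xi> (Suc n) = weight w (Suc n) * (\<xi> (Suc n) * q ^ Suc n) / q ^ Suc n" by simp
    also have "\<dots> = weight w (Suc n) * ((1 - q ^ Suc n) * (1 - q ^ Suc n / w)) * \<psi> (Suc n) / q ^ Suc n - E (Suc n)"
      unfolding \<xi> E_def by (simp add: diff_divide_distrib right_diff_distrib mult.assoc)
    also have "\<dots> = E n - E (Suc n)"
      unfolding weight_Suc [OF w] by (simp add: E_def)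
    finally show ?case using Suc.IH by simp
  qed
  moreover have "(\<lambda>n. - E n) \<longlonglongrightarrow> - (1 / (P q * P (q / w) * P w) * l)"
    unfolding E_def by (intro tendsto_intros weight_tendsto w \<psi>)
  ultimately have "(\<lambda>n. \<Sum>j<Suc n. weight w j * \<xi> j) \<longlonglongrightarrow> - (1 / (P q * P (q / w) * P w) * l)"
    by simp
  then show ?thesis
    unfolding sums_def by (subst filterlim_sequentially_Suc [symmetric]) simp
qed

text \<open>The boundary terms of the two telescoping sums cancel each other.\<close>

lemma lat_sum_exact:
  assumes w: "generic w" and \<psi>: "isCont \<psi> 0"
    and \<xi>: "\<And>y. y \<in> lat w \<Longrightarrow> \<xi> y * y = (1 - y) * (1 - y / w) * \<psi> y - \<psi> (q * y)"
  shows "lat_sum w \<xi> = 0"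
proof -
  have w0: "w \<noteq> 0" using w by (simp add: generic_def)
  have lim: "(\<lambda>j. \<psi> (x * q ^ Suc j)) \<longlonglongrightarrow> \<psi> 0" for x
  proof -
    have "(\<lambda>j. x * q ^ Suc j) \<longlonglongrightarrow> x * 0"
      using LIMSEQ_Suc [OF qpow_tendsto_0] by (intro tendsto_intros)
    then show ?thesis using isCont_tendsto_compose [OF \<psi>] by simp
  qed
  have "(\<lambda>j. weight w j * \<xi> (q ^ j)) sums (- \<psi> 0 / (P q * P (q / w) * P w))"
    by (rule half_telescope [where \<psi> = "\<lambda>j. \<psi> (q ^ j)"])
       (use w lim [of 1] \<xi> [OF lat_intros(1)] in auto)
  \<comment> \<open>At \<open>y = w * q ^ j\<close> the factors \<open>1 - y\<close> and
    \<open>1 - y / w\<close> exchange their roles, which amounts to replacing \<open>w\<close> by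
    \<open>1 / w\<close>. The extra \<open>w\<close> reduces the multiplier \<open>y\<close> to
    \<open>q ^ j\<close>; it is divided out again below.\<close>
  moreover have "(\<lambda>j. weight (1 / w) j * (w * \<xi> (w * q ^ j))) sums (- \<psi> 0 / (P q * P (q / (1 / w)) * P (1 / w)))"
  proof (rule half_telescope [where \<psi> = "\<lambda>j. \<psi> (w * q ^ j)"])
    show "w * \<xi> (w * q ^ j) * q ^ j = (1 - q ^ j) * (1 - q ^ j / (1 / w)) * \<psi> (w * q ^ j) - \<psi> (w * q ^ Suc j)" for j
      using \<xi> [OF lat_intros(2), of j] w0 by (simp add: mult_ac)
  qed (use generic_inverse [OF w] lim [of w] in auto)
  then have "(\<lambda>j. 1 / w * (weight (1 / w) j * (w * \<xi> (w * q ^ j)))) sums (1 / w * (- \<psi> 0 / (P q * P (q * w) * P (1 / w))))"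
    by (intro sums_mult) simp
  then have "(\<lambda>j. weight (1 / w) j * \<xi> (w * q ^ j)) sums (- \<psi> 0 / (P q * (P (q * w) * P (1 / w) * w)))"
    using w0 by (simp add: mult_ac)
  ultimately have "lat_sum w \<xi> = - \<psi> 0 / (P q * P (q / w) * P w) - \<psi> 0 / (P q * (P (q * w) * P (1 / w) * w))"
    unfolding lat_sum_def by (simp add: sums_iff)
  also have "\<dots> = 0"
    unfolding P_inverse_eq [OF w0] by (simp add: mult_ac)
  finally show ?thesis .
qed

text \<open>The factor \<open>y - 1\<close> kills the first point of the progression from 1. The
  remaining points \<open>q ^ Suc j\<close> and \<open>w * q ^ j\<close> are \<open>q\<close> times
  the points of \<open>lat (w / q)\<close>, and the weights match up to the constant
  \<open>w\<close>.\<close>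

lemma lat_sum_shift:
  assumes w: "generic w" and \<psi>: "lat_bdd w \<psi>"
  shows "lat_sum w (\<lambda>y. (y - 1) * \<psi> y) = w * lat_sum (w / q) (\<lambda>y. \<psi> (q * y))"
proof -
  have w0: "w \<noteq> 0" and Pw: "P w \<noteq> 0" "P (q / w) \<noteq> 0" using w by (auto simp: generic_def)
  have b: "lat_bdd w (\<lambda>y. (y - 1) * \<psi> y)" using \<psi> by (intro lat_bdd_mult lat_bdd_diff) auto
  have 1: "weight w (Suc j) * ((q ^ Suc j - 1) * x) = w * (weight (w / q) j * x)" for j x
  proof -
    have "weight w (Suc j) * (1 - q ^ Suc j) = q ^ Suc j / (poch q j * poch (q / w) (Suc j) * P w)"
      using one_minus_qpow_nonzero [of j] by (simp add: weight_def poch_Suc)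
    also have "poch (q / w) (Suc j) = (1 - q / w) * poch (q / (w / q)) j"
      by (simp add: poch_Suc_shift)
    also have "q ^ Suc j / (poch q j * ((1 - q / w) * poch (q / (w / q)) j) * P w) =
        - (w * (q ^ j / (poch q j * poch (q / (w / q)) j * ((1 - w / q) * P w))))"
      using w0 generic_div_q [OF w] P_step [of "w / q"] Pw(2) P_step [of "q / w"]
      by (auto simp: divide_simps generic_def) (simp_all add: algebra_simps)
    also have "(1 - w / q) * P w = P (w / q)" using P_step [of "w / q"] by simp
    finally have "weight w (Suc j) * (1 - q ^ Suc j) = - (w * weight (w / q) j)"
      by (simp add: weight_def)
    then have "weight w (Suc j) * (1 - q ^ Suc j) * - x = - (w * weight (w / q) j) * - x"
      by (rule arg_cong)
    then show ?thesis by (simp add: algebra_simps)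
  qed
  have 2: "weight (1 / w) j * (w * q ^ j - 1) = w * weight (1 / (w / q)) j" for j
  proof -
    have g: "P (1 / w) \<noteq> 0" "P (q * w) \<noteq> 0" using generic_inverse [OF w] by (auto simp: generic_def)
    have "w \<noteq> 1" using g P_step [of 1] by auto
    have "poch w (Suc j) = (1 - w) * poch (q * w) j"
      by (simp add: poch_Suc_shift mult.commute)
    then have e: "poch w j * (1 - w * q ^ j) = (1 - w) * poch (q * w) j" by (simp add: poch_Suc)
    have nz: "poch (q * w) j \<noteq> 0" "poch w j \<noteq> 0" using g Pw poch_nonzero by blast+
    have "weight (1 / w) j * (1 - w * q ^ j) = q ^ j * (1 - w * q ^ j) / (poch q j * poch (q * w) j * P (1 / w))"
      by (simp add: weight_def)
    also have "\<dots> = q ^ j * (1 - w) / (poch q j * poch w j * P (1 / w))"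
      using e nz g by (simp add: divide_simps) (simp add: mult_ac)
    also have "\<dots> = - w * (q ^ j * (1 - 1 / w) / (poch q j * poch w j * P (1 / w)))"
    proof -
      have "1 - w = - w * (1 - 1 / w)" using w0 by (simp add: field_simps)
      then show ?thesis by (metis (no_types) mult.left_commute times_divide_eq_right)
    qed
    also have "P (1 / w) = (1 - 1 / w) * P (q / w)" using P_step [of "1 / w"] by simp
    also have "- w * (q ^ j * (1 - 1 / w) / (poch q j * poch w j * ((1 - 1 / w) * P (q / w)))) = - w * weight (1 / (w / q)) j"
      using w0 \<open>w \<noteq> 1\<close> by (simp add: weight_def)
    finally show ?thesis by (simp add: algebra_simps)
  qed
  have "(\<Sum>j. weight w j * ((q ^ j - 1) * \<psi> (q ^ j))) = (\<Sum>j. weight w (Suc j) * ((q ^ Suc j - 1) * \<psi> (q ^ Suc j)))"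
    using suminf_split_head [OF lat_sum_summable(1) [OF w b]] by simp
  also have "\<dots> = (\<Sum>j. w * (weight (w / q) j * \<psi> (q * q ^ j)))"
    unfolding 1 by simp
  also have "\<dots> = w * (\<Sum>j. weight (w / q) j * \<psi> (q * q ^ j))"
  proof (rule suminf_mult)
    show "summable (\<lambda>j. weight (w / q) j * \<psi> (q * q ^ j))"
      using lat_sum_summable(1) [OF w b] unfolding summable_Suc_iff [of "\<lambda>j. weight w j * _ j", symmetric] 1
      using w0 by (simp add: summable_cmult_iff)
  qed
  finally have A: "(\<Sum>j. weight w j * ((q ^ j - 1) * \<psi> (q ^ j))) = w * (\<Sum>j. weight (w / q) j * \<psi> (q * q ^ j))" .
  have e2: "weight (1 / w) j * ((w * q ^ j - 1) * \<psi> (w * q ^ j)) = w * (weight (1 / (w / q)) j * \<psi> (q * (w / q * q ^ j)))" for j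
    using 2 [of j] by (simp flip: mult.assoc)
  have "(\<Sum>j. weight (1 / w) j * ((w * q ^ j - 1) * \<psi> (w * q ^ j))) = w * (\<Sum>j. weight (1 / (w / q)) j * \<psi> (q * (w / q * q ^ j)))"
    unfolding e2 using lat_sum_summable(2) [OF w b] w0 unfolding e2 summable_cmult_iff by (simp add: suminf_mult)
  then show ?thesis unfolding lat_sum_def A by (simp add: distrib_left)
qed

lemma lat_bdd_shift: "lat_bdd w \<psi> \<Longrightarrow> lat_bdd (w / q) (\<lambda>y. \<psi> (q * y))"
proof -
  assume "lat_bdd w \<psi>"
  then obtain C where "\<And>y. y \<in> lat w \<Longrightarrow> norm (\<psi> y) \<le> C" by (metis lat_bddE)
  moreover have "q * y \<in> lat w" if "y \<in> lat (w / q)" for y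
    using that by (auto simp: lat_def simp flip: power_Suc)
  ultimately show ?thesis by (intro lat_bddI) auto
qed

text \<open>Each use of \<open>lat_sum_shift\<close> removes the current first point. Rescaling the
  remaining differences by \<open>q\<close> produces a power of \<open>q\<close> that turns the
  factors \<open>w / q\<close> back into \<open>w\<close>.\<close>

lemma lat_sum_shift_power:
  assumes "generic w" "lat_bdd w \<psi>"
  shows "lat_sum w (\<lambda>y. (\<Prod>i<k. y - q ^ i) * \<psi> y) = w ^ k * lat_sum (w / q ^ k) (\<lambda>y. \<psi> (q ^ k * y))"
  using assms
proof (induction k arbitrary: w \<psi>)
  case (Suc k)
  have "lat_sum w (\<lambda>y. (\<Prod>i<Suc k. y - q ^ i) * \<psi> y) = lat_sum w (\<lambda>y. (y - 1) * ((\<Prod>i<k. y - q ^ Suc i) * \<psi> y))"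
    by (simp add: prod.lessThan_Suc_shift mult.assoc del: prod.lessThan_Suc power_Suc)
  also have "\<dots> = w * lat_sum (w / q) (\<lambda>y. (\<Prod>i<k. q * y - q ^ Suc i) * \<psi> (q * y))"
    using Suc.prems by (intro lat_sum_shift lat_bdd_mult lat_bdd_prod lat_bdd_diff) auto
  also have "(\<lambda>y. (\<Prod>i<k. q * y - q ^ Suc i) * \<psi> (q * y)) = (\<lambda>y. (\<Prod>i<k. y - q ^ i) * (q ^ k * \<psi> (q * y)))"
  proof
    fix y
    have "(\<Prod>i<k. q * y - q ^ Suc i) = (\<Prod>i<k. q * (y - q ^ i))"
      by (simp add: right_diff_distrib)
    then show "(\<Prod>i<k. q * y - q ^ Suc i) * \<psi> (q * y) = (\<Prod>i<k. y - q ^ i) * (q ^ k * \<psi> (q * y))"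
      by (simp add: prod.distrib)
  qed
  also have "lat_sum (w / q) \<dots> = (w / q) ^ k * lat_sum (w / q / q ^ k) (\<lambda>y. q ^ k * \<psi> (q * (q ^ k * y)))"
    using Suc.prems by (intro Suc.IH generic_div_q lat_bdd_mult lat_bdd_shift) auto
  also have "\<dots> = (w / q) ^ k * (q ^ k * lat_sum (w / q ^ Suc k) (\<lambda>y. \<psi> (q ^ Suc k * y)))"
  proof -
    have "lat_bdd (w / q ^ n) (\<lambda>y. \<psi> (q ^ n * y))" for n
    proof (induction n)
      case (Suc n)
      then show ?case using lat_bdd_shift [OF Suc] by (simp add: mult_ac)
    qed (use Suc.prems in simp)
    from lat_sum_cmult [OF generic_div_qpow [OF Suc.prems(1)] this, of "Suc k" "q ^ k"]
    show ?thesis by (simp add: mult_ac)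
  qed
  finally show ?case by (simp add: power_divide)
qed simp

end

section \<open>A balanced sum over two geometric progressions\<close>

text \<open>Balls are uncountable. This serves the two limits taken through generic parameter
  values: in \<open>a\<close> for the total mass of the weight, and in \<open>z\<close> for the
  theorem itself.\<close>

lemma sequence_avoiding_countable:
  fixes z :: complex and B :: "complex set"
  assumes "countable B"
  obtains s where "s \<longlonglongrightarrow> z" "\<And>n::nat. s n \<notin> B"
proof -
  have "\<exists>x. x \<in> ball z (1 / real (Suc n)) - B" for n
  proof -
    have "uncountable (ball z (1 / real (Suc n)))" by (intro uncountable_ball) simp
    then have "\<not> ball z (1 / real (Suc n)) \<subseteq> B" using assms countable_subset by blast
    then show ?thesis by blast
  qed
  then obtain s where s: "\<And>n. s n \<in> ball z (1 / real (Suc n)) - B" by metis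
  have "s \<longlonglongrightarrow> z"
  proof (rule LIMSEQ_norm_0 [THEN LIM_zero_cancel])
    show "norm (s n - z) < 1 / real (Suc n)" for n
      using s [of n] by (simp add: dist_norm norm_minus_commute)
  qed
  with s show ?thesis using that by blast
qed

context nome
begin

lemma countable_zeros_mult: "c \<noteq> 0 \<Longrightarrow> countable {x. P (c * x) = 0}"
proof (rule countable_subset)
  show "c \<noteq> 0 \<Longrightarrow> {x. P (c * x) = 0} \<subseteq> range (\<lambda>k. 1 / (c * q ^ k))"
    by (auto simp: P_eq_0_iff field_simps)
qed simp

lemma countable_zeros_div: "countable {x. P (c / x) = 0}"
proof (rule countable_subset)
  show "{x. P (c / x) = 0} \<subseteq> range (\<lambda>k. c * q ^ k)"
    by (auto simp: P_eq_0_iff field_simps split: if_splits)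
qed simp

lemma lat_P_square_nonzero:
  assumes "P c \<noteq> 0" "P (c * w ^ 2) \<noteq> 0" "y \<in> lat w"
  shows "P (c * y ^ 2) \<noteq> 0"
proof -
  from assms(3) consider j where "c * y ^ 2 = c * q ^ (j * 2)" | j where "c * y ^ 2 = c * w ^ 2 * q ^ (j * 2)"
    by (fastforce simp: lat_def power_mult power_mult_distrib)
  then show ?thesis by cases (use assms P_shift_nonzero in metis)+
qed

section \<open>Dominated convergence and norm bounds for lattice sums\<close>

lemma weight_suminf_tendsto:
  assumes w: "generic w" and lim: "\<And>j. (\<lambda>n. x n j) \<longlonglongrightarrow> y j" and bd: "\<And>n j. norm (x n j) \<le> C"
  shows "(\<lambda>n. \<Sum>j. weight w j * x n j) \<longlonglongrightarrow> (\<Sum>j. weight w j * y j)"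
proof -
  obtain D where D: "D > 0" "\<And>j. norm (weight w j) \<le> D * norm q ^ j" using weight_bound [OF w] by blast
  have "norm (weight w k * x n k) \<le> D * norm q ^ k * C" for n k
    unfolding norm_mult using D bd by (intro mult_mono order_trans [OF norm_ge_zero D(2)]) auto
  moreover have "summable (\<lambda>j. D * norm q ^ j * C)"
    using q_less by (intro summable_mult summable_mult2 summable_geometric) auto
  ultimately show ?thesis
    by (intro tannerys_theorem [THEN conjunct2, THEN conjunct2] tendsto_intros lim always_eventually) auto
qed

lemma lat_sum_tendsto:
  assumes w: "generic w" and lim: "\<And>y. y \<in> lat w \<Longrightarrow> (\<lambda>n. f n y) \<longlonglongrightarrow> g y"
    and bd: "\<And>n y. y \<in> lat w \<Longrightarrow> norm (f n y) \<le> C"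
  shows "(\<lambda>n. lat_sum w (f n)) \<longlonglongrightarrow> lat_sum w g"
  unfolding lat_sum_def using generic_inverse [OF w]
  by (intro tendsto_add weight_suminf_tendsto [where C = C] w lim bd) auto

lemma lat_sum_norm_bounded:
  assumes w: "generic w"
  obtains M where "M \<ge> 0" "\<And>f C. (\<And>y. y \<in> lat w \<Longrightarrow> norm (f y) \<le> C) \<Longrightarrow> norm (lat_sum w f) \<le> M * C"
proof -
  obtain D where D: "D > 0" "\<And>j. norm (weight w j) \<le> D * norm q ^ j" using weight_bound [OF w] by blast
  obtain E where E: "E > 0" "\<And>j. norm (weight (1 / w) j) \<le> E * norm q ^ j" using weight_bound [OF generic_inverse [OF w]] by blast
  have half: "norm (\<Sum>j. weight v j * x j) \<le> F / (1 - norm q) * C"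
    if F: "\<And>j. norm (weight v j) \<le> F * norm q ^ j" and x: "\<And>j. norm (x j) \<le> C" for v F C x
  proof -
    have "summable (\<lambda>j. norm q ^ j * (F * C))"
      using q_less by (intro summable_mult2 summable_geometric) auto
    moreover have "norm (weight v j * x j) \<le> norm q ^ j * (F * C)" for j
    proof -
      have "norm (weight v j * x j) \<le> (F * norm q ^ j) * C"
        unfolding norm_mult by (intro mult_mono F x order_trans [OF norm_ge_zero F]) auto
      then show ?thesis by (simp add: mult_ac)
    qed
    ultimately have "norm (\<Sum>j. weight v j * x j) \<le> (\<Sum>j. norm q ^ j * (F * C))"
      by (intro norm_suminf_le)
    also have "\<dots> = F / (1 - norm q) * C"
      using q_less by (simp add: suminf_mult2 [symmetric] suminf_geometric summable_geometric)
    finally show ?thesis .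
  qed
  have "norm (lat_sum w f) \<le> (D / (1 - norm q) + E / (1 - norm q)) * C"
    if "\<And>y. y \<in> lat w \<Longrightarrow> norm (f y) \<le> C" for f C
    unfolding lat_sum_def distrib_right
    by (intro norm_triangle_le add_mono half D E that lat_intros)
  moreover have "D / (1 - norm q) + E / (1 - norm q) \<ge> 0"
    using D E q_less by (intro add_nonneg_nonneg divide_nonneg_nonneg) auto
  ultimately show ?thesis using that by blast
qed

lemma P_cont: "isCont f x \<Longrightarrow> isCont (\<lambda>x. P (f x)) x"
  unfolding isCont_def by (rule P_tendsto)

text \<open>The part of the integrand that carries neither \<open>b\<close> nor \<open>c\<close>.
  The factor \<open>P (q * a * y)\<close> stems from the very-well-poised expansion, the other two
  from \<open>f\<close>.\<close>

definition kern :: "complex \<Rightarrow> complex \<Rightarrow> complex \<Rightarrow> complex" where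
  "kern w a y = P (q ^ 2 * a * w * y) * P (q * a * y) / P (q * a * y ^ 2)"

text \<open>The sum of \<open>defect w a\<close> is the difference of the sums of \<open>kern\<close> for \<open>(w, a)\<close> and
  \<open>(w / q, a q\<^sup>2)\<close>. Replacing \<open>a\<close> by \<open>a q\<close> divides it by \<open>- q\<^sup>2 a w\<close>, but it stays bounded
  when this is iterated, so it vanishes.\<close>

definition defect :: "complex \<Rightarrow> complex \<Rightarrow> complex \<Rightarrow> complex" where
  "defect w a y = ((1 + 1 / w) - (q * a + 1 / w) * y) * (P (q ^ 2 * a * w * y) * P (q ^ 2 * a * y)) / P (q * a * y ^ 2)"

lemma kern_bdd: "P (q * a) \<noteq> 0 \<Longrightarrow> P (q * a * w ^ 2) \<noteq> 0 \<Longrightarrow> lat_bdd w (kern w a)"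
  unfolding kern_def by (intro lat_bdd_div_P_square lat_bdd_mult lat_bdd_P) auto

lemma defect_bdd: "P (q * a) \<noteq> 0 \<Longrightarrow> P (q * a * w ^ 2) \<noteq> 0 \<Longrightarrow> lat_bdd w (defect w a)"
  unfolding defect_def by (intro lat_bdd_div_P_square lat_bdd_mult lat_bdd_P lat_bdd_diff) auto

lemma shifted_nonzero:
  assumes "P (q * a) \<noteq> 0" "P (q * a * w ^ 2) \<noteq> 0"
  shows "P (q * (a * q ^ n)) \<noteq> 0" "P (q * (a * q ^ n) * w ^ 2) \<noteq> 0"
  using P_shift_nonzero [OF assms(1), of n] P_shift_nonzero [OF assms(2), of n] by (simp_all add: mult_ac)

text \<open>The combination is made exact by the certificate \<open>- w * kern w a\<close>. Once the
  sum of \<open>defect w a\<close> is known to vanish, this says that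
  \<open>1 - q * a * w ^ 2\<close> times the sum of \<open>kern w a\<close> is invariant under
  \<open>a -> a * q\<close>.\<close>

lemma kern_relation:
  assumes w: "generic w" and a: "P (q * a) \<noteq> 0" "P (q * a * w ^ 2) \<noteq> 0"
  shows "(1 - q * a * w ^ 2) * lat_sum w (kern w a) - (1 - q * (q * a * w ^ 2)) * lat_sum w (kern w (a * q))
     + (w + q * a * w ^ 2) * lat_sum w (defect w a) = 0"
proof -
  note a' = shifted_nonzero [OF a, of 1, simplified]
  have w0: "w \<noteq> 0" using w by (simp add: generic_def)
  define \<xi> where "\<xi> y = (1 - q * a * w ^ 2) * kern w a y - (1 - q * (q * a * w ^ 2)) * kern w (a * q) y
     + (w + q * a * w ^ 2) * defect w a y" for y
  have "lat_sum w \<xi> = 0"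
  proof (rule lat_sum_exact [OF w, where \<psi> = "\<lambda>y. - w * kern w a y"])
    show "isCont (\<lambda>y. - w * kern w a y) 0"
      unfolding kern_def by (intro continuous_intros P_cont) simp
  next
    fix y assume y: "y \<in> lat w"
    \<comment> \<open>All functions involved are polynomial multiples of \<open>V\<close>. With
      \<open>u\<close> as a variable of its own for \<open>1 / w\<close>, the claim becomes a
      polynomial identity modulo \<open>w * u = 1\<close>.\<close>
    define V where "V = P (q ^ 3 * a * w * y) * P (q ^ 2 * a * y) / P (q * a * y ^ 2)"
    define u where "u = 1 / w"
    have u: "w * u = 1" using w0 by (simp add: u_def)
    have s: "P (q ^ 2 * a * w * y) = (1 - q ^ 2 * a * w * y) * P (q ^ 3 * a * w * y)"
      "P (q * a * y) = (1 - q * a * y) * P (q ^ 2 * a * y)"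
      "P (q * a * y ^ 2) = (1 - q * a * y ^ 2) * P (q ^ 2 * a * y ^ 2)"
      "P (q ^ 2 * a * y ^ 2) = (1 - q ^ 2 * a * y ^ 2) * P (q ^ 3 * a * y ^ 2)"
      using P_step [of "q ^ 2 * a * w * y"] P_step [of "q * a * y"] P_step [of "q * a * y ^ 2"]
        P_step [of "q ^ 2 * a * y ^ 2"] by (simp_all add: mult_ac power2_eq_square power3_eq_cube)
    have nz: "1 - q * a * y ^ 2 \<noteq> 0" "1 - q ^ 2 * a * y ^ 2 \<noteq> 0" "P (q * a * y ^ 2) \<noteq> 0"
      using lat_P_square_nonzero [OF a y] s(3,4) by auto
    have k0: "kern w a y = (1 - q ^ 2 * a * w * y) * (1 - q * a * y) * V"
      unfolding kern_def V_def s(1,2) by simp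
    have k1: "kern w (a * q) y = (1 - q * a * y ^ 2) * V"
      using nz(1) unfolding kern_def V_def s(3) by (simp add: mult_ac power2_eq_square power3_eq_cube)
    have d: "defect w a y = (1 - q ^ 2 * a * w * y) * ((1 + u) - (q * a + u) * y) * V"
      unfolding defect_def V_def s(1) u_def by simp
    have kq: "kern w a (q * y) = (1 - q * a * y ^ 2) * (1 - q ^ 2 * a * y ^ 2) * V"
      using nz(1,2) unfolding kern_def V_def s(3) s(4) by (simp add: mult_ac power2_eq_square power3_eq_cube)
    show "\<xi> y * y = (1 - y) * (1 - y / w) * (- w * kern w a y) - - w * kern w a (q * y)"
      unfolding \<xi>_def k0 k1 d kq divide_inverse [of y w] inverse_eq_divide [of w] u_def [symmetric]
      using u by algebra
  qed
  moreover have b: "lat_bdd w (\<lambda>y. (1 - q * a * w ^ 2) * kern w a y)"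
      "lat_bdd w (\<lambda>y. (1 - q * (q * a * w ^ 2)) * kern w (a * q) y)"
      "lat_bdd w (\<lambda>y. (w + q * a * w ^ 2) * defect w a y)"
    by (intro lat_bdd_mult lat_bdd_const kern_bdd defect_bdd a a')+
  ultimately show ?thesis
    by (simp add: \<xi>_def [abs_def] lat_sum_add [OF w lat_bdd_diff [OF b(1,2)] b(3)] lat_sum_diff [OF w b(1,2)]
      lat_sum_cmult [OF w kern_bdd [OF a]] lat_sum_cmult [OF w kern_bdd [OF a']] lat_sum_cmult [OF w defect_bdd [OF a]])
qed

text \<open>The certificate is the negative of \<open>defect w a\<close> without its linear factor.
  Along \<open>a * q ^ n\<close> the multiplier tends to 0, so the relation contracts when it is
  iterated.\<close>

lemma defect_relation:
  assumes w: "generic w" and a: "P (q * a) \<noteq> 0" "P (q * a * w ^ 2) \<noteq> 0"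
  shows "lat_sum w (defect w a) = - (q ^ 2 * a * w) * lat_sum w (defect w (a * q))"
proof -
  note a' = shifted_nonzero [OF a, of 1, simplified]
  have w0: "w \<noteq> 0" using w by (simp add: generic_def)
  define \<psi> where "\<psi> y = - (P (q ^ 2 * a * w * y) * P (q ^ 2 * a * y) / P (q * a * y ^ 2))" for y
  define \<xi> where "\<xi> y = defect w a y + q ^ 2 * a * w * defect w (a * q) y" for y
  have "lat_sum w \<xi> = 0"
  proof (rule lat_sum_exact [OF w, where \<psi> = \<psi>])
    show "isCont \<psi> 0"
      unfolding \<psi>_def by (intro continuous_intros P_cont) simp
  next
    fix y assume y: "y \<in> lat w"
    define V where "V = P (q ^ 3 * a * w * y) * P (q ^ 3 * a * y) / P (q * a * y ^ 2)"
    define u where "u = 1 / w"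
    have u: "w * u = 1" using w0 by (simp add: u_def)
    have s: "P (q ^ 2 * a * w * y) = (1 - q ^ 2 * a * w * y) * P (q ^ 3 * a * w * y)"
      "P (q ^ 2 * a * y) = (1 - q ^ 2 * a * y) * P (q ^ 3 * a * y)"
      "P (q * a * y ^ 2) = (1 - q * a * y ^ 2) * P (q ^ 2 * a * y ^ 2)"
      "P (q ^ 2 * a * y ^ 2) = (1 - q ^ 2 * a * y ^ 2) * P (q ^ 3 * a * y ^ 2)"
      using P_step [of "q ^ 2 * a * w * y"] P_step [of "q ^ 2 * a * y"] P_step [of "q * a * y ^ 2"]
        P_step [of "q ^ 2 * a * y ^ 2"] by (simp_all add: mult_ac power2_eq_square power3_eq_cube)
    have nz: "1 - q * a * y ^ 2 \<noteq> 0" "1 - q ^ 2 * a * y ^ 2 \<noteq> 0" "P (q * a * y ^ 2) \<noteq> 0"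
      using lat_P_square_nonzero [OF a y] s(3,4) by auto
    have d0: "defect w a y = (1 - q ^ 2 * a * w * y) * (1 - q ^ 2 * a * y) * ((1 + u) - (q * a + u) * y) * V"
      unfolding defect_def V_def s(1,2) u_def by simp
    have d1: "defect w (a * q) y = (1 - q * a * y ^ 2) * ((1 + u) - (q * (a * q) + u) * y) * V"
      using nz(1) unfolding defect_def V_def s(3) u_def by (simp add: mult_ac power2_eq_square power3_eq_cube)
    have p0: "\<psi> y = - ((1 - q ^ 2 * a * w * y) * (1 - q ^ 2 * a * y) * V)"
      unfolding \<psi>_def V_def s(1,2) by simp
    have pq: "\<psi> (q * y) = - ((1 - q * a * y ^ 2) * (1 - q ^ 2 * a * y ^ 2) * V)"
      using nz(1,2) unfolding \<psi>_def V_def s(3) s(4) by (simp add: mult_ac power2_eq_square power3_eq_cube)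
    show "\<xi> y * y = (1 - y) * (1 - y / w) * \<psi> y - \<psi> (q * y)"
      unfolding \<xi>_def d0 d1 p0 pq divide_inverse [of y w] inverse_eq_divide [of w] u_def [symmetric]
      using u by algebra
  qed
  moreover have b: "lat_bdd w (\<lambda>y. q ^ 2 * a * w * defect w (a * q) y)"
    by (intro lat_bdd_mult lat_bdd_const defect_bdd a')
  ultimately have "lat_sum w (defect w a) + q ^ 2 * a * w * lat_sum w (defect w (a * q)) = 0"
    by (simp add: \<xi>_def [abs_def] lat_sum_add [OF w defect_bdd [OF a] b] lat_sum_cmult [OF w defect_bdd [OF a']])
  then show ?thesis by (simp add: eq_neg_iff_add_eq_0)
qed


lemma defect_vanishes:
  assumes w: "generic w" and a: "P (q * a) \<noteq> 0" "P (q * a * w ^ 2) \<noteq> 0"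
  shows "lat_sum w (defect w a) = 0"
proof -
  define c where "c n = norm (lat_sum w (defect w (a * q ^ n)))" for n
  have c_Suc: "c n = norm (q ^ 2 * a * w) * norm q ^ n * c (Suc n)" for n
    using defect_relation [OF w shifted_nonzero [OF a, of n]]
    by (simp add: c_def norm_mult norm_power mult_ac)
  obtain C where C: "C > 0" "\<And>n y. y \<in> lat w \<Longrightarrow> norm (inverse (P (q * a * q ^ n * y ^ 2))) \<le> C"
    using norm_inverse_P_square_le [OF a] by blast
  obtain M where M: "M \<ge> 0" "\<And>f C. (\<And>y. y \<in> lat w \<Longrightarrow> norm (f y) \<le> C) \<Longrightarrow> norm (lat_sum w f) \<le> M * C"
    using lat_sum_norm_bounded [OF w] by blast
  define R where "R = 1 + norm w"
  \<comment> \<open>The product of bounds for the linear factor, the two numerator products and the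
    reciprocal denominator. None depends on \<open>n\<close>, since
    \<open>norm (a * q ^ n) \<le> norm a\<close> and \<open>C\<close> serves all shifts.\<close>
  define B where "B = (norm (1 + 1 / w) + (norm (q * a) + norm (1 / w)) * R) *
    (pbound (norm (q ^ 2 * a * w) * R) * pbound (norm (q ^ 2 * a) * R)) * C"
  have qn: "norm q ^ n \<le> 1" for n using q_less by (intro power_le_one) auto
  note scaled = norm_mult_lat_le [of _ w, folded R_def]
  have "norm (defect w (a * q ^ n) y) \<le> B" if y: "y \<in> lat w" for n y
  proof -
    have "norm ((1 + 1 / w) - (q * (a * q ^ n) + 1 / w) * y) \<le> norm (1 + 1 / w) + (norm (q * a) + norm (1 / w)) * R"
    proof -
      have "norm ((1 + 1 / w) - (q * (a * q ^ n) + 1 / w) * y) \<le>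
        norm (1 + 1 / w) + norm (q * (a * q ^ n) + 1 / w) * norm y"
        by (rule order_trans [OF norm_triangle_ineq4]) (simp add: norm_mult)
      also have "norm (q * (a * q ^ n) + 1 / w) \<le> norm (q * a) + norm (1 / w)"
      proof -
        have "norm (q * a * q ^ n) \<le> norm (q * a) * 1"
          unfolding norm_mult [of "q * a"] norm_power by (intro mult_left_mono qn) auto
        then show ?thesis by (intro norm_triangle_le) (simp add: mult_ac)
      qed
      finally show ?thesis
        using norm_lat_le [OF y] unfolding R_def
        by (meson add_left_mono mult_left_mono mult_right_mono norm_ge_zero order_trans add_nonneg_nonneg)
    qed
    moreover have "norm (P (q ^ 2 * (a * q ^ n) * w * y) * P (q ^ 2 * (a * q ^ n) * y))
       \<le> pbound (norm (q ^ 2 * a * w) * R) * pbound (norm (q ^ 2 * a) * R)"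
      unfolding norm_mult [of "P _"] using scaled [OF y, of "q ^ 2 * a * w" n] scaled [OF y, of "q ^ 2 * a" n]
      by (intro mult_mono norm_P_le) (simp_all add: mult_ac less_imp_le)
    moreover have "norm (inverse (P (q * (a * q ^ n) * y ^ 2))) \<le> C"
      using C(2) [OF y, of n] by (simp add: mult_ac)
    ultimately show ?thesis
      unfolding defect_def divide_inverse norm_mult [of _ "inverse (P _)"] norm_mult [of "_ - _"] B_def
      using C(1) by (intro mult_mono) (auto simp: R_def less_imp_le intro!: mult_nonneg_nonneg add_nonneg_nonneg)
  qed
  then have cB: "c n \<le> M * B" for n
    unfolding c_def by (rule M(2))
  have "(\<lambda>n. norm (q ^ 2 * a * w) * norm q ^ n) \<longlonglongrightarrow> norm (q ^ 2 * a * w) * 0"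
    using q_less by (intro tendsto_intros LIMSEQ_power_zero) auto
  then have "\<forall>\<^sub>F n in sequentially. norm (q ^ 2 * a * w) * norm q ^ n < 1 / 2"
    by (intro order_tendstoD(2)) auto
  then obtain N where N: "\<And>n. n \<ge> N \<Longrightarrow> norm (q ^ 2 * a * w) * norm q ^ n < 1 / 2"
    by (auto simp: eventually_sequentially)
  have c0: "c n \<ge> 0" for n by (simp add: c_def)
  \<comment> \<open>Beyond \<open>N\<close> every use of the recurrence gains a factor 1/2, while
    the uniform bound \<open>M * B\<close> remains available at the far end; \<open>m\<close> is
    then sent to infinity.\<close>
  have half: "c (N + n) \<le> (1 / 2) ^ m * (M * B)" for m n
  proof (induction m arbitrary: n)
    case (Suc m)
    have "c (N + n) \<le> 1 / 2 * c (Suc (N + n))"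
      unfolding c_Suc [of "N + n"] using N [of "N + n"] c0 by (intro mult_right_mono) auto
    also have "\<dots> \<le> 1 / 2 * ((1 / 2) ^ m * (M * B))"
      using Suc [of "Suc n"] by simp
    finally show ?case by simp
  qed (use cB in simp)
  have "(\<lambda>m. (1 / 2) ^ m * (M * B)) \<longlonglongrightarrow> 0 * (M * B)"
    by (intro tendsto_intros LIMSEQ_power_zero) auto
  then have "c (N + 0) \<le> 0"
    using half [of 0] by (intro LIMSEQ_le_const) auto
  then have "c N = 0" using c0 [of N] by simp
  \<comment> \<open>The recurrence expresses \<open>c N\<close> through \<open>c (Suc N)\<close>, so
    a zero propagates down to the index 0.\<close>
  then have "c 0 = 0"
  proof (induction N)
    case (Suc N)
    then show ?case using c_Suc [of N] by simp
  qed simp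
  then show ?thesis by (simp add: c_def)
qed

lemma kern_shift_invariant:
  assumes w: "generic w" and a: "P (q * a) \<noteq> 0" "P (q * a * w ^ 2) \<noteq> 0"
  shows "(1 - q * a * w ^ 2) * lat_sum w (kern w a) =
    (1 - q * (a * q ^ n) * w ^ 2) * lat_sum w (kern w (a * q ^ n))"
proof (induction n)
  case (Suc n)
  note a' = shifted_nonzero [OF a, of n]
  show ?case
    using kern_relation [OF w a'] defect_vanishes [OF w a'] Suc by (simp add: mult_ac)
qed simp

text \<open>Invariance allows \<open>a\<close> to be replaced by \<open>a * q ^ n\<close>. For
  \<open>n\<close> tending to infinity both the prefactor and \<open>kern\<close> tend to 1, with a
  bound uniform over the lattice.\<close>

lemma kern_value_const:
  assumes w: "generic w" and a: "P (q * a) \<noteq> 0" "P (q * a * w ^ 2) \<noteq> 0"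
  shows "(1 - q * a * w ^ 2) * lat_sum w (kern w a) = lat_sum w (\<lambda>y. 1)"
proof -
  obtain C where C: "C > 0" "\<And>n y. y \<in> lat w \<Longrightarrow> norm (inverse (P (q * a * q ^ n * y ^ 2))) \<le> C"
    using norm_inverse_P_square_le [OF a] by blast
  define R where "R = 1 + norm w"
  have qn: "norm q ^ n \<le> 1" for n using q_less by (intro power_le_one) auto
  note scaled = norm_mult_lat_le [of _ w, folded R_def]
  have lim0: "(\<lambda>n. x * (a * q ^ n) * y) \<longlonglongrightarrow> 0" for x y
    using tendsto_mult [OF tendsto_mult [OF tendsto_const [of "x * a"] qpow_tendsto_0] tendsto_const [of y]]
    by (simp add: mult_ac)
  have "(\<lambda>n. lat_sum w (kern w (a * q ^ n))) \<longlonglongrightarrow> lat_sum w (\<lambda>y. 1)"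
  proof (rule lat_sum_tendsto [OF w])
    fix y
    have "(\<lambda>n. kern w (a * q ^ n) y) \<longlonglongrightarrow> P 0 * P 0 / P 0"
      unfolding kern_def using lim0 [of "q ^ 2" "w * y"] by (intro tendsto_intros lim0) (simp_all add: mult.assoc)
    then show "(\<lambda>n. kern w (a * q ^ n) y) \<longlonglongrightarrow> 1" by simp
  next
    fix n y assume y: "y \<in> lat w"
    show "norm (kern w (a * q ^ n) y) \<le> pbound (norm (q ^ 2 * a * w) * R) * pbound (norm (q * a) * R) * C"
      unfolding kern_def divide_inverse norm_mult [of _ "inverse (P _)"] norm_mult [of "P _"]
      using scaled [OF y, of "q ^ 2 * a * w" n] scaled [OF y, of "q * a" n] C(2) [OF y, of n]
      by (intro mult_mono norm_P_le) (simp_all add: mult_ac less_imp_le)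
  qed
  moreover have "(\<lambda>n. 1 - q * (a * q ^ n) * w ^ 2) \<longlonglongrightarrow> 1 - 0"
    by (intro tendsto_intros lim0)
  ultimately have "(\<lambda>n. (1 - q * (a * q ^ n) * w ^ 2) * lat_sum w (kern w (a * q ^ n))) \<longlonglongrightarrow> (1 - 0) * lat_sum w (\<lambda>y. 1)"
    by (intro tendsto_mult)
  then show ?thesis
    unfolding kern_shift_invariant [OF w a, symmetric] by (simp add: LIMSEQ_const_iff)
qed

text \<open>The constant is determined by letting \<open>q a w\<^sup>2\<close> tend to 1, where all terms of
  the two series vanish except for the first one of the second series.\<close>

lemma lat_sum_one:
  assumes w: "generic w"
  shows "lat_sum w (\<lambda>y. 1) = 1"
proof -
  have w0: "w \<noteq> 0" and Pw: "P (1 / w) \<noteq> 0" using w generic_inverse [OF w] by (auto simp: generic_def)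
  \<comment> \<open>The terms on the first progression with the quotient of infinite products
    reduced to a finite one, so that they remain meaningful and continuous at the limit value of
    \<open>a\<close>.\<close>
  define x where "x a j = (1 - q * a * w ^ 2) * poch (q * a * q ^ j) j * P (q ^ 2 * a * w * q ^ j)" for a j
  \<comment> \<open>On the second progression the quotient is
    \<open>P (q * k * q ^ j) / P (k * q ^ (2 * j))\<close> with \<open>k = q * a * w ^ 2\<close>.
    For \<open>j = 0\<close> it equals \<open>1 / (1 - k)\<close> and cancels the prefactor, hence
    the value 1; for \<open>j > 0\<close> the vanishing prefactor stays.\<close>
  define x' where "x' a j = (if j = 0 then 1 else (1 - q * a * w ^ 2) * poch (q * a * w ^ 2 * q ^ Suc j) (j - 1)) *
    P (q * a * w * q ^ j)" for a j
  \<comment> \<open>Here \<open>q * a1 * w ^ 2 = 1\<close>, so \<open>a1\<close> itself violates the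
    hypotheses of \<open>kern_value_const\<close> and can only be reached as a limit.\<close>
  define a1 where "a1 = 1 / (q * w ^ 2)"
  have "countable ({a. P (q * a) = 0} \<union> {a. P (q * w ^ 2 * a) = 0})"
    using w0 by (intro countable_Un countable_zeros_mult) auto
  then obtain s where s: "s \<longlonglongrightarrow> a1" "\<And>n. s n \<notin> {a. P (q * a) = 0} \<union> {a. P (q * w ^ 2 * a) = 0}"
    using sequence_avoiding_countable by metis
  have nz: "P (q * s n) \<noteq> 0" "P (q * s n * w ^ 2) \<noteq> 0" for n using s(2) [of n] by (auto simp: mult_ac)
  have eq: "lat_sum w (\<lambda>y. 1) = (\<Sum>j. weight w j * x (s n) j) + (\<Sum>j. weight (1 / w) j * x' (s n) j)" for n
  proof -
    define a where "a = s n"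
    note a = nz [of n, folded a_def]
    have 1: "(1 - q * a * w ^ 2) * kern w a (q ^ j) = x a j" for j
    proof -
      have "P (q * a * q ^ j) = poch (q * a * q ^ j) j * P (q * a * (q ^ j) ^ 2)"
        using P_split [of "q * a * q ^ j" j] by (simp add: power2_eq_square mult_ac)
      moreover have "P (q * a * (q ^ j) ^ 2) \<noteq> 0"
        using lat_P_square_nonzero [OF a lat_intros(1)] by simp
      ultimately show ?thesis by (simp add: kern_def x_def)
    qed
    have 2: "(1 - q * a * w ^ 2) * kern w a (w * q ^ j) = x' a j" for j
    proof -
      define k where "k = q * a * w ^ 2"
      have k: "P (k * (q ^ j) ^ 2) \<noteq> 0"
        using lat_P_square_nonzero [OF a lat_intros(2), of j] by (simp add: k_def power_mult_distrib mult.assoc)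
      have e: "kern w a (w * q ^ j) = P (q * k * q ^ j) * P (q * a * w * q ^ j) / P (k * (q ^ j) ^ 2)"
        unfolding kern_def k_def by (simp add: mult_ac power2_eq_square)
      show ?thesis
      proof (cases j)
        case 0
        then show ?thesis using k P_step [of k] unfolding e x'_def k_def [symmetric] by (simp add: mult_ac)
      next
        case (Suc i)
        have "P (q * k * q ^ j) = poch (k * q ^ Suc j) (j - 1) * P (k * (q ^ j) ^ 2)"
          using P_split [of "k * q ^ Suc j" i] Suc by (simp add: mult_ac power2_eq_square)
        then show ?thesis using k Suc unfolding e x'_def k_def [symmetric] by simp
      qed
    qed
    have "lat_sum w (\<lambda>y. 1) = lat_sum w (\<lambda>y. (1 - q * a * w ^ 2) * kern w a y)"
      using kern_value_const [OF w a] lat_sum_cmult [OF w kern_bdd [OF a]] by simp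
    then show ?thesis unfolding a_def [symmetric] lat_sum_def 1 2 .
  qed
  have "Bseq s" using s(1) by (intro convergent_imp_Bseq) (auto simp: convergent_def)
  then obtain R where R: "\<And>n. norm (s n) \<le> R" unfolding Bseq_def by blast
  have R0: "R \<ge> 0" using R [of 0] norm_ge_zero order_trans by blast
  have qn: "norm q ^ n \<le> 1" for n using q_less by (intro power_le_one) auto
  have bd: "norm (c * s n * q ^ j) \<le> norm c * R" "norm (c * s n) \<le> norm c * R" for c n j
  proof -
    have "norm (c * s n * q ^ j) \<le> norm c * R * 1"
      unfolding norm_mult norm_power by (intro mult_mono R qn) (use R0 in auto)
    then show "norm (c * s n * q ^ j) \<le> norm c * R" by simp
    show "norm (c * s n) \<le> norm c * R"
      unfolding norm_mult by (intro mult_mono R) (use R0 in auto)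
  qed
  define F where "F = 1 + norm (q * w ^ 2) * R"
  have F: "norm (1 - q * s n * w ^ 2) \<le> F" "F \<ge> 1" for n
    using bd(2) [of "q * w ^ 2" n] R0 norm_triangle_ineq4 [of 1 "q * s n * w ^ 2"] by (auto simp: F_def mult_ac)
  have "(\<lambda>n. \<Sum>j. weight w j * x (s n) j) \<longlonglongrightarrow> (\<Sum>j. weight w j * x a1 j)"
  proof (rule weight_suminf_tendsto [OF w])
    show "(\<lambda>n. x (s n) j) \<longlonglongrightarrow> x a1 j" for j
      unfolding x_def by (intro tendsto_intros s)
    show "norm (x (s n) j) \<le> F * pbound (norm q * R) * pbound (norm (q ^ 2 * w) * R)" for n j
      unfolding x_def norm_mult [of _ "P _"] norm_mult [of "_ - _"]
      using F bd(1) [of q n j] bd(1) [of "q ^ 2 * w" n j]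
      by (intro mult_mono norm_P_le norm_poch_le) (simp_all add: mult_ac less_imp_le)
  qed
  moreover have "(\<lambda>n. \<Sum>j. weight (1 / w) j * x' (s n) j) \<longlonglongrightarrow> (\<Sum>j. weight (1 / w) j * x' a1 j)"
  proof (rule weight_suminf_tendsto [OF generic_inverse [OF w]])
    show "(\<lambda>n. x' (s n) j) \<longlonglongrightarrow> x' a1 j" for j
      unfolding x'_def by (cases "j = 0") (auto intro!: tendsto_intros s)
    show "norm (x' (s n) j) \<le> (F * pbound (norm (q * w ^ 2) * R)) * pbound (norm (q * w) * R)" for n j
    proof -
      have "norm (if j = 0 then 1 else (1 - q * s n * w ^ 2) * poch (q * s n * w ^ 2 * q ^ Suc j) (j - 1))
        \<le> F * pbound (norm (q * w ^ 2) * R)"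
      proof (cases "j = 0")
        case True
        have "1 * pbound 0 \<le> F * pbound (norm (q * w ^ 2) * R)"
          using F(2) R0 by (intro mult_mono pbound_mono) auto
        then show ?thesis using True by simp
      next
        case False
        have "norm ((1 - q * s n * w ^ 2) * poch (q * s n * w ^ 2 * q ^ Suc j) (j - 1)) \<le> F * pbound (norm (q * w ^ 2) * R)"
          unfolding norm_mult [of "_ - _"] using F bd(1) [of "q * w ^ 2" n "Suc j"]
          by (intro mult_mono norm_poch_le) (simp_all add: mult_ac)
        then show ?thesis using False by simp
      qed
      then show ?thesis
        unfolding x'_def norm_mult [of _ "P _"] using bd(1) [of "q * w" n j] F(2)
        by (intro mult_mono norm_P_le) (simp_all add: mult_ac less_imp_le)
    qed
  qed
  ultimately have "(\<lambda>n. (\<Sum>j. weight w j * x (s n) j) + (\<Sum>j. weight (1 / w) j * x' (s n) j)) \<longlonglongrightarrow>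
      (\<Sum>j. weight w j * x a1 j) + (\<Sum>j. weight (1 / w) j * x' a1 j)"
    by (rule tendsto_add)
  then have "lat_sum w (\<lambda>y. 1) = (\<Sum>j. weight w j * x a1 j) + (\<Sum>j. weight (1 / w) j * x' a1 j)"
    unfolding eq [symmetric] by (simp add: LIMSEQ_const_iff)
  also have "q * a1 * w ^ 2 = 1" using w0 by (simp add: a1_def)
  then have "x a1 j = 0" "x' a1 j = (if j = 0 then P (1 / w) else 0)" for j
    using w0 by (simp_all add: x_def x'_def) (simp add: a1_def power2_eq_square)
  then have "(\<Sum>j. weight w j * x a1 j) + (\<Sum>j. weight (1 / w) j * x' a1 j) = weight (1 / w) 0 * P (1 / w)"
    using suminf_finite [of "{0}" "\<lambda>j. weight (1 / w) j * x' a1 j"] by simp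
  also have "\<dots> = 1" using Pw by (simp add: weight_def)
  finally show ?thesis .
qed

lemma lat_sum_kern:
  assumes "generic w" and "P (q * a) \<noteq> 0" "P (q * a * w ^ 2) \<noteq> 0"
  shows "(1 - q * a * w ^ 2) * lat_sum w (kern w a) = 1"
  using kern_value_const [OF assms] lat_sum_one [OF assms(1)] by simp

end

section \<open>The very-well-poised series\<close>

context nome
begin

lemma lat_cases:
  assumes "y \<in> lat w"
  obtains j where "y = q ^ j" | j where "y = w * q ^ j"
  using assms by (auto simp: lat_def)

lemma lat_sum_sum:
  assumes "generic w" "\<And>k. lat_bdd w (f k)"
  shows "lat_sum w (\<lambda>y. \<Sum>k<n. f k y) = (\<Sum>k<n. lat_sum w (f k)) \<and> lat_bdd w (\<lambda>y. \<Sum>k<n::nat. f k y)"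
proof (induction n)
  case 0
  then show ?case by (auto simp: lat_sum_def)
next
  case (Suc n)
  then show ?case using assms by (auto simp: lat_sum_add)
qed

lemma lat_sum_sums:
  assumes w: "generic w" and bd: "\<And>k y. y \<in> lat w \<Longrightarrow> norm (f k y) \<le> D k" and D: "summable D"
  shows "(\<lambda>k. lat_sum w (f k)) sums lat_sum w (\<lambda>y. \<Sum>k. f k y)"
proof -
  have D0: "D k \<ge> 0" for k using bd [OF lat_intros(1)] norm_ge_zero order_trans by blast
  have b: "lat_bdd w (f k)" for k using bd by (rule lat_bddI)
  have "(\<lambda>n. lat_sum w (\<lambda>y. \<Sum>k<n. f k y)) \<longlonglongrightarrow> lat_sum w (\<lambda>y. \<Sum>k. f k y)"
  proof (rule lat_sum_tendsto [OF w])
    fix y assume y: "y \<in> lat w"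
    have "summable (\<lambda>k. f k y)"
      by (rule summable_comparison_test' [OF D]) (use bd y in auto)
    then show "(\<lambda>n. \<Sum>k<n. f k y) \<longlonglongrightarrow> (\<Sum>k. f k y)" by (rule summable_LIMSEQ)
    show "norm (\<Sum>k<n. f k y) \<le> suminf D" for n
      using bd [OF y] by (intro order_trans [OF sum_norm_le sum_le_suminf [OF D]] D0) auto
  qed
  then show ?thesis using lat_sum_sum [OF w, of f] b by (simp add: sums_def)
qed

text \<open>Iterating to infinity turns the linear factors into infinite products and
  \<open>X\<close> into its limit. The result is stated without division, so it also covers
  vanishing factors.\<close>

lemma two_term_recurrence:
  assumes rec: "\<And>n. (1 - s * q ^ n) * (1 - t * q ^ n) * X (Suc n) = (1 - r * q ^ n) * X n"
    and lim: "X \<longlonglongrightarrow> l"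
  shows "P (r * q ^ n) * X n = P (s * q ^ n) * P (t * q ^ n) * l"
proof -
  have "poch (r * q ^ n) m * X n = poch (s * q ^ n) m * poch (t * q ^ n) m * X (n + m)" for m
  proof (induction m)
    case (Suc m)
    have "poch (r * q ^ n) (Suc m) * X n = (1 - r * q ^ (n + m)) * (poch (r * q ^ n) m * X n)"
      by (simp add: poch_Suc power_add mult_ac)
    also have "\<dots> = poch (s * q ^ n) m * poch (t * q ^ n) m * ((1 - r * q ^ (n + m)) * X (n + m))"
      unfolding Suc by (simp add: mult_ac)
    also have "\<dots> = poch (s * q ^ n) (Suc m) * poch (t * q ^ n) (Suc m) * X (n + Suc m)"
      unfolding rec [symmetric] by (simp add: poch_Suc power_add mult_ac)
    finally show ?case .
  qed simp
  moreover have "(\<lambda>m. poch (r * q ^ n) m * X n) \<longlonglongrightarrow> P (r * q ^ n) * X n"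
    by (intro tendsto_intros poch_tendsto)
  moreover have "(\<lambda>m. poch (s * q ^ n) m * poch (t * q ^ n) m * X (n + m)) \<longlonglongrightarrow> P (s * q ^ n) * P (t * q ^ n) * l"
    using LIMSEQ_ignore_initial_segment [OF lim, of n]
    by (intro tendsto_intros poch_tendsto) (simp add: add.commute)
  ultimately show ?thesis using LIMSEQ_unique by simp
qed

text \<open>The parameters enter through their reciprocals, \<open>\<beta> = 1 / b\<close> and so
  on: \<open>\<Prod>i<k. \<beta> - q ^ i\<close> is
  \<open>\<beta> ^ k * poch (1 / \<beta>) k\<close> but polynomial in \<open>\<beta>\<close>. For
  the third parameter this gives sense to the value 0, where the lattice accumulates. The factor
  \<open>1 - a * q ^ (2 * k)\<close> is kept apart, because consecutive cores have the simpler
  ratio.\<close>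

definition wp_core :: "complex \<Rightarrow> complex \<Rightarrow> complex \<Rightarrow> nat \<Rightarrow> complex" where
  "wp_core a \<beta> \<gamma> k = poch a k * (\<Prod>i<k. \<beta> - q ^ i) * (\<Prod>i<k. \<gamma> - q ^ i) * (q * a) ^ k /
     ((1 - a) * poch q k * poch (q * a * \<beta>) k * poch (q * a * \<gamma>) k)"

definition wp_coeff :: "complex \<Rightarrow> complex \<Rightarrow> complex \<Rightarrow> nat \<Rightarrow> complex" where
  "wp_coeff a \<beta> \<gamma> k = wp_core a \<beta> \<gamma> k * (1 - a * q ^ (2 * k))"

text \<open>The general term of the \<open>6\<phi>5\<close> series with parameters
  \<open>1 / \<beta>\<close>, \<open>1 / \<gamma>\<close>, \<open>1 / \<delta>\<close>, multiplied
  by \<open>P (q * a * \<delta>)\<close>, which absorbs the denominator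
  \<open>poch (q * a * \<delta>) k\<close>.\<close>

definition wp_term :: "complex \<Rightarrow> complex \<Rightarrow> complex \<Rightarrow> complex \<Rightarrow> nat \<Rightarrow> complex" where
  "wp_term a \<beta> \<gamma> \<delta> k = wp_coeff a \<beta> \<gamma> k * (\<Prod>i<k. \<delta> - q ^ i) * P (q * a * \<delta> * q ^ k)"

text \<open>The Gosper certificate of the contiguous relation for the very-well-poised
  series in the parameter \<open>1 / \<delta>\<close>.\<close>

definition wp_cert :: "complex \<Rightarrow> complex \<Rightarrow> complex \<Rightarrow> complex \<Rightarrow> nat \<Rightarrow> complex" where
  "wp_cert a \<beta> \<gamma> \<delta> k = \<delta> * wp_core a \<beta> \<gamma> k * (1 - a * q ^ k) * (\<beta> - q ^ k) * (\<gamma> - q ^ k) * (q * a) *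
     (\<Prod>i<k. \<delta> - q ^ i) * P (q * a * \<delta> * q ^ Suc k)"

text \<open>The telescoping step with its common factor removed; \<open>p\<close> stands for
  \<open>q\<close> and \<open>Q\<close> for \<open>q ^ n\<close>.\<close>

lemma wp_identity:
  fixes a \<beta> \<gamma> \<delta> Q p :: complex
  shows "(1 - p * a * \<beta> * \<delta>) * (1 - p * a * \<gamma> * \<delta>) * (1 - a * (p * Q) ^ 2) * ((p * \<delta> - 1) * Q)
     - (1 - p * a * \<beta> * \<gamma> * \<delta>) * (1 - a * (p * Q) ^ 2) * (\<delta> - Q) * (1 - p * a * \<delta> * (p * Q))
    = \<delta> * (1 - a * (p * Q)) * (\<beta> - p * Q) * (\<gamma> - p * Q) * (p * a) * (\<delta> - Q)
     - \<delta> * ((1 - p * Q) * (1 - p * a * \<beta> * Q) * (1 - p * a * \<gamma> * Q)) * (1 - p * a * \<delta> * (p * Q))"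
  by (simp add: algebra_simps power2_eq_square)

text \<open>Passing from \<open>\<delta>\<close> to \<open>q * \<delta>\<close> is one step along a
  progression of the lattice. Once the certificate is seen to vanish at infinity, this is a
  first-order recurrence for the sum of the series as a function of \<open>\<delta>\<close>.\<close>

lemma wp_telescope:
  assumes a: "a \<noteq> 1" and nz: "P (q * a * \<beta>) \<noteq> 0" "P (q * a * \<gamma>) \<noteq> 0"
  shows "(\<Sum>k<Suc n. (1 - q * a * \<beta> * \<delta>) * (1 - q * a * \<gamma> * \<delta>) * wp_term a \<beta> \<gamma> (q * \<delta>) k
      - (1 - q * a * \<beta> * \<gamma> * \<delta>) * wp_term a \<beta> \<gamma> \<delta> k) = wp_cert a \<beta> \<gamma> \<delta> n"
proof (induction n)
  case 0
  have "P (q * a * \<delta>) = (1 - q * a * \<delta>) * P (q * a * (q * \<delta>))"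
    using P_step [of "q * a * \<delta>"] by (simp add: mult_ac)
  then show ?case using a
    by (simp add: wp_term_def wp_coeff_def wp_core_def wp_cert_def mult.commute [of _ q] mult.left_commute [of _ q])
      (simp add: algebra_simps)
next
  case (Suc n)
  define k where "k = Suc n"
  define A where "A = wp_core a \<beta> \<gamma> k"
  define Q where "Q = q ^ n"
  define D where "D = (\<Prod>i<n. \<delta> - q ^ i)"
  define W where "W = P (q * a * \<delta> * q ^ Suc k)"
  have Qk: "q ^ k = q * Q" by (simp add: k_def Q_def)
  \<comment> \<open>The ratio of consecutive cores, multiplied out; with it both certificates can be
    expressed through the same \<open>A\<close>.\<close>
  have core: "A * (1 - q * Q) * (1 - q * a * \<beta> * Q) * (1 - q * a * \<gamma> * Q) =
     wp_core a \<beta> \<gamma> n * (1 - a * Q) * (\<beta> - Q) * (\<gamma> - Q) * (q * a)"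
  proof -
    have "poch (q * a * \<beta>) (Suc n) \<noteq> 0" "poch (q * a * \<gamma>) (Suc n) \<noteq> 0" "poch q (Suc n) \<noteq> 0"
      using nz by (simp_all add: poch_nonzero)
    then have "1 - q * a * \<beta> * Q \<noteq> 0" "1 - q * a * \<gamma> * Q \<noteq> 0" "1 - q * Q \<noteq> 0"
      by (simp_all add: poch_Suc Q_def)
    then show ?thesis
      by (simp add: A_def wp_core_def k_def poch_Suc Q_def [symmetric] mult_ac)
  qed
  have prev: "wp_cert a \<beta> \<gamma> \<delta> n = \<delta> * (A * (1 - q * Q) * (1 - q * a * \<beta> * Q) * (1 - q * a * \<gamma> * Q)) * D *
      ((1 - q * a * \<delta> * (q * Q)) * W)"
  proof -
    have "P (q * a * \<delta> * q ^ k) = (1 - q * a * \<delta> * (q * Q)) * W"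
      using P_step [of "q * a * \<delta> * q ^ k"] Qk by (simp add: W_def mult_ac)
    then show ?thesis
      unfolding core by (simp add: wp_cert_def k_def Q_def [symmetric] D_def mult_ac)
  qed
  have "wp_term a \<beta> \<gamma> \<delta> k = A * (1 - a * (q * Q) ^ 2) * (D * (\<delta> - Q)) * ((1 - q * a * \<delta> * (q * Q)) * W)"
  proof -
    have "P (q * a * \<delta> * q ^ k) = (1 - q * a * \<delta> * (q * Q)) * W"
      using P_step [of "q * a * \<delta> * q ^ k"] Qk by (simp add: W_def mult_ac)
    moreover have "q ^ (2 * k) = (q * Q) ^ 2" unfolding Qk [symmetric] by (simp add: power_mult mult.commute flip: power_mult)
    ultimately show ?thesis
      by (simp add: wp_term_def wp_coeff_def A_def D_def Q_def k_def)
  qed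
  moreover have "wp_term a \<beta> \<gamma> (q * \<delta>) k = A * (1 - a * (q * Q) ^ 2) * ((q * \<delta> - 1) * Q * D) * W"
  proof -
    have "(\<Prod>i<k. q * \<delta> - q ^ i) = (q * \<delta> - 1) * (\<Prod>i<n. q * (\<delta> - q ^ i))"
      unfolding k_def prod.lessThan_Suc_shift by (simp add: right_diff_distrib)
    also have "\<dots> = (q * \<delta> - 1) * Q * D" by (simp add: prod.distrib Q_def D_def)
    finally have "(\<Prod>i<k. q * \<delta> - q ^ i) = (q * \<delta> - 1) * Q * D" .
    moreover have "q ^ (2 * k) = (q * Q) ^ 2" unfolding Qk [symmetric] by (simp add: power_mult mult.commute flip: power_mult)
    moreover have "P (q * a * (q * \<delta>) * q ^ k) = W" by (simp add: W_def mult_ac)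
    ultimately show ?thesis
      by (simp add: wp_term_def wp_coeff_def A_def)
  qed
  moreover have cert: "wp_cert a \<beta> \<gamma> \<delta> k = \<delta> * A * (1 - a * (q * Q)) * (\<beta> - q * Q) * (\<gamma> - q * Q) * (q * a) * (D * (\<delta> - Q)) * W"
    by (simp add: wp_cert_def A_def D_def W_def Q_def k_def mult_ac)
  ultimately have "(1 - q * a * \<beta> * \<delta>) * (1 - q * a * \<gamma> * \<delta>) * wp_term a \<beta> \<gamma> (q * \<delta>) k
      - (1 - q * a * \<beta> * \<gamma> * \<delta>) * wp_term a \<beta> \<gamma> \<delta> k = A * D * W *
      ((1 - q * a * \<beta> * \<delta>) * (1 - q * a * \<gamma> * \<delta>) * (1 - a * (q * Q) ^ 2) * ((q * \<delta> - 1) * Q)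
     - (1 - q * a * \<beta> * \<gamma> * \<delta>) * (1 - a * (q * Q) ^ 2) * (\<delta> - Q) * (1 - q * a * \<delta> * (q * Q)))"
    unfolding right_diff_distrib [of "A * D * W"] by (simp only: mult_ac)
  also have "\<dots> = wp_cert a \<beta> \<gamma> \<delta> k - wp_cert a \<beta> \<gamma> \<delta> n"
    unfolding wp_identity prev cert right_diff_distrib [of "A * D * W"] by (simp only: mult_ac)
  finally have "(1 - q * a * \<beta> * \<delta>) * (1 - q * a * \<gamma> * \<delta>) * wp_term a \<beta> \<gamma> (q * \<delta>) k
      - (1 - q * a * \<beta> * \<gamma> * \<delta>) * wp_term a \<beta> \<gamma> \<delta> k = wp_cert a \<beta> \<gamma> \<delta> k - wp_cert a \<beta> \<gamma> \<delta> n" .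
  then show ?case using Suc by (simp add: k_def)
qed

lemma norm_wp_core_le:
  assumes "\<beta> \<noteq> 0" "\<gamma> \<noteq> 0" and nz: "P (q * a * \<beta>) \<noteq> 0" "P (q * a * \<gamma>) \<noteq> 0"
  obtains C where "C > 0" "\<And>k. norm (wp_core a \<beta> \<gamma> k) \<le> C * norm (q * a * \<beta> * \<gamma>) ^ k"
proof -
  obtain C1 where C1: "C1 > 0" "\<And>j. norm (inverse (poch q j)) \<le> C1"
    using inverse_poch_bounded [OF P_q_nonzero] by blast
  obtain C2 where C2: "C2 > 0" "\<And>j. norm (inverse (poch (q * a * \<beta>) j)) \<le> C2"
    using inverse_poch_bounded [OF nz(1)] by blast
  obtain C3 where C3: "C3 > 0" "\<And>j. norm (inverse (poch (q * a * \<gamma>) j)) \<le> C3"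
    using inverse_poch_bounded [OF nz(2)] by blast
  have pr: "norm (\<Prod>i<k. x - q ^ i) \<le> norm x ^ k * pbound (norm (1 / x))" if "x \<noteq> 0" for x k
  proof -
    have "(\<Prod>i<k. x - q ^ i) = (\<Prod>i<k. x * (1 - 1 / x * q ^ i))"
      using that by (intro prod.cong) (auto simp: right_diff_distrib)
    then have "(\<Prod>i<k. x - q ^ i) = x ^ k * poch (1 / x) k"
      by (simp add: prod.distrib qpoch_def)
    then show ?thesis
      by (simp add: norm_mult norm_power mult_left_mono norm_poch_le del: norm_divide)
  qed
  \<comment> \<open>The summand 1 keeps \<open>C\<close> positive in the case \<open>a = 1\<close>,
    where \<open>inverse (1 - a)\<close> is 0.\<close>
  define C where "C = pbound (norm a) * pbound (norm (1 / \<beta>)) * pbound (norm (1 / \<gamma>)) *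
     (norm (inverse (1 - a)) + 1) * C1 * C2 * C3"
  have "norm (wp_core a \<beta> \<gamma> k) \<le> C * norm (q * a * \<beta> * \<gamma>) ^ k" for k
  proof -
    have "norm (wp_core a \<beta> \<gamma> k) = norm (poch a k) * norm (\<Prod>i<k. \<beta> - q ^ i) * norm (\<Prod>i<k. \<gamma> - q ^ i) *
       norm (q * a) ^ k * norm (inverse (1 - a)) * norm (inverse (poch q k)) *
       norm (inverse (poch (q * a * \<beta>) k)) * norm (inverse (poch (q * a * \<gamma>) k))"
      by (simp add: wp_core_def norm_divide norm_mult norm_power norm_inverse divide_inverse mult_ac)
    also have "\<dots> \<le> pbound (norm a) * (norm \<beta> ^ k * pbound (norm (1 / \<beta>))) * (norm \<gamma> ^ k * pbound (norm (1 / \<gamma>))) *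
       norm (q * a) ^ k * (norm (inverse (1 - a)) + 1) * C1 * C2 * C3"
      using C1 C2 C3 pr [OF assms(1)] pr [OF assms(2)] norm_poch_le [OF order_refl, of a]
      by (intro mult_mono) (auto simp: less_imp_le)
    also have "\<dots> = C * norm (q * a * \<beta> * \<gamma>) ^ k"
      by (simp add: C_def norm_mult power_mult_distrib mult_ac)
    finally show ?thesis .
  qed
  moreover have "C > 0"
    unfolding C_def using C1(1) C2(1) C3(1) by (intro mult_pos_pos add_nonneg_pos) auto
  ultimately show ?thesis using that by blast
qed

text \<open>At \<open>y = q ^ j\<close> the product vanishes for \<open>k > j\<close>, and otherwise
  its factors are at most \<open>2 * norm q ^ i\<close>, so it decays faster than any geometric
  sequence (\<open>D1\<close>). At \<open>y = w * q ^ j\<close> it is at most a constant times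
  \<open>norm w ^ k\<close>, and the smallness hypothesis makes the total geometric
  (\<open>D2\<close>). Neither bound depends on \<open>j\<close>.\<close>

lemma wp_majorant:
  assumes nz: "a \<noteq> 1" "\<beta> \<noteq> 0" "\<gamma> \<noteq> 0" "P (q * a * \<beta>) \<noteq> 0" "P (q * a * \<gamma>) \<noteq> 0"
    and w: "w \<noteq> 0" and z: "norm (q * a * \<beta> * \<gamma> * w) < 1"
  obtains D where "summable D"
    "\<And>k y. y \<in> lat w \<Longrightarrow> norm (wp_core a \<beta> \<gamma> k * (\<Prod>i<k. y - q ^ i)) \<le> D k"
proof -
  define e where "e = norm (q * a * \<beta> * \<gamma>)"
  obtain C where C: "C > 0" "\<And>k. norm (wp_core a \<beta> \<gamma> k) \<le> C * e ^ k"
    unfolding e_def using norm_wp_core_le [OF nz(2-5)] by blast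
  have e0: "e \<ge> 0" by (simp add: e_def)
  define D1 where "D1 k = e ^ k * (\<Prod>i<k. 2 * norm q ^ i)" for k
  define D2 where "D2 k = pbound (1 / norm w) * (e * norm w) ^ k" for k
  have D1: "summable D1"
  proof -
    have "(\<lambda>n. 2 * e * norm q ^ n) \<longlonglongrightarrow> 2 * e * 0"
      using q_less by (intro tendsto_intros LIMSEQ_power_zero) auto
    then have "\<forall>\<^sub>F n in sequentially. 2 * e * norm q ^ n < 1 / 2"
      by (intro order_tendstoD(2)) auto
    then obtain N where N: "\<And>n. n \<ge> N \<Longrightarrow> 2 * e * norm q ^ n < 1 / 2"
      by (auto simp: eventually_sequentially)
    show ?thesis
    proof (rule summable_ratio_test [of "1 / 2" N])
      fix n assume "n \<ge> N"
      have pos: "D1 m \<ge> 0" for m using e0 by (auto simp: D1_def intro!: mult_nonneg_nonneg prod_nonneg)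
      have "D1 (Suc n) = 2 * e * norm q ^ n * D1 n" by (simp add: D1_def)
      also have "\<dots> \<le> 1 / 2 * D1 n" using N [OF \<open>n \<ge> N\<close>] pos [of n] by (intro mult_right_mono) auto
      finally show "norm (D1 (Suc n)) \<le> 1 / 2 * norm (D1 n)"
        using pos [of n] pos [of "Suc n"] by (simp add: abs_of_nonneg)
    qed simp
  qed
  have D2: "summable D2"
    using z unfolding D2_def e_def by (intro summable_mult summable_geometric) (simp add: norm_mult)
  have D10: "D1 k \<ge> 0" "D2 k \<ge> 0" for k
    using e0 by (auto simp: D1_def D2_def less_imp_le intro!: mult_nonneg_nonneg prod_nonneg)
  have "norm (wp_core a \<beta> \<gamma> k * (\<Prod>i<k. y - q ^ i)) \<le> C * (D1 k + D2 k)" if yl: "y \<in> lat w" for k y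
  proof -
    have "e ^ k * norm (\<Prod>i<k. y - q ^ i) \<le> D1 k + D2 k"
    proof -
      consider j where "y = q ^ j" "k > j" | j where "y = q ^ j" "k \<le> j" | j where "y = w * q ^ j"
        using lat_cases [OF yl] not_le by metis
      then show ?thesis
      proof cases
        case 1
        then have "(\<Prod>i<k. y - q ^ i) = 0" by auto
        then show ?thesis using D10 [of k] by (simp only:) simp
      next
        case 2
        have "norm (\<Prod>i<k. y - q ^ i) \<le> (\<Prod>i<k. 2 * norm q ^ i)"
          unfolding prod_norm [symmetric]
        proof (intro prod_mono conjI)
          fix i assume "i \<in> {..<k}"
          then have "norm q ^ j \<le> norm q ^ i" using 2 q_less by (intro power_decreasing) auto
          then show "norm (y - q ^ i) \<le> 2 * norm q ^ i"
            using norm_triangle_ineq4 [of y "q ^ i"] 2 by (simp add: norm_power)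
        qed simp
        then have "e ^ k * norm (\<Prod>i<k. y - q ^ i) \<le> D1 k"
          unfolding D1_def using e0 by (intro mult_left_mono) auto
        then show ?thesis using D10(2) [of k] by linarith
      next
        case 3
        have "norm (\<Prod>i<k. y - q ^ i) \<le> (\<Prod>i<k. norm w * (1 + 1 / norm w * norm q ^ i))"
          unfolding prod_norm [symmetric]
        proof (intro prod_mono conjI)
          fix i
          have "norm q ^ j \<le> 1" using q_less by (intro power_le_one) auto
          then have "norm y \<le> norm w" using 3 mult_left_mono [of "norm q ^ j" 1 "norm w"] by (simp add: norm_mult norm_power)
          then show "norm (y - q ^ i) \<le> norm w * (1 + 1 / norm w * norm q ^ i)"
            using norm_triangle_ineq4 [of y "q ^ i"] w by (simp add: norm_power distrib_left)
        qed simp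
        also have "\<dots> \<le> norm w ^ k * pbound (1 / norm w)"
          using prod_norm_le_pbound [of "1 / norm w" k] by (simp add: prod.distrib mult_left_mono)
        finally have "e ^ k * norm (\<Prod>i<k. y - q ^ i) \<le> e ^ k * (norm w ^ k * pbound (1 / norm w))"
          using e0 by (intro mult_left_mono) auto
        then have "e ^ k * norm (\<Prod>i<k. y - q ^ i) \<le> D2 k"
          by (simp add: D2_def power_mult_distrib mult_ac)
        then show ?thesis using D10(1) [of k] by linarith
      qed
    qed
    then have "C * (e ^ k * norm (\<Prod>i<k. y - q ^ i)) \<le> C * (D1 k + D2 k)"
      using C(1) by simp
    moreover have "norm (wp_core a \<beta> \<gamma> k * (\<Prod>i<k. y - q ^ i)) \<le> C * e ^ k * norm (\<Prod>i<k. y - q ^ i)"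
      unfolding norm_mult by (intro mult_right_mono C) auto
    ultimately show ?thesis by (simp add: mult.assoc)
  qed
  moreover have "summable (\<lambda>k. C * (D1 k + D2 k))"
    by (intro summable_mult summable_add D1 D2)
  ultimately show ?thesis using that by blast
qed

lemma norm_one_minus_le: "norm (1 - x * q ^ n) \<le> 1 + norm x"
proof -
  have "norm x * norm q ^ n \<le> norm x * 1" using q_less by (intro mult_left_mono power_le_one) auto
  then show ?thesis using norm_triangle_ineq4 [of 1 "x * q ^ n"] by (simp add: norm_mult norm_power)
qed

text \<open>The nonterminating \<open>6\<phi>5\<close> summation with denominators cleared. The
  recurrence from \<open>wp_telescope\<close> links every lattice point to the value at the common
  limit 0, and the point 1 fixes that value.\<close>

lemma wp_sum:
  assumes nz: "a \<noteq> 1" "\<beta> \<noteq> 0" "\<gamma> \<noteq> 0" "P (q * a * \<beta>) \<noteq> 0" "P (q * a * \<gamma>) \<noteq> 0"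
    and w: "w \<noteq> 0" and z: "norm (q * a * \<beta> * \<gamma> * w) < 1" and y: "y \<in> lat w"
  shows "P (q * a * \<beta>) * P (q * a * \<gamma>) * (P (q * a * \<beta> * \<gamma> * y) * (\<Sum>k. wp_term a \<beta> \<gamma> y k)) =
     P (q * a) * P (q * a * \<beta> * \<gamma>) * (P (q * a * \<beta> * y) * P (q * a * \<gamma> * y))"
proof -
  obtain D where D: "summable D" "\<And>k y. y \<in> lat w \<Longrightarrow> norm (wp_core a \<beta> \<gamma> k * (\<Prod>i<k. y - q ^ i)) \<le> D k"
    using wp_majorant [OF nz w z] by blast
  have D0: "D k \<ge> 0" for k using D(2) [OF lat_intros(1)] norm_ge_zero order_trans by blast
  define R where "R = norm (q * a) * (1 + norm w)"
  define M where "M = (1 + norm a) * pbound R"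
  have Pb: "norm (P (q * a * y * q ^ k)) \<le> pbound R" if "y \<in> lat w" for y k
    using norm_lat_le [OF that] unfolding R_def norm_mult [of "q * a", symmetric]
    by (intro norm_P_shift_le) (simp add: norm_mult mult_left_mono)
  have T: "norm (wp_term a \<beta> \<gamma> y k) \<le> M * D k" if "y \<in> lat w" for y k
  proof -
    have "norm (wp_term a \<beta> \<gamma> y k) = norm (wp_core a \<beta> \<gamma> k * (\<Prod>i<k. y - q ^ i)) * norm (1 - a * q ^ (2 * k)) *
       norm (P (q * a * y * q ^ k))"
      by (simp add: wp_term_def wp_coeff_def norm_mult mult_ac)
    also have "\<dots> \<le> D k * (1 + norm a) * pbound R"
      using D0 by (intro mult_mono D Pb that norm_one_minus_le) (auto intro!: mult_nonneg_nonneg add_nonneg_nonneg)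
    finally show ?thesis by (simp add: M_def mult_ac)
  qed
  have MD: "summable (\<lambda>k. M * D k)" by (intro summable_mult D)
  have Tsum: "summable (wp_term a \<beta> \<gamma> y)" if "y \<in> lat w" for y
    by (rule summable_comparison_test' [OF MD]) (use T that in auto)
  define U where "U y = (\<Sum>k. wp_term a \<beta> \<gamma> y k)" for y
  have cert0: "(\<lambda>k. wp_cert a \<beta> \<gamma> y k) \<longlonglongrightarrow> 0" if "y \<in> lat w" for y
  proof (rule Lim_null_comparison)
    define B where "B = norm y * ((1 + norm a) * (norm \<beta> + 1) * (norm \<gamma> + 1) * norm (q * a) * pbound R)"
    have qn: "norm q ^ n \<le> 1" for n using q_less by (intro power_le_one) auto
    show "\<forall>\<^sub>F n in sequentially. norm (wp_cert a \<beta> \<gamma> y n) \<le> D n * B"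
    proof (intro always_eventually allI)
      fix n
      have "norm (wp_cert a \<beta> \<gamma> y n) = norm (wp_core a \<beta> \<gamma> n * (\<Prod>i<n. y - q ^ i)) * (norm y * (norm (1 - a * q ^ n) *
         norm (\<beta> - q ^ n) * norm (\<gamma> - q ^ n) * norm (q * a) * norm (P (q * a * y * q ^ Suc n))))"
        by (simp add: wp_cert_def norm_mult mult_ac)
      also have "\<dots> \<le> D n * B"
        unfolding B_def using D0
        by (intro mult_mono D Pb that norm_one_minus_le order_refl order_trans [OF norm_triangle_ineq4])
          (auto simp: norm_power qn less_imp_le intro!: mult_nonneg_nonneg add_nonneg_nonneg)
      finally show "norm (wp_cert a \<beta> \<gamma> y n) \<le> D n * B" .
    qed
    show "(\<lambda>n. D n * B) \<longlonglongrightarrow> 0"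
      using tendsto_mult_right [OF summable_LIMSEQ_zero [OF D(1)], of B] by simp
  qed
  have rec: "(1 - q * a * \<beta> * y) * (1 - q * a * \<gamma> * y) * U (q * y) = (1 - q * a * \<beta> * \<gamma> * y) * U y" if y: "y \<in> lat w" for y
  proof -
    let ?f = "\<lambda>k. (1 - q * a * \<beta> * y) * (1 - q * a * \<gamma> * y) * wp_term a \<beta> \<gamma> (q * y) k
      - (1 - q * a * \<beta> * \<gamma> * y) * wp_term a \<beta> \<gamma> y k"
    have "?f sums ((1 - q * a * \<beta> * y) * (1 - q * a * \<gamma> * y) * U (q * y) - (1 - q * a * \<beta> * \<gamma> * y) * U y)"
      unfolding U_def by (intro sums_diff sums_mult summable_sums Tsum y lat_q)
    moreover have "?f sums 0"
      unfolding sums_def by (subst filterlim_sequentially_Suc [symmetric])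
        (simp only: wp_telescope [OF nz(1,4,5)] cert0 [OF y])
    ultimately show ?thesis using sums_unique2 by fastforce
  qed
  have lim: "(\<lambda>n. U (x * q ^ n)) \<longlonglongrightarrow> U 0" if x: "\<And>n. x * q ^ n \<in> lat w" for x
    unfolding U_def
  proof (intro tannerys_theorem [THEN conjunct2, THEN conjunct2])
    have "(\<lambda>n. x * q ^ n) \<longlonglongrightarrow> x * 0" by (intro tendsto_intros qpow_tendsto_0)
    then have "(\<lambda>n. x * q ^ n) \<longlonglongrightarrow> 0" by simp
    then show "(\<lambda>n. wp_term a \<beta> \<gamma> (x * q ^ n) k) \<longlonglongrightarrow> wp_term a \<beta> \<gamma> 0 k" for k
      unfolding wp_term_def by (intro tendsto_intros)
    show "\<forall>\<^sub>F (k, n) in sequentially \<times>\<^sub>F sequentially. norm (wp_term a \<beta> \<gamma> (x * q ^ n) k) \<le> M * D k"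
      using T [OF x] by (intro always_eventually) auto
    show "summable (\<lambda>k. M * D k)" by (rule MD)
  qed auto
  have X: "P (q * a * \<beta> * \<gamma> * x * q ^ n) * U (x * q ^ n) = P (q * a * \<beta> * x * q ^ n) * P (q * a * \<gamma> * x * q ^ n) * U 0"
    if x: "\<And>n. x * q ^ n \<in> lat w" for x n
    by (rule two_term_recurrence [where X = "\<lambda>n. U (x * q ^ n)", OF _ lim [OF x]])
       (use rec [OF x] in \<open>simp add: mult_ac\<close>)
  \<comment> \<open>At \<open>y = 1\<close> the product over \<open>i < k\<close> contains the
    factor \<open>1 - q ^ 0\<close>, so only the term \<open>k = 0\<close> survives.\<close>
  have "U 1 = P (q * a)"
  proof -
    have "wp_term a \<beta> \<gamma> 1 k = 0" if "k > 0" for k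
    proof -
      have "(\<Prod>i<k. 1 - q ^ i) = 0" using that by (intro prod_zero) (auto intro!: bexI [of _ 0])
      then show ?thesis by (simp add: wp_term_def)
    qed
    then have "U 1 = wp_term a \<beta> \<gamma> 1 0"
      unfolding U_def using suminf_finite [of "{0}" "wp_term a \<beta> \<gamma> 1"] by auto
    then show ?thesis using nz(1) by (simp add: wp_term_def wp_coeff_def wp_core_def)
  qed
  then have U0: "P (q * a * \<beta>) * P (q * a * \<gamma>) * U 0 = P (q * a) * P (q * a * \<beta> * \<gamma>)"
    using X [of 1 0] by (simp add: mult.commute)
  have "P (q * a * \<beta> * \<gamma> * y) * U y = P (q * a * \<beta> * y) * P (q * a * \<gamma> * y) * U 0"
    using lat_cases [OF y]
  proof cases
    case (1 j)
    then show ?thesis using X [of 1 j] by simp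
  next
    case (2 j)
    then show ?thesis using X [OF lat_intros(2), of j] by (simp add: mult.assoc)
  qed
  then show ?thesis using U0 unfolding U_def [symmetric] by (simp add: mult_ac)
qed

text \<open>The sum over \<open>k\<close> may be interchanged with the lattice sum because
  \<open>wp_majorant\<close> is a summable bound at all lattice points simultaneously. In the
  application \<open>q * a * \<beta> * \<gamma> * w\<close> is the argument \<open>z\<close> of the
  series.\<close>

lemma wp_two_series:
  assumes nz: "a \<noteq> 1" "\<beta> \<noteq> 0" "\<gamma> \<noteq> 0" "P (q * a * \<beta>) \<noteq> 0" "P (q * a * \<gamma>) \<noteq> 0"
    and w: "generic w" and a: "P (q * a) \<noteq> 0" "P (q * a * w ^ 2) \<noteq> 0"
    and bc: "P (q * a * \<beta> * \<gamma>) \<noteq> 0" and z: "norm (q * a * \<beta> * \<gamma> * w) < 1"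
  shows "P (q * a * \<beta>) * P (q * a * \<gamma>) * (\<Sum>k. wp_coeff a \<beta> \<gamma> k * w ^ k) =
    P (q * a) * P (q * a * \<beta> * \<gamma>) * ((1 - q * a * w ^ 2) *
      lat_sum w (\<lambda>y. P (q * a * \<beta> * y) * P (q * a * \<gamma> * y) * P (q ^ 2 * a * w * y) /
        (P (q * a * \<beta> * \<gamma> * y) * P (q * a * y ^ 2))))"
proof -
  have w0: "w \<noteq> 0" using w by (simp add: generic_def)
  obtain D where D: "summable D" "\<And>k y. y \<in> lat w \<Longrightarrow> norm (wp_core a \<beta> \<gamma> k * (\<Prod>i<k. y - q ^ i)) \<le> D k"
    using wp_majorant [OF nz w0 z] by blast
  have D0: "D k \<ge> 0" for k using D(2) [OF lat_intros(1)] norm_ge_zero order_trans by blast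
  \<comment> \<open>What multiplies the product over \<open>i < k\<close>; its dependence on
    \<open>k\<close> comes from the factor \<open>P (q * a * \<delta> * q ^ k)\<close> of
    \<open>wp_term\<close>.\<close>
  define \<psi> where "\<psi> k y = P (q * a * q ^ k * y) * P (q ^ 2 * a * w * y) / P (q * a * y ^ 2)" for k y
  have \<psi>_bdd: "lat_bdd w (\<psi> k)" for k
    unfolding \<psi>_def by (intro lat_bdd_div_P_square lat_bdd_mult lat_bdd_P a) auto
  define f where "f k y = wp_coeff a \<beta> \<gamma> k * ((\<Prod>i<k. y - q ^ i) * \<psi> k y)" for k y
  have f_bdd: "lat_bdd w (\<lambda>y. (\<Prod>i<k. y - q ^ i) * \<psi> k y)" for k
    by (intro lat_bdd_mult lat_bdd_prod lat_bdd_diff \<psi>_bdd) auto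
  have Lf: "(1 - q * a * w ^ 2) * lat_sum w (f k) = wp_coeff a \<beta> \<gamma> k * w ^ k" for k
  proof -
    have "lat_sum w (f k) = wp_coeff a \<beta> \<gamma> k * (w ^ k * lat_sum (w / q ^ k) (\<lambda>y. \<psi> k (q ^ k * y)))"
      unfolding f_def lat_sum_cmult [OF w f_bdd] lat_sum_shift_power [OF w \<psi>_bdd] ..
    also have "(\<lambda>y. \<psi> k (q ^ k * y)) = kern (w / q ^ k) (a * q ^ (2 * k))"
    proof
      fix y
      have e: "q * a * q ^ k * (q ^ k * y) = q * (a * q ^ (2 * k)) * y"
        "q ^ 2 * a * w * (q ^ k * y) = q ^ 2 * (a * q ^ (2 * k)) * (w / q ^ k) * y"
        "q * a * (q ^ k * y) ^ 2 = q * (a * q ^ (2 * k)) * y ^ 2"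
        unfolding mult_2 power_add by (simp_all add: power2_eq_square mult_ac)
      then show "\<psi> k (q ^ k * y) = kern (w / q ^ k) (a * q ^ (2 * k)) y"
        unfolding \<psi>_def kern_def e by (simp only: mult.commute [of "P (q * _ * y)"])
    qed
    also have "(1 - q * a * w ^ 2) * (wp_coeff a \<beta> \<gamma> k * (w ^ k * lat_sum (w / q ^ k) (kern (w / q ^ k) (a * q ^ (2 * k))))) =
       wp_coeff a \<beta> \<gamma> k * w ^ k"
    proof -
      \<comment> \<open>The quantity \<open>q * a * w ^ 2\<close> is invariant under the
        simultaneous change of \<open>a\<close> and \<open>w\<close>, so a single prefactor
        evaluates the inner sums for all \<open>k\<close>.\<close>
      have e: "q * (a * q ^ (2 * k)) * (w / q ^ k) ^ 2 = q * a * w ^ 2"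
        by (simp add: power_divide mult_2 power_add power2_eq_square)
      have "P (q * (a * q ^ (2 * k))) \<noteq> 0" using P_shift_nonzero [OF a(1)] by (simp add: mult_ac)
      then have "(1 - q * a * w ^ 2) * lat_sum (w / q ^ k) (kern (w / q ^ k) (a * q ^ (2 * k))) = 1"
        using lat_sum_kern [OF generic_div_qpow [OF w], of "a * q ^ (2 * k)" k] a(2) unfolding e by blast
      then show ?thesis by (metis mult.assoc mult.commute mult.right_neutral)
    qed
    finally show ?thesis .
  qed
  have \<psi>_le: "\<exists>B. \<forall>k. \<forall>y\<in>lat w. norm (\<psi> k y) \<le> B"
  proof -
    have "lat_bdd w (\<lambda>y. P (q ^ 2 * a * w * y) / P (q * a * y ^ 2))"
      by (intro lat_bdd_div_P_square lat_bdd_mult lat_bdd_P a) auto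
    then obtain B where B: "B > 0" "\<And>y. y \<in> lat w \<Longrightarrow> norm (P (q ^ 2 * a * w * y) / P (q * a * y ^ 2)) \<le> B"
      by (erule lat_bddE)
    have "norm (\<psi> k y) \<le> pbound (norm (q * a) * (1 + norm w)) * B" if y: "y \<in> lat w" for k y
    proof -
      have "norm (P (q * a * y * q ^ k)) \<le> pbound (norm (q * a) * (1 + norm w))"
        using norm_lat_le [OF y] by (intro norm_P_shift_le) (simp add: norm_mult mult_left_mono)
      then have "norm (P (q * a * y * q ^ k) * (P (q ^ 2 * a * w * y) / P (q * a * y ^ 2))) \<le> pbound (norm (q * a) * (1 + norm w)) * B"
        unfolding norm_mult [of "P _"] using B(1) B(2) [OF y] by (intro mult_mono) (auto simp: less_imp_le)
      then show ?thesis by (simp add: \<psi>_def mult_ac)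
    qed
    then show ?thesis by blast
  qed
  then obtain B where B: "\<And>k y. y \<in> lat w \<Longrightarrow> norm (\<psi> k y) \<le> B" by blast
  have B0: "B \<ge> 0" using B [OF lat_intros(1)] norm_ge_zero order_trans by blast
  have f_le: "norm (f k y) \<le> D k * ((1 + norm a) * B)" if y: "y \<in> lat w" for k y
  proof -
    have "norm (f k y) = norm (wp_core a \<beta> \<gamma> k * (\<Prod>i<k. y - q ^ i)) * (norm (1 - a * q ^ (2 * k)) * norm (\<psi> k y))"
      by (simp add: f_def wp_coeff_def norm_mult mult_ac)
    also have "\<dots> \<le> D k * ((1 + norm a) * B)"
      using D0 B0 by (intro mult_mono D B y norm_one_minus_le) auto
    finally show ?thesis .
  qed
  have Dsum: "summable (\<lambda>k. D k * ((1 + norm a) * B))" by (intro summable_mult2 D)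
  have "(\<lambda>k. lat_sum w (f k)) sums lat_sum w (\<lambda>y. \<Sum>k. f k y)"
    by (rule lat_sum_sums [OF w f_le Dsum])
  then have sums: "(\<lambda>k. wp_coeff a \<beta> \<gamma> k * w ^ k) sums ((1 - q * a * w ^ 2) * lat_sum w (\<lambda>y. \<Sum>k. f k y))"
    unfolding Lf [symmetric] by (rule sums_mult)
  define \<Phi> where "\<Phi> y = P (q * a * \<beta> * y) * P (q * a * \<gamma> * y) * P (q ^ 2 * a * w * y) /
        (P (q * a * \<beta> * \<gamma> * y) * P (q * a * y ^ 2))" for y
  \<comment> \<open>Covers the denominator \<open>P (q * a * \<beta> * \<gamma> * y)\<close> on the
    progression from \<open>w\<close>, as \<open>bc\<close> does on the one from 1.\<close>
  have zz: "P (q * a * \<beta> * \<gamma> * w) \<noteq> 0" by (rule P_nonzero_if_norm_less [OF z])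
  have \<Phi>_bdd: "lat_bdd w \<Phi>"
    unfolding \<Phi>_def divide_divide_eq_left [symmetric]
    by (intro lat_bdd_div_P_square lat_bdd_div_P lat_bdd_mult lat_bdd_P a bc zz) auto
  define c where "c = P (q * a) * P (q * a * \<beta> * \<gamma>) / (P (q * a * \<beta>) * P (q * a * \<gamma>))"
  have "(\<Sum>k. f k y) = c * \<Phi> y" if y: "y \<in> lat w" for y
  proof -
    have "P (q * a * \<beta> * \<gamma> * y) \<noteq> 0"
      using y P_shift_nonzero [OF bc] P_shift_nonzero [OF zz] by (auto simp: lat_def mult_ac)
    then have S: "(\<Sum>k. wp_term a \<beta> \<gamma> y k) = c * (P (q * a * \<beta> * y) * P (q * a * \<gamma> * y) / P (q * a * \<beta> * \<gamma> * y))"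
      using wp_sum [OF nz w0 z y] nz(4,5) by (simp add: c_def field_simps)
    define g where "g = P (q ^ 2 * a * w * y) / P (q * a * y ^ 2)"
    have fg: "f k y = g * wp_term a \<beta> \<gamma> y k" for k
      by (simp add: f_def wp_term_def \<psi>_def g_def mult_ac)
    have "(\<Sum>k. f k y) = g * (\<Sum>k. wp_term a \<beta> \<gamma> y k)"
    \<comment> \<open>Summability of \<open>wp_term\<close> is obtained from that of
      \<open>f\<close> by dividing by \<open>g\<close>; for \<open>g = 0\<close> both sides are
      0.\<close>
    proof (cases "g = 0")
      case False
      have "summable (\<lambda>k. f k y)"
        by (rule summable_comparison_test' [OF Dsum]) (use f_le y in auto)
      then have "summable (wp_term a \<beta> \<gamma> y)"
        using False unfolding fg summable_cmult_iff by simp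
      then show ?thesis unfolding fg by (rule suminf_mult)
    qed (simp add: fg)
    then show ?thesis unfolding S by (simp add: \<Phi>_def g_def mult_ac)
  qed
  then have "lat_sum w (\<lambda>y. \<Sum>k. f k y) = c * lat_sum w \<Phi>"
    unfolding lat_sum_cmult [OF w \<Phi>_bdd, symmetric] by (rule lat_sum_cong)
  then have "(\<Sum>k. wp_coeff a \<beta> \<gamma> k * w ^ k) = (1 - q * a * w ^ 2) * (c * lat_sum w \<Phi>)"
    using sums by (simp add: sums_iff)
  then show ?thesis
    unfolding \<Phi>_def [symmetric] using nz(4,5) by (simp add: c_def field_simps)
qed

end

section \<open>Residues in an annulus\<close>

lemma contour_integral_circlepath_simple_pole:
  assumes "0 < r" "norm p \<noteq> r"
  shows "((\<lambda>x. 1 / (x - p)) has_contour_integral (if norm p < r then 2 * of_real pi * \<i> else 0)) (circlepath 0 r)"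
proof (cases "norm p < r")
  case True
  then show ?thesis
    using Cauchy_integral_circlepath_simple [of "\<lambda>_. 1" 0 r p] by simp
next
  case False
  then have "((\<lambda>x. 1 / (x - p)) has_contour_integral 0) (circlepath 0 r)"
    using assms by (intro Cauchy_theorem_disc_simple [of _ 0 "norm p"]) (auto intro!: holomorphic_intros)
  with False show ?thesis by simp
qed

text \<open>\<open>F\<close> minus its principal parts extends holomorphically to a neighbourhood of
  the closed annulus, in which the two circles are homotopic. Each principal part contributes to the
  outer circle only.\<close>

lemma annulus_residues:
  fixes F :: "complex \<Rightarrow> complex" and p :: "'i \<Rightarrow> complex"
  assumes r: "0 < r" "r < R" and J: "finite J" "inj_on p J" "\<And>j. j \<in> J \<Longrightarrow> r < norm (p j) \<and> norm (p j) < R"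
    and V: "open V" "F holomorphic_on V" "\<And>x. r \<le> norm x \<Longrightarrow> norm x \<le> R \<Longrightarrow> x \<in> V \<or> x \<in> p ` J"
    and loc: "\<And>j. j \<in> J \<Longrightarrow> \<exists>g N. open N \<and> p j \<in> N \<and> g holomorphic_on N \<and> g (p j) = \<rho> j \<and>
      (\<forall>x\<in>N - {p j}. F x = g x / (x - p j))"
  shows "contour_integral (circlepath 0 R) F - contour_integral (circlepath 0 r) F = 2 * of_real pi * \<i> * (\<Sum>j\<in>J. \<rho> j)"
proof -
  obtain g N where gN: "\<And>j. j \<in> J \<Longrightarrow> open (N j)" "\<And>j. j \<in> J \<Longrightarrow> p j \<in> N j" "\<And>j. j \<in> J \<Longrightarrow> g j holomorphic_on N j"
    "\<And>j. j \<in> J \<Longrightarrow> g j (p j) = \<rho> j" "\<And>j x. j \<in> J \<Longrightarrow> x \<in> N j - {p j} \<Longrightarrow> F x = g j x / (x - p j)"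
    using loc by metis
  define X where "X = p ` J"
  \<comment> \<open>The neighbourhoods \<open>N j\<close> are added so that the domain also contains
    the poles.\<close>
  define U where "U = V \<union> (\<Union>j\<in>J. N j)"
  have X: "finite X" "X \<subseteq> U" using J gN(2) by (auto simp: X_def U_def)
  have U: "open U" using V gN(1) by (auto simp: U_def)
  have ann: "x \<in> U" if "r \<le> norm x" "norm x \<le> R" for x
    using V(3) [OF that] gN(2) by (auto simp: U_def)
  have F: "F holomorphic_on U - X"
  proof -
    have "F holomorphic_on (N j - {p j})" if "j \<in> J" for j
    proof -
      have "(\<lambda>x. g j x / (x - p j)) holomorphic_on (N j - {p j})"
        by (intro holomorphic_intros holomorphic_on_subset [OF gN(3) [OF that]]) auto
      then show ?thesis using gN(5) [OF that] by (subst holomorphic_cong [OF refl])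
    qed
    then have "F holomorphic_on (\<Union>j\<in>J. N j - {p j})"
      using gN(1) by (intro holomorphic_on_UN_open) auto
    then have "F holomorphic_on V \<union> (\<Union>j\<in>J. N j - {p j})"
      using V gN(1) by (intro holomorphic_on_Un) auto
    then show ?thesis by (rule holomorphic_on_subset) (auto simp: U_def X_def)
  qed
  define S where "S x = (\<Sum>j\<in>J. \<rho> j * (1 / (x - p j)))" for x
  have "\<exists>G. G holomorphic_on U \<and> (\<forall>x\<in>U - X. G x = F x - S x)"
  proof (rule removable_singularities)
    show "finite X" "X \<subseteq> interior U" using X U by (auto simp: interior_open)
    show "(\<lambda>x. F x - S x) holomorphic_on U - X"
      unfolding S_def by (intro holomorphic_intros F) (auto simp: X_def)
  next
    fix z assume "z \<in> X"
    then obtain i where i: "i \<in> J" "z = p i" by (auto simp: X_def)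
    \<comment> \<open>Subtracting the principal part at \<open>z\<close> from \<open>F\<close>
      leaves a difference quotient of \<open>g i\<close>, whose limit is the derivative; so the
      singularity is removable.\<close>
    have "((\<lambda>x. (g i x - g i z) / (x - z)) \<longlongrightarrow> deriv (g i) z) (at z)"
      using holomorphic_derivI [OF gN(3) [OF i(1)] gN(1) [OF i(1)] gN(2) [OF i(1)], of UNIV] i unfolding has_field_derivative_iff by simp
    moreover have "((\<lambda>x. \<Sum>j\<in>J - {i}. \<rho> j * (1 / (x - p j))) \<longlongrightarrow> (\<Sum>j\<in>J - {i}. \<rho> j * (1 / (z - p j)))) (at z)"
      using i J(2) by (intro tendsto_intros) (auto simp: inj_on_def)
    ultimately have lim: "((\<lambda>x. (g i x - g i z) / (x - z) - (\<Sum>j\<in>J - {i}. \<rho> j * (1 / (x - p j)))) \<longlongrightarrow>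
        deriv (g i) z - (\<Sum>j\<in>J - {i}. \<rho> j * (1 / (z - p j)))) (at z)"
      by (rule tendsto_diff)
    have "\<forall>\<^sub>F x in at z. x \<in> N i - {z}"
      using gN(1,2) i by (intro eventually_at_in_open) auto
    then have "\<forall>\<^sub>F x in at z. (g i x - g i z) / (x - z) - (\<Sum>j\<in>J - {i}. \<rho> j * (1 / (x - p j))) = F x - S x"
    proof eventually_elim
      case (elim x)
      have "S x = \<rho> i * (1 / (x - p i)) + (\<Sum>j\<in>J - {i}. \<rho> j * (1 / (x - p j)))"
        unfolding S_def using i J(1) by (simp add: sum.remove)
      then show ?case using gN(4) [OF i(1)] gN(5) [OF i(1)] elim i(2) by (simp add: diff_divide_distrib)
    qed
    with lim have "((\<lambda>x. F x - S x) \<longlongrightarrow> deriv (g i) z - (\<Sum>j\<in>J - {i}. \<rho> j * (1 / (z - p j)))) (at z)"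
      by (rule Lim_transform_eventually)
    then show "(\<lambda>x. F x - S x) \<in> O[at z](\<lambda>_. 1)"
      by (intro bigoI_tendsto [where c = "deriv (g i) z - (\<Sum>j\<in>J - {i}. \<rho> j * (1 / (z - p j)))"]) auto
  qed
  then obtain G where G: "G holomorphic_on U" "\<And>x. x \<in> U - X \<Longrightarrow> G x = F x - S x" by blast
  have on_circle: "contour_integral (circlepath 0 s) G = contour_integral (circlepath 0 s) F -
      (\<Sum>j\<in>J. \<rho> j * (if norm (p j) < s then 2 * of_real pi * \<i> else 0))" if s: "s = r \<or> s = R" for s
  proof -
    have sX: "sphere 0 s \<subseteq> U - X" and s0: "s > 0" and sp: "\<And>j. j \<in> J \<Longrightarrow> norm (p j) \<noteq> s"
      using ann J(3) s r by (force simp: X_def)+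
    have "contour_integral (circlepath 0 s) G = contour_integral (circlepath 0 s) (\<lambda>x. F x - S x)"
      using sX s0 G(2) by (intro contour_integral_cong) auto
    also have "\<dots> = contour_integral (circlepath 0 s) F - contour_integral (circlepath 0 s) S"
    proof (rule contour_integral_diff)
      show "F contour_integrable_on circlepath 0 s"
        using sX s0 by (intro contour_integrable_continuous_circlepath continuous_on_subset [OF holomorphic_on_imp_continuous_on [OF F]]) auto
      show "S contour_integrable_on circlepath 0 s"
        unfolding S_def using sp s0
        by (intro contour_integrable_sum contour_integrable_lmul has_contour_integral_integrable [OF contour_integral_circlepath_simple_pole] J) auto
    qed
    also have "(S has_contour_integral (\<Sum>j\<in>J. \<rho> j * (if norm (p j) < s then 2 * of_real pi * \<i> else 0))) (circlepath 0 s)"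
      unfolding S_def using sp s0 J
      by (intro has_contour_integral_sum has_contour_integral_lmul contour_integral_circlepath_simple_pole) auto
    then have "contour_integral (circlepath 0 s) S = (\<Sum>j\<in>J. \<rho> j * (if norm (p j) < s then 2 * of_real pi * \<i> else 0))"
      by (rule contour_integral_unique)
    finally show ?thesis .
  qed
  have "contour_integral (circlepath 0 r) G = contour_integral (circlepath 0 R) G"
  proof (rule Cauchy_theorem_homotopic_loops [OF _ U G(1)])
    show "homotopic_loops U (circlepath 0 r) (circlepath 0 R)"
    proof (rule homotopic_loops_linear)
      fix t :: real
      show "closed_segment (circlepath 0 r t) (circlepath 0 R t) \<subseteq> U"
      proof
        fix x assume "x \<in> closed_segment (circlepath 0 r t) (circlepath 0 R t)"
        then obtain u where u: "0 \<le> u" "u \<le> 1" "x = (1 - u) *\<^sub>R circlepath 0 r t + u *\<^sub>R circlepath 0 R t"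
          by (auto simp: closed_segment_def)
        define v where "v = (1 - u) * r + u * R"
        have v: "r \<le> v" "v \<le> R"
        proof -
          have "u * (R - r) \<ge> 0" "(1 - u) * (R - r) \<ge> 0" using u r by auto
          then show "r \<le> v" "v \<le> R" by (simp_all add: v_def algebra_simps)
        qed
        have "x = of_real v * exp (2 * of_real pi * \<i> * of_real t)"
          unfolding u(3) circlepath v_def by (simp add: scaleR_conv_of_real algebra_simps)
        then have "norm x = v" using v r by (simp add: norm_mult)
        then show "x \<in> U" using ann v by simp
      qed
    qed auto
  qed auto
  moreover have "(\<Sum>j\<in>J. \<rho> j * (if norm (p j) < r then 2 * of_real pi * \<i> else 0)) = 0"
    using J(3) by (intro sum.neutral) force
  moreover have "(\<Sum>j\<in>J. \<rho> j * (if norm (p j) < R then 2 * of_real pi * \<i> else 0)) = (\<Sum>j\<in>J. \<rho> j * (2 * of_real pi * \<i>))"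
    using J(3) by (intro sum.cong) auto
  ultimately have "contour_integral (circlepath 0 r) F =
     contour_integral (circlepath 0 R) F - (\<Sum>j\<in>J. \<rho> j * (2 * of_real pi * \<i>))"
    using on_circle [of r] on_circle [of R] by simp
  then show ?thesis by (simp add: sum_distrib_left sum_distrib_right mult_ac algebra_simps)
qed

text \<open>Dominated convergence for truncated terms. The sets \<open>K n\<close> are arbitrary
  finite sets because an annulus cuts a progression at both ends.\<close>

lemma tendsto_sum_exhausting:
  fixes t :: "nat \<Rightarrow> complex"
  assumes "summable (\<lambda>k. norm (t k))" and "\<And>n. finite (K n)" and "\<And>k. \<forall>\<^sub>F n in sequentially. k \<in> K n"
  shows "(\<lambda>n. \<Sum>k\<in>K n. t k) \<longlonglongrightarrow> (\<Sum>k. t k)"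
proof -
  have "(\<lambda>n. \<Sum>k. if k \<in> K n then t k else 0) \<longlonglongrightarrow> (\<Sum>k. t k)"
  proof (intro tannerys_theorem [THEN conjunct2, THEN conjunct2])
    show "(\<lambda>n. if k \<in> K n then t k else 0) \<longlonglongrightarrow> t k" for k
      by (rule tendsto_eventually, use assms(3) [of k] in eventually_elim) simp
    show "\<forall>\<^sub>F (k, n) in sequentially \<times>\<^sub>F sequentially. norm (if k \<in> K n then t k else 0) \<le> norm (t k)"
      by (intro always_eventually) auto
  qed (use assms(1) in auto)
  moreover have "(\<Sum>k. if k \<in> K n then t k else 0) = (\<Sum>k\<in>K n. t k)" for n
    using suminf_finite [OF assms(2), of n "\<lambda>k. if k \<in> K n then t k else 0"] by simp
  ultimately show ?thesis by simp
qed

context nome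
begin

text \<open>The Gaussian factor enters only through the length of the list, so it cancels against
  the denominator factors of \<open>P_set_reflect\<close> when \<open>length B = card D\<close>.
  What depends on \<open>n\<close> is then a bounded part and a power of
  \<open>prod_list B / \<Prod>D\<close>.\<close>

lemma P_list_reflect:
  assumes "x \<noteq> 0" "e = - x" "0 \<notin> set B"
  shows "(\<Prod>b\<leftarrow>B. P (b / (x * q ^ n))) =
    (\<Prod>b\<leftarrow>B. P (b / x)) * (\<Prod>b\<leftarrow>B. poch (q * x / b) n) * (prod_list B / e ^ length B) ^ n /
      (q ^ (Suc n choose 2)) ^ length B"
  using assms(3)
proof (induction B)
  case (Cons b B)
  have "P (b / (x * q ^ n)) = P (b / x) * (poch (q * x / b) n * (- (b / x)) ^ n / q ^ (Suc n choose 2))"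
    using P_reflect [of "b / x" n] assms Cons.prems by simp
  moreover have "- (b / x) = b / e" using assms by simp
  ultimately show ?case
    using Cons by (simp add: power_mult_distrib power_divide mult_ac del: minus_divide_right divide_minus_right)
qed simp

lemma P_set_reflect:
  assumes "x \<noteq> 0" "e = - x" "0 \<notin> D" "finite D"
  shows "(\<Prod>d\<in>D. P (d / (x * q ^ n))) =
    (\<Prod>d\<in>D. P (d / x)) * (\<Prod>d\<in>D. poch (q * x / d) n) * (\<Prod>D / e ^ card D) ^ n /
      (q ^ (Suc n choose 2)) ^ card D"
  using assms(4,3)
proof (induction D rule: finite_induct)
  case (insert d D)
  have "P (d / (x * q ^ n)) = P (d / x) * (poch (q * x / d) n * (- (d / x)) ^ n / q ^ (Suc n choose 2))"
    using P_reflect [of "d / x" n] assms insert.prems by simp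
  moreover have "- (d / x) = d / e" using assms by simp
  ultimately show ?case
    using insert by (simp add: power_mult_distrib power_divide mult_ac del: minus_divide_right divide_minus_right)
qed simp

lemma P_list_holomorphic:
  assumes "0 \<notin> S"
  shows "(\<lambda>x. \<Prod>a\<leftarrow>A. P (a * x)) holomorphic_on S" "(\<lambda>x. \<Prod>a\<leftarrow>A. P (a / x)) holomorphic_on S"
  using assms by (induction A) (auto intro!: holomorphic_intros)

lemma P_set_holomorphic:
  assumes "0 \<notin> S"
  shows "(\<lambda>x. \<Prod>a\<in>A. P (a * x)) holomorphic_on S" "(\<lambda>x. \<Prod>a\<in>A. P (a / x)) holomorphic_on S"
  using assms by (auto intro!: holomorphic_intros)

lemma norm_P_list_le:
  assumes "\<And>a. a \<in> set A \<Longrightarrow> norm (g a) \<le> M"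
  shows "norm (\<Prod>a\<leftarrow>A. P (g a)) \<le> pbound M ^ length A"
  using assms by (induction A) (auto simp: norm_mult less_imp_le intro!: mult_mono norm_P_le)

lemma norm_poch_list_le:
  assumes "\<And>a. a \<in> set A \<Longrightarrow> norm (g a) \<le> M"
  shows "norm (\<Prod>a\<leftarrow>A. poch (g a) n) \<le> pbound M ^ length A"
  using assms by (induction A) (auto simp: norm_mult less_imp_le intro!: mult_mono norm_poch_le)

text \<open>Numerator parameters form lists, since they may coincide; denominator parameters form
  sets, since a repetition would produce a double pole. The inversion \<open>x -> 1 / x\<close>
  swaps \<open>A\<close> with \<open>B\<close> and \<open>C\<close> with \<open>D\<close>, which
  reduces one end of the annulus to the other.\<close>

definition integrand :: "complex list \<Rightarrow> complex list \<Rightarrow> complex set \<Rightarrow> complex set \<Rightarrow> complex \<Rightarrow> complex" where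
  "integrand A B C D x = ((\<Prod>a\<leftarrow>A. P (a * x)) * (\<Prod>b\<leftarrow>B. P (b / x))) /
    ((\<Prod>c\<in>C. P (c * x)) * (\<Prod>d\<in>D. P (d / x)))"

text \<open>The residue of \<open>integrand A B C D x / x\<close> at \<open>x = d * q ^ k\<close>.
  In \<open>P (d / x)\<close> the vanishing factor is dropped; the factors before it give
  \<open>poch (1 / q ^ k) k\<close>, those after it \<open>P q\<close>.\<close>

definition pole_res :: "complex list \<Rightarrow> complex list \<Rightarrow> complex set \<Rightarrow> complex set \<Rightarrow> complex \<Rightarrow> nat \<Rightarrow> complex" where
  "pole_res A B C D d k = ((\<Prod>a\<leftarrow>A. P (a * (d * q ^ k))) * (\<Prod>b\<leftarrow>B. P (b / (d * q ^ k)))) /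
    ((\<Prod>c\<in>C. P (c * (d * q ^ k))) * (\<Prod>d'\<in>D - {d}. P (d' / (d * q ^ k))) * (poch (1 / q ^ k) k * P q))"

lemma integrand_inverse: "integrand A B C D (1 / x) = integrand B A D C x"
  by (simp add: integrand_def mult_ac)

text \<open>The counterpart of \<open>P_reflect\<close> at \<open>y = 1\<close>, where that identity
  reads 0 = 0.\<close>

lemma poch_reflect_self: "poch (1 / q ^ k) k = poch q k * (- 1) ^ k / q ^ (Suc k choose 2)"
proof (induction k)
  case (Suc k)
  define t where "t = 1 - q * q ^ k"
  have "poch (1 / q ^ Suc k) (Suc k) = (1 - 1 / q ^ Suc k) * poch (1 / q ^ k) k"
    by (simp add: poch_Suc_shift)
  also have "1 - 1 / q ^ Suc k = t * (- 1) / q ^ Suc k" by (simp add: field_simps t_def)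
  finally show ?case
    unfolding Suc poch_Suc t_def [symmetric] by (simp add: power_add numeral_2_eq_2 mult_ac)
qed (simp add: binomial_eq_0)

definition res_term :: "complex list \<Rightarrow> complex list \<Rightarrow> complex set \<Rightarrow> complex set \<Rightarrow> complex \<Rightarrow> nat \<Rightarrow> complex" where
  "res_term A B C D d k = (\<Prod>a\<leftarrow>A. P (a * d * q ^ k)) / (\<Prod>c\<in>C. P (c * d * q ^ k)) *
    (\<Prod>b\<leftarrow>B. poch (q * d / b) k) / (\<Prod>d'\<in>D. poch (q * d / d') k) * (prod_list B / \<Prod>D) ^ k"

definition res_pref :: "complex list \<Rightarrow> complex set \<Rightarrow> complex \<Rightarrow> complex" where
  "res_pref B D d = (\<Prod>b\<leftarrow>B. P (b / d)) / (P q * (\<Prod>d'\<in>D - {d}. P (d' / d)))"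

text \<open>All factors in \<open>1 / x\<close> are reflected. The denominator has lost the
  parameter \<open>d\<close>, but \<open>poch_reflect_self\<close> supplies the missing Gaussian
  factor and sign, so only the power of \<open>prod_list B / \<Prod>D\<close> is left.\<close>

lemma pole_res_eq:
  assumes "finite D" "d \<in> D" "0 \<notin> D" "0 \<notin> set B" "length B = card D"
  shows "pole_res A B C D d k = res_pref B D d * res_term A B C D d k"
proof -
  have d0: "d \<noteq> 0" using assms by auto
  define g where "g = q ^ (Suc k choose 2)"
  have g0: "g \<noteq> 0" by (simp add: g_def)
  define m where "m = card (D - {d})"
  have len: "length B = Suc m" unfolding m_def assms(5) using card_Suc_Diff1 [OF assms(1,2)] by (rule sym)
  define y where "y = (- d) ^ m"
  have y0: "y \<noteq> 0" using d0 by (simp add: y_def)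
  define \<Omega> where "\<Omega> = \<Prod>(D - {d})"
  have \<Omega>: "\<Prod>D = d * \<Omega>" "\<Omega> \<noteq> 0" using assms by (auto simp: \<Omega>_def prod.remove)
  have poch: "(\<Prod>d'\<in>D. poch (q * d / d') k) = poch q k * (\<Prod>d'\<in>D - {d}. poch (q * d / d') k)"
    using assms d0 by (simp add: prod.remove)
  have B: "(\<Prod>b\<leftarrow>B. P (b / (d * q ^ k))) = (\<Prod>b\<leftarrow>B. P (b / d)) * (\<Prod>b\<leftarrow>B. poch (q * d / b) k) *
      (prod_list B / (- d * y)) ^ k / (g * g ^ m)"
    using P_list_reflect [OF d0 refl assms(4), of k] by (simp add: len g_def y_def)
  have D: "(\<Prod>d'\<in>D - {d}. P (d' / (d * q ^ k))) = (\<Prod>d'\<in>D - {d}. P (d' / d)) *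
      (\<Prod>d'\<in>D - {d}. poch (q * d / d') k) * (\<Omega> / y) ^ k / g ^ m"
    using P_set_reflect [OF d0 refl, of "D - {d}" k] assms by (simp add: m_def g_def y_def \<Omega>_def)
  have e: "(prod_list B / (- d * y)) ^ k = (prod_list B / (d * \<Omega>)) ^ k * ((\<Omega> / y) ^ k * (- 1) ^ k)"
    unfolding power_mult_distrib [symmetric] using \<Omega>(2) d0 y0 by (simp add: field_simps)
  define u where "u = (\<Omega> / y) ^ k"
  define s :: complex where "s = (- 1) ^ k"
  have us: "u \<noteq> 0" "s \<noteq> 0" using \<Omega> y0 by (auto simp: u_def s_def)
  show ?thesis
    unfolding pole_res_def res_pref_def res_term_def B D poch \<Omega> poch_reflect_self g_def [symmetric] e u_def [symmetric] s_def [symmetric]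
    using us g0 by (simp add: mult_ac)
qed

lemma res_term_summable:
  assumes fin: "finite C" "finite D" and d: "d \<in> D" "0 \<notin> D"
    and C: "\<And>c. c \<in> C \<Longrightarrow> P (c * d) \<noteq> 0" and D: "\<And>d'. d' \<in> D \<Longrightarrow> d' \<noteq> d \<Longrightarrow> P (d / d') \<noteq> 0"
    and lt: "norm (prod_list B) < norm (\<Prod>D)"
  shows "summable (\<lambda>k. norm (res_term A B C D d k))"
proof -
  have d0: "d \<noteq> 0" using d by auto
  obtain M where M: "M \<ge> 0" "\<And>a. a \<in> set A \<Longrightarrow> norm (a * d) \<le> M" "\<And>b. b \<in> set B \<Longrightarrow> norm (q * d / b) \<le> M"
  proof -
    define M where "M = (\<Sum>a\<in>set A. norm (a * d)) + (\<Sum>b\<in>set B. norm (q * d / b))"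
    have "norm (a * d) \<le> M" if "a \<in> set A" for a
      using member_le_sum [of a "set A" "\<lambda>a. norm (a * d)"] that unfolding M_def
      by (smt (verit) List.finite_set norm_ge_zero sum_nonneg)
    moreover have "norm (q * d / b) \<le> M" if "b \<in> set B" for b
      using member_le_sum [of b "set B" "\<lambda>b. norm (q * d / b)"] that unfolding M_def
      by (smt (verit) List.finite_set norm_ge_zero sum_nonneg)
    moreover have "M \<ge> 0" unfolding M_def by (intro add_nonneg_nonneg sum_nonneg) auto
    ultimately show ?thesis using that by blast
  qed
  have "\<exists>K. \<forall>k. norm (inverse (\<Prod>c\<in>C. P (c * d * q ^ k))) \<le> K"
    using fin(1) C
  proof (induction C rule: finite_induct)
    case (insert c C)
    then obtain K where K: "\<And>k. norm (inverse (\<Prod>c\<in>C. P (c * d * q ^ k))) \<le> K" by auto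
    have "norm (inverse (P (c * d * q ^ k)) * inverse (\<Prod>c\<in>C. P (c * d * q ^ k))) \<le> pbound (norm (c * d)) / norm (P (c * d)) * K" for k
      unfolding norm_mult [of "inverse _"] using insert.prems
      by (intro mult_mono norm_inverse_P_shift_le K) (auto simp: less_imp_le)
    then show ?case using insert.hyps by (auto simp: inverse_mult_distrib)
  qed auto
  then obtain K1 where K1: "\<And>k. norm (inverse (\<Prod>c\<in>C. P (c * d * q ^ k))) \<le> K1" by blast
  have "\<exists>K. \<forall>k. norm (inverse (\<Prod>d'\<in>D'. poch (q * d / d') k)) \<le> K" if "D' \<subseteq> D" for D'
    using finite_subset [OF that fin(2)] that
  proof (induction D' rule: finite_induct)
    case (insert x E)
    then obtain K where K: "\<And>k. norm (inverse (\<Prod>d'\<in>E. poch (q * d / d') k)) \<le> K" by auto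
    have "P (q * d / x) \<noteq> 0"
    proof (cases "x = d")
      case True
      then show ?thesis using d0 by simp
    next
      case False
      then have "P (d / x) \<noteq> 0" using D insert.prems by auto
      then show ?thesis using P_step [of "d / x"] by (auto simp: mult.commute)
    qed
    then obtain L where L: "L > 0" "\<And>k. norm (inverse (poch (q * d / x) k)) \<le> L" using inverse_poch_bounded by blast
    have "norm (inverse (poch (q * d / x) k) * inverse (\<Prod>d'\<in>E. poch (q * d / d') k)) \<le> L * K" for k
      unfolding norm_mult [of "inverse _"] using L by (intro mult_mono K) auto
    then show ?case using insert.hyps by (auto simp: inverse_mult_distrib)
  qed auto
  then obtain K2 where K2: "\<And>k. norm (inverse (\<Prod>d'\<in>D. poch (q * d / d') k)) \<le> K2" by blast
  have K0: "K1 \<ge> 0" "K2 \<ge> 0" using K1 [of 0] K2 [of 0] norm_ge_zero order_trans by blast+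
  define K where "K = pbound M ^ length A * K1 * pbound M ^ length B * K2"
  define \<theta> where "\<theta> = norm (prod_list B / \<Prod>D)"
  have \<theta>: "\<theta> < 1" using lt by (auto simp: \<theta>_def norm_divide divide_simps)
  show ?thesis
  proof (rule summable_comparison_test')
    show "summable (\<lambda>k. K * \<theta> ^ k)" using \<theta> by (intro summable_mult summable_geometric) (auto simp: \<theta>_def)
    fix k :: nat
    have "norm (\<Prod>a\<leftarrow>A. P (a * d * q ^ k)) \<le> pbound M ^ length A"
    proof (rule norm_P_list_le)
      fix a assume "a \<in> set A"
      then have "norm (a * d) * norm q ^ k \<le> M * 1"
        using M q_less by (intro mult_mono power_le_one) auto
      then show "norm (a * d * q ^ k) \<le> M" by (simp add: norm_mult norm_power)
    qed
    moreover have "norm (\<Prod>b\<leftarrow>B. poch (q * d / b) k) \<le> pbound M ^ length B"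
      by (intro norm_poch_list_le M)
    ultimately have "norm (\<Prod>a\<leftarrow>A. P (a * d * q ^ k)) * norm (inverse (\<Prod>c\<in>C. P (c * d * q ^ k))) *
      norm (\<Prod>b\<leftarrow>B. poch (q * d / b) k) * norm (inverse (\<Prod>d'\<in>D. poch (q * d / d') k)) * \<theta> ^ k \<le> K * \<theta> ^ k"
      unfolding K_def using K0 by (intro mult_right_mono mult_mono K1 K2) (auto simp: less_imp_le \<theta>_def)
    then show "norm (norm (res_term A B C D d k)) \<le> K * \<theta> ^ k"
      by (simp add: res_term_def norm_mult norm_divide norm_inverse norm_power divide_inverse \<theta>_def mult_ac power_mult_distrib)
  qed
qed

end

section \<open>The sum of all residues\<close>

context nome
begin

text \<open>Pairwise distinctness of all poles. Since the quotient conditions range over ordered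
  pairs, they exclude that two parameters of one family differ by an integer power of
  \<open>q\<close> of either sign; the last condition separates the two families.\<close>

definition simple_poles :: "complex set \<Rightarrow> complex set \<Rightarrow> bool" where
  "simple_poles C D \<longleftrightarrow> finite C \<and> finite D \<and> 0 \<notin> C \<and> 0 \<notin> D \<and>
     (\<forall>c\<in>C. \<forall>c'\<in>C. c \<noteq> c' \<longrightarrow> P (c / c') \<noteq> 0) \<and> (\<forall>d\<in>D. \<forall>d'\<in>D. d \<noteq> d' \<longrightarrow> P (d / d') \<noteq> 0) \<and>
     (\<forall>c\<in>C. \<forall>d\<in>D. P (c * d) \<noteq> 0)"

lemma simple_poles_commute: "simple_poles C D \<Longrightarrow> simple_poles D C"
proof -
  assume s: "simple_poles C D"
  then have "P (d * c) \<noteq> 0" if "d \<in> D" "c \<in> C" for c d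
    using that by (simp add: mult.commute [of d c] simple_poles_def)
  with s show ?thesis by (simp add: simple_poles_def)
qed

lemma P_shift_back_nonzero:
  assumes "x \<noteq> 0" "P x \<noteq> 0" "P (1 / x) \<noteq> 0"
  shows "P (x / q ^ k) \<noteq> 0"
proof
  assume "P (x / q ^ k) = 0"
  then obtain j where j: "x / q ^ k * q ^ j = 1" by (auto simp: P_eq_0_iff)
  show False
  proof (cases "k \<le> j")
    case True
    then have "x * q ^ (j - k) = 1" using j by (simp add: power_diff)
    then show False using assms(2) by (auto simp: P_eq_0_iff)
  next
    case False
    then have "1 / x * q ^ (k - j) = 1" using j assms(1) by (simp add: power_diff field_simps)
    then show False using assms(3) by (auto simp: P_eq_0_iff)
  qed
qed

lemma simple_pole:
  assumes s: "simple_poles C D" and d: "d \<in> D"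
  shows "\<exists>g N. open N \<and> d * q ^ k \<in> N \<and> 0 \<notin> N \<and> g holomorphic_on N \<and> g (d * q ^ k) = pole_res A B C D d k \<and>
      (\<forall>x\<in>N - {d * q ^ k}. integrand A B C D x / x = g x / (x - d * q ^ k))"
proof -
  have fin: "finite C" "finite D" and d0: "d \<noteq> 0" using s d by (auto simp: simple_poles_def)
  define p where "p = d * q ^ k"
  have p0: "p \<noteq> 0" using d0 by (simp add: p_def)
  \<comment> \<open>The denominator without its only vanishing factor \<open>1 - p / x\<close>.
    Multiplied by the \<open>x\<close> from \<open>dx / x\<close>, that factor becomes
    \<open>x - p\<close>.\<close>
  define den where "den x = (\<Prod>c\<in>C. P (c * x)) * (\<Prod>d'\<in>D - {d}. P (d' / x)) * (poch (d / x) k * P (d / x * q ^ Suc k))" for x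
  define g where "g x = (\<Prod>a\<leftarrow>A. P (a * x)) * (\<Prod>b\<leftarrow>B. P (b / x)) / den x" for x
  define N where "N = {x\<in>-{0}. den x \<in> -{0}}"
  have poch_holo: "(\<lambda>x. poch (d / x) k) holomorphic_on S" if "0 \<notin> S" for S
    unfolding qpoch_def using that by (intro holomorphic_intros) auto
  have den_holo: "den holomorphic_on S" if "0 \<notin> S" for S
    unfolding den_def using that by (intro holomorphic_intros P_set_holomorphic poch_holo) auto
  have "open N"
    unfolding N_def using continuous_open_preimage [OF holomorphic_on_imp_continuous_on [OF den_holo], of "- {0}" "- {0}"]
    by (simp add: vimage_def Int_def open_Compl)
  moreover have "p \<in> N"
  proof -
    have "P (c * p) \<noteq> 0" if "c \<in> C" for c
      using s d that P_shift_nonzero [of "c * d" k] by (auto simp: simple_poles_def p_def mult.assoc)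
    moreover have "P (d' / p) \<noteq> 0" if "d' \<in> D - {d}" for d'
    proof -
      have "d' \<noteq> 0" "P (d' / d) \<noteq> 0" "P (d / d') \<noteq> 0" using s d that by (auto simp: simple_poles_def)
      then show ?thesis using P_shift_back_nonzero [of "d' / d" k] d0 by (simp add: p_def)
    qed
    moreover have "poch (d / p) k \<noteq> 0"
      using d0 poch_reflect_self [of k] by (simp add: p_def)
    moreover have "P (d / p * q ^ Suc k) \<noteq> 0"
      using d0 by (simp add: p_def)
    ultimately show ?thesis using p0 fin by (simp add: N_def den_def)
  qed
  moreover have "0 \<notin> N" by (simp add: N_def)
  moreover have "g holomorphic_on N"
    unfolding g_def by (intro holomorphic_intros P_list_holomorphic den_holo) (auto simp: N_def)
  moreover have "g p = pole_res A B C D d k"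
    using d0 by (simp add: g_def den_def pole_res_def p_def)
  moreover have "integrand A B C D x / x = g x / (x - p)" if x: "x \<in> N - {p}" for x
  proof -
    have x0: "x \<noteq> 0" using x by (simp add: N_def)
    have "P (d / x) = poch (d / x) k * ((1 - p / x) * P (d / x * q ^ Suc k))"
      using P_split [of "d / x" k] P_step [of "d / x * q ^ k"] by (simp add: p_def mult_ac)
    then have "(\<Prod>c\<in>C. P (c * x)) * (\<Prod>d\<in>D. P (d / x)) = den x * (1 - p / x)"
      using fin d by (simp add: prod.remove den_def mult_ac)
    then have "integrand A B C D x = g x / (1 - p / x)"
      by (simp add: integrand_def g_def)
    moreover have "(1 - p / x) * x = x - p" using x0 by (simp add: left_diff_distrib)
    ultimately show ?thesis by (metis divide_divide_eq_left)
  qed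
  ultimately show ?thesis unfolding p_def by blast
qed

text \<open>Obtained from \<open>simple_pole\<close> by \<open>x -> 1 / x\<close>. The form
  \<open>dx / x\<close> changes its sign under this substitution, hence the minus sign of the
  residue.\<close>

lemma simple_pole_inverse:
  assumes s: "simple_poles C D" and c: "c \<in> C"
  shows "\<exists>g N. open N \<and> 1 / (c * q ^ k) \<in> N \<and> g holomorphic_on N \<and> g (1 / (c * q ^ k)) = - pole_res B A D C c k \<and>
      (\<forall>x\<in>N - {1 / (c * q ^ k)}. integrand A B C D x / x = g x / (x - 1 / (c * q ^ k)))"
proof -
  define p where "p = c * q ^ k"
  have p0: "p \<noteq> 0" using s c by (auto simp: p_def simple_poles_def)
  obtain g N where g: "open N" "p \<in> N" "0 \<notin> N" "g holomorphic_on N" "g p = pole_res B A D C c k"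
    "\<And>x. x \<in> N - {p} \<Longrightarrow> integrand B A D C x / x = g x / (x - p)"
    using simple_pole [OF simple_poles_commute [OF s] c, of k B A] unfolding p_def by blast
  define M where "M = {x\<in>-{0}. 1 / x \<in> N}"
  have "open M"
    unfolding M_def using continuous_open_preimage [of "- {0::complex}" "\<lambda>x. 1 / x" N] g(1)
    by (simp add: vimage_def Int_def open_Compl continuous_intros)
  moreover have "1 / p \<in> M" using g(2) p0 by (simp add: M_def)
  moreover have "(\<lambda>x. - g (1 / x) * (1 / p) / x) holomorphic_on M"
  proof -
    have "(g \<circ> (\<lambda>x. 1 / x)) holomorphic_on M"
      by (rule holomorphic_on_compose_gen [OF _ g(4)]) (auto simp: M_def intro!: holomorphic_intros)
    then show ?thesis by (intro holomorphic_intros) (auto simp: M_def o_def)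
  qed
  moreover have "- g (1 / (1 / p)) * (1 / p) / (1 / p) = - pole_res B A D C c k" using g(5) p0 by simp
  moreover have "integrand A B C D x / x = (- g (1 / x) * (1 / p) / x) / (x - 1 / p)" if x: "x \<in> M - {1 / p}" for x
  proof -
    have x0: "x \<noteq> 0" "1 / x \<in> N - {p}" "x * p \<noteq> 1" using x p0 by (auto simp: M_def field_simps)
    have "integrand A B C D x / x = (integrand B A D C (1 / x) / (1 / x)) / x ^ 2"
      using integrand_inverse [of B A D C x] x0(1) by (simp add: power2_eq_square)
    also have "\<dots> = g (1 / x) / (1 / x - p) / x ^ 2"
      unfolding g(6) [OF x0(2)] ..
    also have "(1 / x - p) * x ^ 2 = - (x * p * (x - 1 / p))"
      using x0 p0 by (simp add: field_simps power2_eq_square)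
    then have "g (1 / x) / (1 / x - p) / x ^ 2 = (- g (1 / x) * (1 / p) / x) / (x - 1 / p)"
      by (simp add: mult_ac)
    finally show ?thesis .
  qed
  ultimately show ?thesis unfolding p_def by blast
qed

lemma norm_P_set_le:
  assumes "\<And>a. a \<in> A \<Longrightarrow> norm (g a) \<le> M"
  shows "norm (\<Prod>a\<in>A. P (g a)) \<le> pbound M ^ card A"
  using assms by (induction A rule: infinite_finite_induct) (auto simp: norm_mult less_imp_le intro!: mult_mono norm_P_le)

lemma norm_poch_set_le:
  assumes "\<And>a. a \<in> A \<Longrightarrow> norm (g a) \<le> M"
  shows "norm (\<Prod>a\<in>A. poch (g a) n) \<le> pbound M ^ card A"
  using assms by (induction A rule: infinite_finite_induct) (auto simp: norm_mult less_imp_le intro!: mult_mono norm_poch_le)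

text \<open>After reflection the Gaussian factors cancel by \<open>len\<close>, and
  \<open>lt\<close> makes the remaining power decay. It suffices to study one circle that avoids all
  zeros of the denominators.\<close>

lemma integrand_decay:
  assumes fin: "finite C" "finite D" and z: "0 \<notin> D" "0 \<notin> set B" "0 \<notin> C"
    and len: "length B = card D" and lt: "norm (prod_list B) < norm (\<Prod>D)" and s: "s > 0"
    and nz: "\<And>x c. norm x = s \<Longrightarrow> c \<in> C \<Longrightarrow> P (c * x) \<noteq> 0" "\<And>x d. norm x = s \<Longrightarrow> d \<in> D \<Longrightarrow> P (d / x) \<noteq> 0"
      "\<And>x d. norm x = s \<Longrightarrow> d \<in> D \<Longrightarrow> P (q * x / d) \<noteq> 0"
  obtains K where "\<And>n x. norm x = s \<Longrightarrow> norm (integrand A B C D (x * q ^ n)) \<le> K * norm (prod_list B / \<Prod>D) ^ n"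
proof -
  \<comment> \<open>\<open>H\<close> collects all that does not depend on \<open>n\<close> and is
    bounded by compactness of the circle. Reciprocals that depend on \<open>n\<close> are rewritten
    by \<open>P_split\<close> as a bounded product over a value on the fixed circle; this brings in
    the factors with \<open>q / d * x\<close> and \<open>c * x\<close>.\<close>
  define H where "H x = (\<Prod>b\<leftarrow>B. P (b / x)) / ((\<Prod>d\<in>D. P (d / x)) * (\<Prod>d\<in>D. P (q / d * x)) * (\<Prod>c\<in>C. P (c * x)))" for x
  have "H holomorphic_on sphere 0 s"
    unfolding H_def using nz fin s
    by (intro holomorphic_on_divide holomorphic_on_mult P_list_holomorphic P_set_holomorphic)
      (auto simp: times_divide_eq_left intro!: holomorphic_intros)
  then have "compact (H ` sphere 0 s)"
    by (intro compact_continuous_image holomorphic_on_imp_continuous_on) auto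
  then obtain K0 where "\<forall>y\<in>H ` sphere 0 s. norm y \<le> K0"
    using compact_imp_bounded bounded_iff by metis
  then have K0: "norm (H x) \<le> K0" if "norm x = s" for x
    using that by simp
  have "norm (H (of_real s)) \<le> K0" using s by (intro K0) simp
  then have K00: "K0 \<ge> 0" by (rule order_trans [OF norm_ge_zero])
  have "finite (set A \<union> (\<lambda>b. q / b) ` set B \<union> C \<union> (\<lambda>d. q / d) ` D)" using fin by auto
  then obtain M where M0: "\<And>a. a \<in> set A \<union> (\<lambda>b. q / b) ` set B \<union> C \<union> (\<lambda>d. q / d) ` D \<Longrightarrow> norm a \<le> M"
    using finite_imp_bounded bounded_iff by metis
  define K where "K = K0 * (pbound (M * s) ^ length A * pbound (M * s) ^ length B * pbound (M * s) ^ card C * pbound (M * s) ^ card D)"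
  have "norm (integrand A B C D (x * q ^ n)) \<le> K * norm (prod_list B / \<Prod>D) ^ n" if x: "norm x = s" for x n
  proof -
    have x0: "x \<noteq> 0" using x s by auto
    have M: "norm (a * x) \<le> M * s" "norm (a * x * q ^ n) \<le> M * s"
      if "a \<in> set A \<union> (\<lambda>b. q / b) ` set B \<union> C \<union> (\<lambda>d. q / d) ` D" for a
    proof -
      show *: "norm (a * x) \<le> M * s" using M0 [OF that] x s by (simp add: norm_mult mult_right_mono)
      have "norm (a * x) * norm q ^ n \<le> norm (a * x) * 1" using q_less by (intro mult_left_mono power_le_one) auto
      with * show "norm (a * x * q ^ n) \<le> M * s" by (simp add: norm_mult norm_power)
    qed
    define e where "e = - x"
    have e0: "e \<noteq> 0" using x0 by (simp add: e_def)
    define G where "G = (q ^ (Suc n choose 2)) ^ card D"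
    have G0: "G \<noteq> 0" by (simp add: G_def)
    have 1: "(\<Prod>b\<leftarrow>B. P (b / (x * q ^ n))) = (\<Prod>b\<leftarrow>B. P (b / x)) * (\<Prod>b\<leftarrow>B. poch (q / b * x) n) * (prod_list B / e ^ card D) ^ n / G"
      using P_list_reflect [OF x0 e_def z(2), of n] by (simp add: G_def len)
    have 2: "(\<Prod>d\<in>D. P (d / (x * q ^ n))) = (\<Prod>d\<in>D. P (d / x)) * (\<Prod>d\<in>D. poch (q / d * x) n) * (\<Prod>D / e ^ card D) ^ n / G"
      using P_set_reflect [OF x0 e_def z(1) fin(2), of n] by (simp add: G_def)
    have 3: "(\<Prod>d\<in>D. P (q / d * x)) = (\<Prod>d\<in>D. poch (q / d * x) n) * (\<Prod>d\<in>D. P (q / d * x * q ^ n))"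
      unfolding prod.distrib [symmetric] by (rule prod.cong [OF refl P_split])
    have 4: "(\<Prod>c\<in>C. P (c * x)) = (\<Prod>c\<in>C. poch (c * x) n) * (\<Prod>c\<in>C. P (c * (x * q ^ n)))"
      unfolding prod.distrib [symmetric] mult.assoc [of _ x "q ^ n", symmetric] by (rule prod.cong [OF refl P_split])
    have n3: "(\<Prod>d\<in>D. P (q / d * x)) \<noteq> 0" and n4: "(\<Prod>c\<in>C. P (c * x)) \<noteq> 0" and n2: "(\<Prod>d\<in>D. P (d / x)) \<noteq> 0"
      using nz x fin by auto
    define pD where "pD = \<Prod>D / e ^ card D"
    have pD: "pD \<noteq> 0" "prod_list B / e ^ card D = prod_list B / \<Prod>D * pD"
      using z(1) fin e0 by (auto simp: pD_def)
    define aa where "aa = (\<Prod>a\<leftarrow>A. P (a * (x * q ^ n)))"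
    define bb where "bb = (\<Prod>b\<leftarrow>B. poch (q / b * x) n)"
    define cc where "cc = (\<Prod>c\<in>C. poch (c * x) n)"
    define dd where "dd = (\<Prod>d\<in>D. P (q / d * x * q ^ n))"
    have "integrand A B C D (x * q ^ n) = H x * (aa * bb * cc * dd) * (prod_list B / \<Prod>D) ^ n"
      using n2 n3 [unfolded 3] n4 [unfolded 4] G0 pD(1)
      unfolding integrand_def H_def 1 2 3 4 pD(2) pD_def [symmetric] power_mult_distrib aa_def bb_def cc_def dd_def
      by (simp add: divide_simps)
    moreover have "norm (aa * bb * cc * dd) \<le>
        pbound (M * s) ^ length A * pbound (M * s) ^ length B * pbound (M * s) ^ card C * pbound (M * s) ^ card D"
      unfolding norm_mult aa_def bb_def cc_def dd_def mult.assoc [of _ x "q ^ n", symmetric]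
      by (intro mult_mono norm_P_list_le norm_poch_list_le norm_P_set_le norm_poch_set_le M) (auto simp: less_imp_le)
    then have "norm (H x) * norm (aa * bb * cc * dd) * norm (prod_list B / \<Prod>D) ^ n \<le> K * norm (prod_list B / \<Prod>D) ^ n"
      unfolding K_def using K00 K0 [OF x] by (intro mult_right_mono mult_mono) auto
    ultimately show ?thesis by (simp add: norm_mult norm_power)
  qed
  then show ?thesis using that by blast
qed

text \<open>The measure \<open>dx / x\<close> is scale invariant: the length
  \<open>2 * pi * R n\<close> cancels against \<open>1 / R n\<close>, so the decay of
  \<open>f\<close> alone decides, for shrinking and for growing radii alike.\<close>

lemma circle_integral_tendsto_0:
  assumes K: "\<And>n x. norm x = R n \<Longrightarrow> norm (f x) \<le> K * \<theta> ^ n" and \<theta>: "0 \<le> \<theta>" "\<theta> < 1" and R: "\<And>n. R n > (0::real)"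
    and cont: "\<And>n. continuous_on (sphere 0 (R n)) f"
  shows "(\<lambda>n. contour_integral (circlepath 0 (R n)) (\<lambda>x. f x / x)) \<longlonglongrightarrow> 0"
proof (rule Lim_null_comparison)
  show "(\<lambda>n. K * \<theta> ^ n * (2 * pi)) \<longlonglongrightarrow> 0"
    using \<theta> tendsto_mult_left_zero [OF tendsto_mult_right_zero [OF LIMSEQ_power_zero [of \<theta>], of K], of "2 * pi"] by simp
  show "\<forall>\<^sub>F n in sequentially. norm (contour_integral (circlepath 0 (R n)) (\<lambda>x. f x / x)) \<le> K * \<theta> ^ n * (2 * pi)"
  proof (intro always_eventually allI)
    fix n
    have "norm (f (of_real (R n))) \<le> K * \<theta> ^ n" using R [of n] by (intro K) simp
    then have K0: "K * \<theta> ^ n \<ge> 0" by (rule order_trans [OF norm_ge_zero])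
    have "(\<lambda>x. f x / x) contour_integrable_on circlepath 0 (R n)"
      using cont [of n] R [of n] by (intro contour_integrable_continuous_circlepath continuous_intros) auto
    then have "norm (contour_integral (circlepath 0 (R n)) (\<lambda>x. f x / x)) \<le> (K * \<theta> ^ n / R n) * (2 * pi * R n)"
      using K [of _ n] R [of n] K0
      by (intro has_contour_integral_bound_circlepath [OF has_contour_integral_integral])
        (auto simp: norm_divide intro!: divide_right_mono)
    then show "norm (contour_integral (circlepath 0 (R n)) (\<lambda>x. f x / x)) \<le> K * \<theta> ^ n * (2 * pi)"
      using R [of n] by simp
  qed
qed

section \<open>Poles inside an annulus: finiteness, exhaustion and distinctness\<close>

lemma annulus_index_finite:
  assumes "x \<noteq> 0" "(s::real) > 0"
  shows "finite {k. s < norm (x * q ^ k)}"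
proof -
  have "(\<lambda>k. norm (x * q ^ k)) \<longlonglongrightarrow> norm (x * 0)"
    by (intro tendsto_intros qpow_tendsto_0)
  then have "\<forall>\<^sub>F k in sequentially. norm (x * q ^ k) < s"
    using assms by (intro order_tendstoD(2)) auto
  then obtain N where "\<And>k. k \<ge> N \<Longrightarrow> norm (x * q ^ k) < s" by (auto simp: eventually_sequentially)
  then have "{k. s < norm (x * q ^ k)} \<subseteq> {..<N}"
    by (auto simp: not_less [symmetric]) (meson less_asym not_le)
  then show ?thesis using finite_subset by blast
qed

lemma annulus_exhausts:
  assumes "x > 0" "s > 0"
  shows "\<forall>\<^sub>F n in sequentially. s * norm q ^ n < x \<and> x < s / norm q ^ n"
proof -
  have "(\<lambda>n. s * norm q ^ n) \<longlonglongrightarrow> s * 0" "(\<lambda>n. x * norm q ^ n) \<longlonglongrightarrow> x * 0"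
    using q_less by (intro tendsto_intros LIMSEQ_power_zero; simp)+
  then have "\<forall>\<^sub>F n in sequentially. s * norm q ^ n < x" "\<forall>\<^sub>F n in sequentially. x * norm q ^ n < s"
    using assms by (intro order_tendstoD(2); simp)+
  then show ?thesis by eventually_elim (simp add: field_simps)
qed

lemma qpow_inj: "q ^ i = q ^ j \<Longrightarrow> i = j"
proof -
  assume "q ^ i = q ^ j"
  then have "norm q ^ i = norm q ^ j" by (metis norm_power)
  then show "i = j" using q_less power_inject_exp' [of "norm q" i j] by simp
qed

lemma distinct_lattices:
  assumes "P (x / y) \<noteq> 0" "P (y / x) \<noteq> 0" "x \<noteq> 0" "y \<noteq> 0"
  shows "x * q ^ i \<noteq> y * q ^ j"
proof
  assume e: "x * q ^ i = y * q ^ j"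
  show False
  proof (cases "i \<le> j")
    case True
    then have "y / x * q ^ (j - i) = 1" using e assms by (simp add: power_diff field_simps)
    then show False using assms by (auto simp: P_eq_0_iff)
  next
    case False
    then have "x / y * q ^ (i - j) = 1" using e assms by (simp add: power_diff field_simps)
    then show False using assms by (auto simp: P_eq_0_iff)
  qed
qed

text \<open>The integrals of \<open>integrand A B C D x / x\<close> over circles with radii in a geometric progression
  tend to 0 at both ends.\<close>

theorem sum_of_residues:
  assumes sp: "simple_poles C D" and AB: "0 \<notin> set A" "0 \<notin> set B" "length A = card C" "length B = card D"
    and lt: "norm (prod_list A) < norm (\<Prod>C)" "norm (prod_list B) < norm (\<Prod>D)"
  shows "(\<Sum>d\<in>D. res_pref B D d * (\<Sum>k. res_term A B C D d k)) =
         (\<Sum>c\<in>C. res_pref A C c * (\<Sum>k. res_term B A D C c k))"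
proof -
  note sp' = simple_poles_commute [OF sp]
  have fin: "finite C" "finite D" and z: "0 \<notin> C" "0 \<notin> D" using sp by (auto simp: simple_poles_def)
  have CD: "P (c * d) \<noteq> 0" if "c \<in> C" "d \<in> D" for c d using sp that by (auto simp: simple_poles_def)
  define f where "f = integrand A B C D"
  \<comment> \<open>The values of \<open>s\<close> for which some circle of radius
    \<open>s * norm q ^ n\<close> or \<open>s / norm q ^ n\<close> passes through a pole. They are
    countably many, so an admissible \<open>s\<close> exists.\<close>
  define bad where "bad = (\<lambda>(d, k, n). norm (d * q ^ k) / norm q ^ n) ` (D \<times> UNIV \<times> (UNIV :: nat set)) \<union>
    (\<lambda>(d, k, n). norm (d * q ^ k) * norm q ^ n) ` (D \<times> UNIV \<times> (UNIV :: nat set)) \<union>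
    (\<lambda>(c, k, n). norm (1 / (c * q ^ k)) / norm q ^ n) ` (C \<times> UNIV \<times> (UNIV :: nat set)) \<union>
    (\<lambda>(c, k, n). norm (1 / (c * q ^ k)) * norm q ^ n) ` (C \<times> UNIV \<times> (UNIV :: nat set))"
  have "countable bad"
    unfolding bad_def using fin by (intro countable_Un countable_image countable_SIGMA) (auto intro: countable_finite)
  moreover have "uncountable {0<..<1::real}" by (simp add: uncountable_open_interval)
  ultimately have "\<not> {0<..<1} \<subseteq> bad" using countable_subset by blast
  then obtain s where s: "s > 0" "s \<notin> bad" by (auto simp: subset_eq)
  have badD: "s * norm q ^ n \<noteq> norm (d * q ^ k)" "s / norm q ^ n \<noteq> norm (d * q ^ k)" if "d \<in> D" for d k n
  proof -
    have "norm (d * q ^ k) / norm q ^ n \<in> bad" "norm (d * q ^ k) * norm q ^ n \<in> bad"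
      unfolding bad_def using that by (force simp: image_iff)+
    then have "s \<noteq> norm (d * q ^ k) / norm q ^ n" "s \<noteq> norm (d * q ^ k) * norm q ^ n" using s(2) by auto
    then show "s * norm q ^ n \<noteq> norm (d * q ^ k)" "s / norm q ^ n \<noteq> norm (d * q ^ k)"
      by (auto simp: field_simps)
  qed
  have badC: "s * norm q ^ n \<noteq> norm (1 / (c * q ^ k))" "s / norm q ^ n \<noteq> norm (1 / (c * q ^ k))" if "c \<in> C" for c k n
  proof -
    have "norm (1 / (c * q ^ k)) / norm q ^ n \<in> bad" "norm (1 / (c * q ^ k)) * norm q ^ n \<in> bad"
      unfolding bad_def using that by (force simp: image_iff)+
    then have "s \<noteq> norm (1 / (c * q ^ k)) / norm q ^ n" "s \<noteq> norm (1 / (c * q ^ k)) * norm q ^ n" using s(2) by auto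
    then show "s * norm q ^ n \<noteq> norm (1 / (c * q ^ k))" "s / norm q ^ n \<noteq> norm (1 / (c * q ^ k))"
      by (auto simp: field_simps)
  qed
  have zeroD: "\<exists>k. x = d * q ^ k" if "P (d / x) = 0" "x \<noteq> 0" for d x
    using that by (auto simp: P_eq_0_iff field_simps)
  have zeroC: "\<exists>k. x = 1 / (c * q ^ k)" if "P (c * x) = 0" for c x
    using that unfolding P_eq_0_iff by (metis divide_eq_eq_1 eq_divide_eq_1 mult.commute mult.left_commute mult_eq_0_iff nonzero_eq_divide_eq zero_neq_one)
  have circleC: "P (c * x) \<noteq> 0" "P (q / (c * x)) \<noteq> 0" if x: "norm x = s" and c: "c \<in> C" for x c
  proof -
    show "P (c * x) \<noteq> 0" using zeroC [of c x] badC(1) [OF c, of 0] x by force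
    show "P (q / (c * x)) \<noteq> 0"
    proof
      assume "P (q / (c * x)) = 0"
      then obtain k where "q / (c * x) * q ^ k = 1" by (auto simp: P_eq_0_iff)
      then have "x / q ^ Suc k = 1 / (c * q ^ 0)" by (auto simp: field_simps split: if_splits)
      then have "norm x / norm q ^ Suc k = norm (1 / (c * q ^ 0))" by (metis norm_divide norm_power)
      then show False using badC(2) [OF c, of "Suc k" 0] x by simp
    qed
  qed
  have circleD: "P (d / x) \<noteq> 0" "P (q * x / d) \<noteq> 0" if x: "norm x = s" and d: "d \<in> D" for x d
  proof -
    have x0: "x \<noteq> 0" using x s by auto
    show "P (d / x) \<noteq> 0" using zeroD [of d x] badD(1) [OF d, of 0] x x0 by force
    show "P (q * x / d) \<noteq> 0"
    proof
      assume "P (q * x / d) = 0"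
      then obtain k where "q * x / d * q ^ k = 1" by (auto simp: P_eq_0_iff)
      then have "d * q ^ 0 = x * q ^ Suc k" by (auto simp: field_simps split: if_splits)
      then show False using badD(1) [OF d, of "Suc k" 0] x by (simp add: norm_mult norm_power)
    qed
  qed
  define \<Phi> where "\<Phi> x = (\<Prod>c\<in>C. P (c * x)) * (\<Prod>d\<in>D. P (d / x))" for x
  have \<Phi>_holo: "\<Phi> holomorphic_on S" if "0 \<notin> S" for S
    unfolding \<Phi>_def using that by (intro holomorphic_intros P_set_holomorphic)
  define V where "V = {x\<in>-{0}. \<Phi> x \<in> -{0}}"
  have V: "open V"
    unfolding V_def using continuous_open_preimage [OF holomorphic_on_imp_continuous_on [OF \<Phi>_holo], of "- {0}" "- {0}"]
    by (simp add: vimage_def Int_def open_Compl)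
  have f_holo: "f holomorphic_on V"
    unfolding f_def integrand_def \<Phi>_def [symmetric]
    by (intro holomorphic_intros P_list_holomorphic \<Phi>_holo) (auto simp: V_def)
  have poles: "(\<exists>c\<in>C. \<exists>k. x = 1 / (c * q ^ k)) \<or> (\<exists>d\<in>D. \<exists>k. x = d * q ^ k)" if "x \<noteq> 0" "x \<notin> V" for x
  proof -
    have "(\<exists>c\<in>C. P (c * x) = 0) \<or> (\<exists>d\<in>D. P (d / x) = 0)"
      using that fin by (auto simp: V_def \<Phi>_def)
    then show ?thesis using zeroC zeroD that(1) by blast
  qed
  define r where "r n = s * norm q ^ n" for n
  define R where "R n = s / norm q ^ n" for n
  have rR0: "r n > 0" "R n > 0" for n using s by (simp_all add: r_def R_def)
  have avoid: "x \<in> V" if "norm x = r n \<or> norm x = R n" for x n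
  proof (rule ccontr)
    assume "x \<notin> V"
    moreover have "x \<noteq> 0" using that rR0 [of n] by auto
    ultimately show False
      using poles [of x] that badC badD unfolding r_def R_def by metis
  qed
  obtain K1 where K1: "\<And>n x. norm x = s \<Longrightarrow> norm (f (x * q ^ n)) \<le> K1 * norm (prod_list B / \<Prod>D) ^ n"
    using integrand_decay [OF fin z(2) AB(2) z(1) AB(4) lt(2) s(1), where A = A] circleC circleD unfolding f_def by metis
  have s': "1 / s > 0" using s by simp
  have inv_norm: "norm (1 / x) = s" if "norm x = 1 / s" for x :: complex
    using that by (simp add: norm_divide)
  \<comment> \<open>Large circles are reduced to small ones by inversion: the base radius becomes
    \<open>1 / s\<close> and the two families exchange their roles.\<close>
  obtain K2 where K2: "\<And>n x. norm x = 1 / s \<Longrightarrow> norm (integrand B A D C (x * q ^ n)) \<le> K2 * norm (prod_list A / \<Prod>C) ^ n"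
  proof (rule integrand_decay [OF fin(2,1) z(1) AB(1) z(2) AB(3) lt(1) s', where A = B])
    show "P (d * x) \<noteq> 0" if "norm x = 1 / s" "d \<in> D" for x d
      using circleD(1) [OF inv_norm [OF that(1)] that(2)] by simp
    show "P (c / x) \<noteq> 0" "P (q * x / c) \<noteq> 0" if "norm x = 1 / s" "c \<in> C" for x c
      using circleC [OF inv_norm [OF that(1)] that(2)] by simp_all
  qed blast
  have cont: "continuous_on (sphere 0 (r n)) f" "continuous_on (sphere 0 (R n)) f" for n
  proof -
    have "sphere 0 (r n) \<subseteq> V" by (rule subsetI, rule avoid [of _ n]) simp
    moreover have "sphere 0 (R n) \<subseteq> V" by (rule subsetI, rule avoid [of _ n]) simp
    ultimately show "continuous_on (sphere 0 (r n)) f" "continuous_on (sphere 0 (R n)) f"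
      using continuous_on_subset [OF holomorphic_on_imp_continuous_on [OF f_holo]] by blast+
  qed
  define I where "I \<epsilon> = contour_integral (circlepath 0 \<epsilon>) (\<lambda>x. f x / x)" for \<epsilon>
  have inner: "(\<lambda>n. I (r n)) \<longlonglongrightarrow> 0"
    unfolding I_def
  proof (rule circle_integral_tendsto_0)
    show "norm (f x) \<le> K1 * norm (prod_list B / \<Prod>D) ^ n" if "norm x = r n" for n x
      using K1 [of "x / q ^ n" n] that by (simp add: norm_divide norm_power r_def)
    show "norm (prod_list B / \<Prod>D) < 1" using lt(2) by (auto simp: norm_divide divide_simps)
  qed (use rR0 cont in auto)
  have outer: "(\<lambda>n. I (R n)) \<longlonglongrightarrow> 0"
    unfolding I_def
  proof (rule circle_integral_tendsto_0)
    show "norm (f x) \<le> K2 * norm (prod_list A / \<Prod>C) ^ n" if x: "norm x = R n" for n x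
    proof -
      have "x \<noteq> 0" using x rR0 [of n] by auto
      then have "f x = integrand B A D C (1 / (x * q ^ n) * q ^ n)"
        using integrand_inverse [of B A D C x] by (simp add: f_def)
      moreover have "norm (1 / (x * q ^ n)) = 1 / s"
        using x s by (simp add: norm_divide norm_mult norm_power R_def)
      ultimately show ?thesis using K2 by metis
    qed
    show "norm (prod_list A / \<Prod>C) < 1" using lt(1) by (auto simp: norm_divide divide_simps)
  qed (use rR0 cont in auto)
  define KD where "KD n d = {k. r n < norm (d * q ^ k) \<and> norm (d * q ^ k) < R n}" for n d
  define KC where "KC n c = {k. r n < norm (1 / (c * q ^ k)) \<and> norm (1 / (c * q ^ k)) < R n}" for n c
  have KD: "finite (KD n d)" if "d \<in> D" for n d
  proof (rule finite_subset)
    show "finite {k. r n < norm (d * q ^ k)}" using that z rR0 by (intro annulus_index_finite) auto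
  qed (auto simp: KD_def)
  have KC: "finite (KC n c)" if "c \<in> C" for n c
  proof -
    have c0: "c \<noteq> 0" using that z by auto
    have "finite {k. 1 / R n < norm (c * q ^ k)}"
      using rR0 c0 by (intro annulus_index_finite) auto
    moreover have "KC n c \<subseteq> {k. 1 / R n < norm (c * q ^ k)}"
      using c0 rR0 [of n] unfolding KC_def by (auto simp: norm_divide field_simps)
    ultimately show ?thesis using finite_subset by blast
  qed
  define T where "T n = (\<Sum>d\<in>D. \<Sum>k\<in>KD n d. pole_res A B C D d k) -
    (\<Sum>c\<in>C. \<Sum>k\<in>KC n c. pole_res B A D C c k)" for n
  \<comment> \<open>Poles are indexed by a disjoint sum: the left summand holds those accumulating
    at 0, the right one those accumulating at infinity, whose residues carry the opposite
    sign.\<close>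
  define p :: "complex \<times> nat + complex \<times> nat \<Rightarrow> complex"
    where "p = case_sum (\<lambda>(d, k). d * q ^ k) (\<lambda>(c, k). 1 / (c * q ^ k))"
  define \<rho> where "\<rho> = case_sum (\<lambda>(d, k). pole_res A B C D d k) (\<lambda>(c, k). - pole_res B A D C c k)"
  define J where "J n = (SIGMA d:D. KD n d) <+> (SIGMA c:C. KC n c)" for n
  have diffD: "d = d' \<and> i = j" if "d * q ^ i = d' * q ^ j" "d \<in> D" "d' \<in> D" for d d' i j
  proof -
    have nz: "d \<noteq> 0" "d' \<noteq> 0" using that z by auto
    have "d = d'"
    proof (rule ccontr)
      assume "d \<noteq> d'"
      then have "P (d / d') \<noteq> 0" "P (d' / d) \<noteq> 0" using sp that(2,3) unfolding simple_poles_def by metis+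
      then show False using distinct_lattices that(1) nz by blast
    qed
    then show ?thesis using that(1) nz qpow_inj by auto
  qed
  have diffC: "c = c' \<and> i = j" if "c * q ^ i = c' * q ^ j" "c \<in> C" "c' \<in> C" for c c' i j
  proof -
    have nz: "c \<noteq> 0" "c' \<noteq> 0" using that z by auto
    have "c = c'"
    proof (rule ccontr)
      assume "c \<noteq> c'"
      then have "P (c / c') \<noteq> 0" "P (c' / c) \<noteq> 0" using sp that(2,3) unfolding simple_poles_def by metis+
      then show False using distinct_lattices that(1) nz by blast
    qed
    then show ?thesis using that(1) nz qpow_inj by auto
  qed
  have diffCD: "d * q ^ i \<noteq> 1 / (c * q ^ j)" if "c \<in> C" "d \<in> D" for c d i j
  proof
    assume e: "d * q ^ i = 1 / (c * q ^ j)"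
    have "c * q ^ j \<noteq> 0" using that z by auto
    then have "(d * q ^ i) * (c * q ^ j) = 1" unfolding e by simp
    then have "c * d * q ^ (i + j) = 1" by (simp add: power_add mult_ac)
    then show False using CD [OF that] P_eq_0_iff by blast
  qed
  have inj: "inj_on p (J n)" for n
  proof (rule inj_onI)
    fix x y assume "x \<in> J n" "y \<in> J n" "p x = p y"
    note xy = this
    show "x = y"
    proof (cases x)
      case (Inl u)
      obtain d i where u: "u = (d, i)" "d \<in> D" using Inl xy(1) by (auto simp: J_def)
      show ?thesis
      proof (cases y)
        case (Inl v)
        obtain d' j where "v = (d', j)" "d' \<in> D" using Inl xy(2) by (auto simp: J_def)
        then show ?thesis using diffD [of d i d' j] u Inl \<open>x = Inl u\<close> xy(3) by (simp add: p_def)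
      next
        case (Inr v)
        obtain c j where "v = (c, j)" "c \<in> C" using Inr xy(2) by (auto simp: J_def)
        then have False using diffCD [of c d i j] u Inr Inl xy(3) by (simp add: p_def)
        then show ?thesis ..
      qed
    next
      case (Inr u)
      obtain c i where u: "u = (c, i)" "c \<in> C" using Inr xy(1) by (auto simp: J_def)
      show ?thesis
      proof (cases y)
        case (Inl v)
        obtain d j where "v = (d, j)" "d \<in> D" using Inl xy(2) by (auto simp: J_def)
        then have False using diffCD [of c d j i] u Inr Inl xy(3) by (simp add: p_def)
        then show ?thesis ..
      next
        case (Inr v)
        obtain c' j where v: "v = (c', j)" "c' \<in> C" using Inr xy(2) by (auto simp: J_def)
        have "1 / (c * q ^ i) = 1 / (c' * q ^ j)" using u v Inr \<open>x = Inr u\<close> xy(3) by (simp add: p_def)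
        then have "c * q ^ i = c' * q ^ j" by (metis div_by_1 divide_divide_eq_right mult_1)
        then show ?thesis using diffC [of c i c' j] u v Inr \<open>x = Inr u\<close> by simp
      qed
    qed
  qed
  have integral: "I (R n) - I (r n) =
      2 * of_real pi * \<i> * T n"
    if n: "n > 0" for n
  proof -
    \<comment> \<open>For \<open>n = 0\<close> both circles have radius \<open>s\<close>, and there
      is no annulus.\<close>
    have "norm q ^ n < 1" using q_less n by (simp add: power_less_one_iff)
    then have "r n < s * 1" "s / 1 < R n"
      using s unfolding r_def R_def by (intro mult_strict_left_mono divide_strict_left_mono; simp)+
    then have "r n < R n" by simp
    have "I (R n) - I (r n) =
      2 * of_real pi * \<i> * (\<Sum>j\<in>J n. \<rho> j)"
      unfolding I_def
    proof (rule annulus_residues [OF rR0(1) \<open>r n < R n\<close> _ inj _ V])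
      show "finite (J n)" unfolding J_def using KD KC fin by (intro finite_Plus finite_SigmaI)
      show "r n < norm (p j) \<and> norm (p j) < R n" if "j \<in> J n" for j
        using that by (auto simp: J_def p_def KD_def KC_def)
      show "(\<lambda>x. f x / x) holomorphic_on V"
        by (intro holomorphic_intros f_holo) (auto simp: V_def)
      show "x \<in> V \<or> x \<in> p ` J n" if x: "r n \<le> norm x" "norm x \<le> R n" for x
      proof (cases "x \<in> V")
        case False
        have "x \<noteq> 0" using x rR0 [of n] by auto
        have strict: "r n < norm x" "norm x < R n" using avoid [of x n] False x by force+
        from poles [OF \<open>x \<noteq> 0\<close> False] show ?thesis
        proof (elim disjE bexE exE)
          fix c k assume c: "c \<in> C" "x = 1 / (c * q ^ k)"
          then have "Inr (c, k) \<in> J n" "p (Inr (c, k)) = x"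
            using strict by (auto simp: J_def KC_def p_def)
          then show ?thesis by blast
        next
          fix d k assume d: "d \<in> D" "x = d * q ^ k"
          then have "Inl (d, k) \<in> J n" "p (Inl (d, k)) = x"
            using strict by (auto simp: J_def KD_def p_def)
          then show ?thesis by blast
        qed
      qed auto
      show "\<exists>g N. open N \<and> p j \<in> N \<and> g holomorphic_on N \<and> g (p j) = \<rho> j \<and> (\<forall>x\<in>N - {p j}. f x / x = g x / (x - p j))"
        if "j \<in> J n" for j
      proof -
        from that consider d k where "d \<in> D" "j = Inl (d, k)" | c k where "c \<in> C" "j = Inr (c, k)"
          by (auto simp: J_def)
        then show ?thesis
        proof cases
          case 1
          then show ?thesis using simple_pole [OF sp 1(1), of k A B] unfolding p_def \<rho>_def f_def by auto
        next
          case 2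
          then show ?thesis using simple_pole_inverse [OF sp 2(1), where A = A and B = B and k = k] unfolding p_def \<rho>_def f_def by simp
        qed
      qed
    qed
    also have "(\<Sum>j\<in>J n. \<rho> j) = T n"
    proof -
      have "(\<Sum>j\<in>J n. \<rho> j) = sum (\<rho> \<circ> Inl) (SIGMA d:D. KD n d) + sum (\<rho> \<circ> Inr) (SIGMA c:C. KC n c)"
        unfolding J_def using KD KC fin by (intro sum.Plus finite_SigmaI)
      also have "sum (\<rho> \<circ> Inl) (SIGMA d:D. KD n d) = (\<Sum>d\<in>D. \<Sum>k\<in>KD n d. pole_res A B C D d k)"
        using KD fin by (subst sum.Sigma) (auto simp: \<rho>_def intro!: sum.cong)
      also have "sum (\<rho> \<circ> Inr) (SIGMA c:C. KC n c) = - (\<Sum>c\<in>C. \<Sum>k\<in>KC n c. pole_res B A D C c k)"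
        unfolding sum_negf [symmetric] using KC fin by (subst sum.Sigma) (auto simp: \<rho>_def intro!: sum.cong)
      finally show ?thesis by (simp add: T_def)
    qed
    finally show ?thesis .
  qed
  have resD: "summable (\<lambda>k. norm (res_term A B C D d k))" if "d \<in> D" for d
    using sp that CD by (intro res_term_summable fin z lt(2)) (auto simp: simple_poles_def)
  have resC: "summable (\<lambda>k. norm (res_term B A D C c k))" if "c \<in> C" for c
    using sp' that CD by (intro res_term_summable fin z lt(1)) (auto simp: simple_poles_def)
  have limD: "(\<lambda>n. \<Sum>k\<in>KD n d. pole_res A B C D d k) \<longlonglongrightarrow> res_pref B D d * (\<Sum>k. res_term A B C D d k)" if d: "d \<in> D" for d
  proof -
    have d0: "d \<noteq> 0" using d z by auto
    have "(\<lambda>n. \<Sum>k\<in>KD n d. res_term A B C D d k) \<longlonglongrightarrow> (\<Sum>k. res_term A B C D d k)"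
    proof (rule tendsto_sum_exhausting [OF resD [OF d] KD [OF d]])
      show "\<forall>\<^sub>F n in sequentially. k \<in> KD n d" for k
        using annulus_exhausts [of "norm (d * q ^ k)" s] s d0 by (simp add: KD_def r_def R_def)
    qed
    then show ?thesis
      unfolding pole_res_eq [OF fin(2) d z(2) AB(2,4)] sum_distrib_left [symmetric] by (intro tendsto_intros)
  qed
  have limC: "(\<lambda>n. \<Sum>k\<in>KC n c. pole_res B A D C c k) \<longlonglongrightarrow> res_pref A C c * (\<Sum>k. res_term B A D C c k)" if c: "c \<in> C" for c
  proof -
    have c0: "c \<noteq> 0" using c z by auto
    have "(\<lambda>n. \<Sum>k\<in>KC n c. res_term B A D C c k) \<longlonglongrightarrow> (\<Sum>k. res_term B A D C c k)"
    proof (rule tendsto_sum_exhausting [OF resC [OF c] KC [OF c]])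
      show "\<forall>\<^sub>F n in sequentially. k \<in> KC n c" for k
        using annulus_exhausts [of "norm (1 / (c * q ^ k))" s] s c0 by (simp add: KC_def r_def R_def)
    qed
    then show ?thesis
      unfolding pole_res_eq [OF fin(1) c z(1) AB(1,3)] sum_distrib_left [symmetric] by (intro tendsto_intros)
  qed
  have "(\<lambda>n. 2 * of_real pi * \<i> * T n) \<longlonglongrightarrow>
     2 * of_real pi * \<i> * ((\<Sum>d\<in>D. res_pref B D d * (\<Sum>k. res_term A B C D d k)) - (\<Sum>c\<in>C. res_pref A C c * (\<Sum>k. res_term B A D C c k)))"
    unfolding T_def by (intro tendsto_intros limD limC)
  moreover have "(\<lambda>n. 2 * of_real pi * \<i> * T n) \<longlonglongrightarrow> 0"
  proof (rule Lim_transform_eventually)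
    show "(\<lambda>n. I (R n) - I (r n)) \<longlonglongrightarrow> 0"
      using tendsto_diff [OF outer inner] by simp
    show "\<forall>\<^sub>F n in sequentially. I (R n) - I (r n) = 2 * of_real pi * \<i> * T n"
      using eventually_gt_at_top [of 0] by eventually_elim (rule integral)
  qed
  ultimately have "2 * of_real pi * \<i> * ((\<Sum>d\<in>D. res_pref B D d * (\<Sum>k. res_term A B C D d k)) - (\<Sum>c\<in>C. res_pref A C c * (\<Sum>k. res_term B A D C c k))) = 0"
    by (rule LIMSEQ_unique)
  then show ?thesis by simp
qed

end

section \<open>The five residue series\<close>

lemma prod4: "distinct [x1, x2, x3, x4] \<Longrightarrow> prod f {x1, x2, x3, x4} = f x1 * (f x2 * (f x3 * f x4))"
  by simp

lemma prod5: "distinct [x1, x2, x3, x4, x5] \<Longrightarrow> prod f {x1, x2, x3, x4, x5} = f x1 * (f x2 * (f x3 * (f x4 * f x5)))"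
  by simp

context nome
begin

lemma P_inverse_nonzero:
  assumes "x \<noteq> 0" "P x \<noteq> 0" "P (q / x) \<noteq> 0"
  shows "P (1 / x) \<noteq> 0"
proof -
  have "x \<noteq> 1" using assms(2) P_step [of 1] by auto
  then show ?thesis using assms P_step [of "1 / x"] by auto
qed

text \<open>By \<open>P_split\<close> the finite factorials coming from \<open>q / h\<close> and
  \<open>h / w\<close> in \<open>B\<close> complete the shifted products coming from
  \<open>A\<close>. Thus \<open>h\<close> disappears from the terms, and the four products with
  \<open>h\<close> assemble to the two thetas. In the same way the products over
  \<open>{1, w}\<close> yield the upper parameters \<open>d\<close> and
  \<open>w * d\<close>.\<close>

lemma res_side_eq:
  fixes a b c w h d :: complex and D :: "complex set"
  defines "A \<equiv> [h, q * w / h]" and "B \<equiv> [q / h, h / w, q * a / b, q * a / c, q ^ 2 * a * w]"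
  assumes nz: "h \<noteq> 0" "w \<noteq> 0" "a \<noteq> 0" "b \<noteq> 0" "c \<noteq> 0" "w \<noteq> 1" and d: "d \<noteq> 0" "P d \<noteq> 0" "P (w * d) \<noteq> 0"
    and ratio: "prod_list B / \<Prod>D = q"
    and sm: "summable (\<lambda>k. res_term A B {1, w} D d k)"
  shows "P q * (res_pref B D d * (\<Sum>k. res_term A B {1, w} D d k)) =
    theta (h * d) q * theta (h / (w * d)) q * (P (q * a / (b * d)) * P (q * a / (c * d)) * P (q ^ 2 * a * w / d)) /
      (P d * P (w * d) * (\<Prod>d'\<in>D - {d}. P (d' / d))) *
    (\<Sum>k. (poch d k * poch (w * d) k * poch (d * b / a) k * poch (d * c / a) k * poch (d / (q * a * w)) k) /
        (\<Prod>d'\<in>D. poch (q * d / d') k) * q ^ k)"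
proof -
  define X where "X k = (poch d k * poch (w * d) k * poch (d * b / a) k * poch (d * c / a) k * poch (d / (q * a * w)) k) /
        (\<Prod>d'\<in>D. poch (q * d / d') k) * q ^ k" for k
  define F where "F = P (h * d) * P (q * w * d / h) / (P d * P (w * d))"
  have tm: "res_term A B {1, w} D d k = F * X k" for k
  proof -
    have "P (h * d) = P (h * d * q ^ k) * poch (h * d) k" using P_split [of "h * d" k] by simp
    moreover have "P (q * w * d / h) = P (q * w / h * d * q ^ k) * poch (q * d / (h / w)) k"
      using P_split [of "q * w * d / h" k] nz by (simp add: field_simps)
    moreover have "P d = poch d k * P (d * q ^ k)" by (rule P_split)
    moreover have "P (w * d) = poch (w * d) k * P (w * d * q ^ k)" by (rule P_split)
    moreover have "q * d / (q / h) = h * d" "q * d / (q * a / b) = d * b / a" "q * d / (q * a / c) = d * c / a"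
      "q * d / (q ^ 2 * a * w) = d / (q * a * w)"
      using nz by (simp_all add: field_simps power2_eq_square)
    moreover have "poch d k \<noteq> 0" "poch (w * d) k \<noteq> 0" using d poch_nonzero by blast+
    ultimately show ?thesis
      unfolding res_term_def ratio F_def X_def unfolding A_def B_def using \<open>w \<noteq> 1\<close> d by (simp add: mult_ac)
  qed
  have "(\<Sum>k. res_term A B {1, w} D d k) = F * (\<Sum>k. X k)"
  \<comment> \<open>Summability of \<open>X\<close> is inherited from \<open>sm\<close> only if the
    constant \<open>F\<close> is non-zero; otherwise both sides are 0.\<close>
  proof (cases "F = 0")
    case False
    have "summable X" using sm False unfolding tm summable_cmult_iff by simp
    then show ?thesis unfolding tm by (rule suminf_mult)
  qed (simp add: tm)
  then show ?thesis
    unfolding res_pref_def X_def [symmetric] theta_eq F_def B_def by (simp add: mult_ac)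
qed

text \<open>The same completion of products removes \<open>h\<close> from the terms. Both
  progressions end up with the identical prefactor, because the factors \<open>P w\<close> and
  \<open>P (1 / w)\<close> of the residues are those in the two weights.\<close>

lemma outer_side_eq:
  fixes a b c w h :: complex and D :: "complex set"
  defines "A \<equiv> [h, q * w / h]" and "B \<equiv> [q / h, h / w, q * a / b, q * a / c, q ^ 2 * a * w]"
    and "\<Phi> \<equiv> \<lambda>y. P (q * a * (1 / b) * y) * P (q * a * (1 / c) * y) * P (q ^ 2 * a * w * y) /
        (P (q * a * (1 / b) * (1 / c) * y) * P (q * a * y ^ 2))"
  assumes nz: "h \<noteq> 0" "a \<noteq> 0" "b \<noteq> 0" "c \<noteq> 0" and w: "generic w" and \<Phi>_bdd: "lat_bdd w \<Phi>"
    and D: "\<And>y. (\<Prod>d\<in>D. P (d * y)) = P (q * a * y ^ 2) * P (q * a / (b * c) * y)"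
  shows "P q * (\<Sum>c'\<in>{1, w}. res_pref A {1, w} c' * (\<Sum>k. res_term B A D {1, w} c' k)) =
    theta h q * theta (h / w) q * lat_sum w \<Phi>"
proof -
  have w0: "w \<noteq> 0" and w1: "w \<noteq> 1" and Pw: "P w \<noteq> 0" and Pw': "P (1 / w) \<noteq> 0"
    using w generic_inverse [OF w] P_step [of 1] by (auto simp: generic_def)
  have dif: "{1, w} - {1} = {w}" "{1, w} - {w} = {1}" using w1 by auto
  have ratio: "prod_list A / \<Prod>{1, w} = q" using w0 w1 nz by (simp add: A_def)
  have D': "(\<Prod>d\<in>D. P (d * y * q ^ k)) = P (q * a * (y * q ^ k) ^ 2) * P (q * a / (b * c) * (y * q ^ k))" for y k
    using D [of "y * q ^ k"] by (simp add: mult.assoc)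
  have \<Phi>: "\<Phi> y = P (q * a / b * y) * P (q * a / c * y) * P (q ^ 2 * a * w * y) / (P (q * a * y ^ 2) * P (q * a / (b * c) * y))" for y
    by (simp add: \<Phi>_def mult_ac)
  have t1: "res_term B A D {1, w} 1 k = P (q / h) * P (h / w) * P w * (weight w k * \<Phi> (q ^ k))" for k
  proof -
    have "P (q / h) = P (q / h * q ^ k) * poch (q / h) k" using P_split [of "q / h" k] by simp
    moreover have "P (h / w) = P (h / w * q ^ k) * poch (q / (q * w / h)) k" using P_split [of "h / w" k] nz w0 by simp
    ultimately show ?thesis
      unfolding res_term_def ratio D' \<Phi> weight_def using w1 Pw
      by (simp add: A_def B_def mult_ac)
  qed
  have t2: "res_term B A D {1, w} w k = P (q * w / h) * P h * P (1 / w) * (weight (1 / w) k * \<Phi> (w * q ^ k))" for k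
  proof -
    have "P (q * w / h) = P (q / h * w * q ^ k) * poch (q * w / h) k" using P_split [of "q * w / h" k] by simp
    moreover have "P h = P (h / w * w * q ^ k) * poch (q * w / (q * w / h)) k" using P_split [of h k] nz w0 by simp
    moreover have "(\<Prod>c'\<in>{1, w}. poch (q * w / c') k) = poch (q * w) k * poch q k" using w0 w1 by simp
    ultimately show ?thesis
      unfolding res_term_def ratio D' \<Phi> weight_def using Pw'
      by (simp add: A_def B_def mult_ac)
  qed
  have "(\<Sum>k. res_term B A D {1, w} 1 k) = P (q / h) * P (h / w) * P w * (\<Sum>k. weight w k * \<Phi> (q ^ k))"
    unfolding t1 by (rule suminf_mult [OF lat_sum_summable(1) [OF w \<Phi>_bdd]])
  moreover have "(\<Sum>k. res_term B A D {1, w} w k) = P (q * w / h) * P h * P (1 / w) * (\<Sum>k. weight (1 / w) k * \<Phi> (w * q ^ k))"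
    unfolding t2 by (rule suminf_mult [OF lat_sum_summable(2) [OF w \<Phi>_bdd]])
  moreover have "res_pref A {1, w} 1 = P h * P (q * w / h) / (P q * P w)"
    by (simp add: res_pref_def dif A_def)
  moreover have "res_pref A {1, w} w = P (h / w) * P (q / h) / (P q * P (1 / w))"
    using w0 by (simp add: res_pref_def dif A_def)
  ultimately show ?thesis
    using w1 Pw Pw' unfolding lat_sum_def theta_eq by (simp add: distrib_left mult_ac)
qed

text \<open>The contribution of the pole progression from \<open>sq * sa\<close>, that is
  \<open>S1\<close>; replacing \<open>sa\<close> by \<open>- sa\<close> gives \<open>S2\<close>.
  \<open>whole_summand\<close> plays this role for \<open>q * sa\<close>, with \<open>S3\<close> and
  \<open>S4\<close>.\<close>

definition half_summand :: "complex \<Rightarrow> complex \<Rightarrow> complex \<Rightarrow> complex \<Rightarrow> complex \<Rightarrow> complex \<Rightarrow> complex" where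
  "half_summand sq sa b c h z =
      thetas [h * (sq * sa), h * (sq * sa / (b * c * z))] q
        * qpochs_inf [sq * sa / b, sq * sa / c, b * c * z * (sq / sa)] q
      / qpochs_inf [-1, sq, - sq, sq * sa, sq * sa / (b * c), b * c * z / (sq * sa)] q
      * phi [sq * sa, q * b / (sq * sa), q * c / (sq * sa),
             b * c * z / (sq * sa), sq * sa / (b * c * z)]
            [- q, sq, - sq, sq * b * c / sa] q q"

definition whole_summand :: "complex \<Rightarrow> complex \<Rightarrow> complex \<Rightarrow> complex \<Rightarrow> complex \<Rightarrow> complex \<Rightarrow> complex" where
  "whole_summand sq sa b c h z =
      thetas [h * q * sa, h * (sa / (b * c * z))] q
        * qpochs_inf [sa / b, sa / c, b * c * z / sa] q
      / qpochs_inf [-1, 1 / sq, - (1 / sq), q * sa, sa / (b * c), b * c * z / sa] q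
      * phi [q * sa, q * b / sa, q * c / sa, b * c * z / sa, q * sa / (b * c * z)]
            [- q, sq ^ 3, - (sq ^ 3), q * b * c / sa] q q"

definition last_summand :: "complex \<Rightarrow> complex \<Rightarrow> complex \<Rightarrow> complex \<Rightarrow> complex \<Rightarrow> complex \<Rightarrow> complex \<Rightarrow> complex" where
  "last_summand sq sa a b c h z =
      thetas [h / z, h * (q * a / (b * c))] q
        * qpochs_inf [b, c, b^2 * c^2 * z / a] q
      / qpochs_inf [z, q * a / (b * c), b^2 * c^2 / (q * a)] q
      * phi [q / b, q / c, q * a / (b * c), z, q * a / (b^2 * c^2 * z)]
            [q * sa / (b * c), - (q * sa / (b * c)),
             sq ^ 3 * sa / (b * c), - (sq ^ 3 * sa / (b * c))] q q"

text \<open>The parameters \<open>q * sa\<close> and \<open>- (q * sa)\<close> over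
  \<open>sa\<close> and \<open>- sa\<close> collapse to
  \<open>(1 - a * q ^ (2 * k)) / (1 - a)\<close>. The powers of \<open>1 / b\<close> and
  \<open>1 / c\<close> in \<open>z ^ k\<close> turn \<open>poch b k\<close> and
  \<open>poch c k\<close> into the products of \<open>wp_core\<close>, which leaves
  \<open>w ^ k\<close>.\<close>

lemma W54_eq_suminf:
  assumes "a = sa ^ 2" "b \<noteq> 0" "c \<noteq> 0" "a \<noteq> 0" "P sa \<noteq> 0" "P (- sa) \<noteq> 0" and z: "z = q * a * (1 / b) * (1 / c) * w"
  shows "W54 a sa b c q z = (\<Sum>k. wp_coeff a (1 / b) (1 / c) k * w ^ k)"
  unfolding W54_def phi_def
proof (rule suminf_cong)
  fix k
  have sa: "1 - sa \<noteq> 0" "1 + sa \<noteq> 0" using assms(5,6) P_step [of sa] P_step [of "- sa"] by auto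
  have "a \<noteq> 1" using sa by (auto simp: assms(1) power2_eq_1_iff)
  have pr: "(\<Prod>i<k. 1 / x - q ^ i) = poch x k / x ^ k" if "x \<noteq> 0" for x
  proof -
    have "(\<Prod>i<k. 1 / x - q ^ i) = (\<Prod>i<k. (1 - x * q ^ i) * (1 / x))"
      using that by (intro prod.cong) (auto simp: field_simps)
    also have "\<dots> = poch x k * (1 / x) ^ k" unfolding prod.distrib by (simp add: qpoch_def)
    finally show ?thesis by (simp only: power_one_over) simp
  qed
  have s1: "poch (q * sa) k = poch sa k * (1 - sa * q ^ k) / (1 - sa)"
    using poch_Suc [of sa k] poch_Suc_shift [of sa k] sa by (simp add: field_simps)
  have s2: "poch (- (q * sa)) k = poch (- sa) k * (1 + sa * q ^ k) / (1 + sa)"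
    using poch_Suc [of "- sa" k] poch_Suc_shift [of "- sa" k] sa by (simp add: field_simps)
  have e: "(1 - sa * q ^ k) * (1 + sa * q ^ k) = 1 - a * q ^ (2 * k)" "(1 - sa) * (1 + sa) = 1 - a"
    unfolding assms(1) mult_2 power_add by (simp_all add: algebra_simps power2_eq_square)
  have n: "poch sa k \<noteq> 0" "poch (- sa) k \<noteq> 0" using assms(5,6) poch_nonzero by blast+
  have "poch (q * sa) k * poch (- (q * sa)) k / (poch sa k * poch (- sa) k) = (1 - a * q ^ (2 * k)) / (1 - a)"
    unfolding s1 s2 e [symmetric] using n by simp
  then have "poch a k * (poch (q * sa) k * poch (- (q * sa)) k / (poch sa k * poch (- sa) k)) * poch b k * poch c k /
      (poch q k * poch (q * a / b) k * poch (q * a / c) k) * z ^ k =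
      poch a k * ((1 - a * q ^ (2 * k)) / (1 - a)) * poch b k * poch c k / (poch q k * poch (q * a / b) k * poch (q * a / c) k) * z ^ k"
    by simp
  moreover have "z ^ k = (q * a) ^ k * w ^ k / (b ^ k * c ^ k)"
    unfolding z by (simp add: power_mult_distrib power_divide)
  ultimately show "qpochs [a, q * sa, - (q * sa), b, c] q k / qpochs (q # [sa, - sa, q * a / b, q * a / c]) q k * z ^ k =
       wp_coeff a (1 / b) (1 / c) k * w ^ k"
    unfolding wp_coeff_def wp_core_def pr [OF assms(2)] pr [OF assms(3)] qpochs_def
    by (simp add: mult_ac)
qed

text \<open>Here \<open>sa\<close> is any square root of \<open>a\<close>. Since \<open>- sa\<close>
  leads to the same set \<open>D\<close>, the lemmas for the poles at \<open>sq * sa\<close> and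
  \<open>q * sa\<close> also yield those at the negatives.\<close>

context
  fixes sq sa a b c h z w :: complex and D A B
  assumes sq: "q = sq * sq" and sa: "a = sa * sa" and nz: "sq \<noteq> 0" "sa \<noteq> 0" "b \<noteq> 0" "c \<noteq> 0" "h \<noteq> 0" "z \<noteq> 0"
    and w: "w = b * c * z / (q * a)" "w \<noteq> 1"
    and D_def: "D = {sq * sa, - (sq * sa), q * sa, - (q * sa), q * a / (b * c)}"
    and dist: "distinct [sq * sa, - (sq * sa), q * sa, - (q * sa), q * a / (b * c)]"
    and A_def: "A = [h, q * w / h]" and B_def: "B = [q / h, h / w, q * a / b, q * a / c, q ^ 2 * a * w]"
begin

text \<open>Fixes the argument \<open>q\<close> of all five series; the entry
  \<open>q ^ 2 * a * w\<close> of \<open>B\<close> is the one that achieves it.\<close>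

lemma pole_ratio: "prod_list B / \<Prod>D = q"
proof -
  have "\<Prod>D = (sq * sa) * (- (sq * sa)) * (q * sa) * (- (q * sa)) * (q * a / (b * c))"
    using dist unfolding D_def by (simp add: mult_ac)
  then show ?thesis
    using nz by (simp add: B_def w(1) sq sa field_simps power2_eq_square)
qed

lemma half_side:
  assumes P: "P (sq * sa) \<noteq> 0" "P (w * (sq * sa)) \<noteq> 0"
    and sm: "summable (\<lambda>k. res_term A B {1, w} D (sq * sa) k)"
  shows "P q * (res_pref B D (sq * sa) * (\<Sum>k. res_term A B {1, w} D (sq * sa) k)) = half_summand sq sa b c h z"
proof -
  have w0: "w \<noteq> 0" and a0: "a \<noteq> 0" using nz by (auto simp: w(1) sa sq)
  have D': "D - {sq * sa} = {- (sq * sa), q * sa, - (q * sa), q * a / (b * c)}"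
    using dist unfolding D_def by auto
  have e: "sq * sa * b / a = q * b / (sq * sa)" "sq * sa * c / a = q * c / (sq * sa)"
    "w * (sq * sa) = b * c * z / (sq * sa)" "sq * sa / (q * a * w) = sq * sa / (b * c * z)"
    "h / (b * c * z / (sq * sa)) = h * (sq * sa / (b * c * z))"
    "q * a / (b * (sq * sa)) = sq * sa / b" "q * a / (c * (sq * sa)) = sq * sa / c"
    "q ^ 2 * a * w / (sq * sa) = b * c * z * (sq / sa)"
    using nz by (simp_all add: w(1) sq sa field_simps power2_eq_square)
  have f: "- (sq * sa) / (sq * sa) = - 1" "q * sa / (sq * sa) = sq" "- (q * sa) / (sq * sa) = - sq"
    "q * a / (b * c) / (sq * sa) = sq * sa / (b * c)"
    using nz by (simp_all add: sq sa field_simps)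
  have g: "q * (sq * sa) / - (sq * sa) = - q" "q * (sq * sa) / (q * sa) = sq" "q * (sq * sa) / - (q * sa) = - sq"
    "q * (sq * sa) / (q * a / (b * c)) = sq * b * c / sa" "q * (sq * sa) / (sq * sa) = q"
    using nz by (simp_all add: sa)
  have pD: "(\<Prod>d'\<in>D. poch (q * (sq * sa) / d') k) = poch q k * (poch (- q) k * (poch sq k * (poch (- sq) k * poch (sq * b * c / sa) k)))" for k
    unfolding D_def prod5 [OF dist] g ..
  have pD': "(\<Prod>d'\<in>D - {sq * sa}. P (d' / (sq * sa))) = P (- 1) * (P sq * (P (- sq) * P (sq * sa / (b * c))))"
    unfolding D' f by (subst prod4) (use dist f in auto)
  show ?thesis
    using res_side_eq [OF nz(5) w0 a0 nz(3,4) w(2), of "sq * sa" D, folded A_def B_def, OF _ P pole_ratio sm] nz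
    unfolding pD pD' e half_summand_def phi_def thetas_def qpochs_def qpochs_inf_def
    by (simp add: mult_ac)
qed

lemma whole_side:
  assumes P: "P (q * sa) \<noteq> 0" "P (w * (q * sa)) \<noteq> 0"
    and sm: "summable (\<lambda>k. res_term A B {1, w} D (q * sa) k)"
  shows "P q * (res_pref B D (q * sa) * (\<Sum>k. res_term A B {1, w} D (q * sa) k)) = whole_summand sq sa b c h z"
proof -
  have w0: "w \<noteq> 0" and a0: "a \<noteq> 0" using nz by (auto simp: w(1) sa sq)
  have D': "D - {q * sa} = {sq * sa, - (sq * sa), - (q * sa), q * a / (b * c)}"
    using dist unfolding D_def by auto
  have e: "q * sa * b / a = q * b / sa" "q * sa * c / a = q * c / sa"
    "w * (q * sa) = b * c * z / sa" "q * sa / (q * a * w) = q * sa / (b * c * z)"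
    "h / (b * c * z / sa) = h * (sa / (b * c * z))"
    "q * a / (b * (q * sa)) = sa / b" "q * a / (c * (q * sa)) = sa / c"
    "q ^ 2 * a * w / (q * sa) = b * c * z / sa"
    using nz by (simp_all add: w(1) sa field_simps power2_eq_square)
  have f: "sq * sa / (q * sa) = 1 / sq" "- (sq * sa) / (q * sa) = - (1 / sq)" "- (q * sa) / (q * sa) = - 1"
    "q * a / (b * c) / (q * sa) = sa / (b * c)"
    using nz by (simp_all add: sq sa)
  have g: "q * (q * sa) / (sq * sa) = sq ^ 3" "q * (q * sa) / - (sq * sa) = - (sq ^ 3)" "q * (q * sa) / - (q * sa) = - q"
    "q * (q * sa) / (q * a / (b * c)) = q * b * c / sa" "q * (q * sa) / (q * sa) = q"
    using nz by (simp_all add: sq sa power3_eq_cube)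
  have pD: "(\<Prod>d'\<in>D. poch (q * (q * sa) / d') k) =
      poch (sq ^ 3) k * (poch (- (sq ^ 3)) k * (poch q k * (poch (- q) k * poch (q * b * c / sa) k)))" for k
    unfolding D_def prod5 [OF dist] g ..
  have pD': "(\<Prod>d'\<in>D - {q * sa}. P (d' / (q * sa))) = P (1 / sq) * (P (- (1 / sq)) * (P (- 1) * P (sa / (b * c))))"
    unfolding D' f by (subst prod4) (use dist f in auto)
  show ?thesis
    using res_side_eq [OF nz(5) w0 a0 nz(3,4) w(2), of "q * sa" D, folded A_def B_def, OF _ P pole_ratio sm] nz
    unfolding pD pD' e whole_summand_def phi_def thetas_def qpochs_def qpochs_inf_def
    by (simp add: mult_ac)
qed

lemma last_side:
  assumes P: "P (q * a / (b * c)) \<noteq> 0" "P z \<noteq> 0"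
    and sm: "summable (\<lambda>k. res_term A B {1, w} D (q * a / (b * c)) k)"
  shows "P q * (res_pref B D (q * a / (b * c)) * (\<Sum>k. res_term A B {1, w} D (q * a / (b * c)) k)) = last_summand sq sa a b c h z"
proof -
  define d where "d = q * a / (b * c)"
  have w0: "w \<noteq> 0" and a0: "a \<noteq> 0" using nz by (auto simp: w(1) sa sq)
  have d0: "d \<noteq> 0" using nz a0 by (simp add: d_def)
  have D': "D - {d} = {sq * sa, - (sq * sa), q * sa, - (q * sa)}"
    using dist unfolding D_def d_def by auto
  have e: "d * b / a = q / c" "d * c / a = q / b" "w * d = z" "d / (q * a * w) = q * a / (b ^ 2 * c ^ 2 * z)"
    "q * a / (b * d) = c" "q * a / (c * d) = b" "q ^ 2 * a * w / d = b ^ 2 * c ^ 2 * z / a"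
    using nz by (simp_all add: d_def w(1) sa field_simps power2_eq_square)
  have g: "q * d / (sq * sa) = sq ^ 3 * sa / (b * c)" "q * d / - (sq * sa) = - (sq ^ 3 * sa / (b * c))"
    "q * d / (q * sa) = q * sa / (b * c)" "q * d / - (q * sa) = - (q * sa / (b * c))" "q * d / (q * a / (b * c)) = q"
    using nz by (simp_all add: d_def sq sa power3_eq_cube)
  have pD: "(\<Prod>d'\<in>D. poch (q * d / d') k) = poch (sq ^ 3 * sa / (b * c)) k * (poch (- (sq ^ 3 * sa / (b * c))) k *
      (poch (q * sa / (b * c)) k * (poch (- (q * sa / (b * c))) k * poch q k)))" for k
    unfolding D_def prod5 [OF dist] g ..
  have pD': "(\<Prod>d'\<in>D - {d}. P (d' / d)) = P (b ^ 2 * c ^ 2 / (q * a))"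
  proof -
    have f: "sq * sa / d = b * c / (sq * sa)" "- (sq * sa) / d = - (b * c / (sq * sa))"
      "q * sa / d = sq * (b * c / (sq * sa))" "- (q * sa) / d = - (sq * (b * c / (sq * sa)))"
      using nz by (simp_all add: d_def sq sa)
    \<comment> \<open>The four remaining denominator products recombine by the duplication formula,
      which explains the single entry \<open>b^2 * c^2 / (q * a)\<close> in
      \<open>S5\<close>.\<close>
    have "b ^ 2 * c ^ 2 / (q * a) = (b * c / (sq * sa)) ^ 2" using nz by (simp add: sq sa power2_eq_square mult_ac)
    then show ?thesis
      using P_square [of sq "b * c / (sq * sa)"] dist unfolding D'
      by (subst prod4) (auto simp only: f, simp_all add: sq power2_eq_square mult_ac)
  qed
  show ?thesis
    using res_side_eq [OF nz(5) w0 a0 nz(3,4) w(2) d0, of D, folded A_def B_def, OF _ _ pole_ratio] P sm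
    unfolding pD pD' e last_summand_def phi_def thetas_def qpochs_def qpochs_inf_def d_def [symmetric]
    by (simp add: mult_ac)
qed

end

text \<open>Read as separation of poles: \<open>s\<close>, \<open>ws\<close>, the first part of
  \<open>bc\<close> and \<open>norm z < 1\<close> keep the five progressions accumulating at 0 away
  from the other two, \<open>u\<close>, \<open>s5\<close> and \<open>t5\<close> keep the five apart
  from each other, and \<open>generic\<close> does so for the other two.\<close>

theorem five_summands_generic:
  fixes sq sa a b c h z w :: complex
  assumes sq: "sq ^ 2 = q" and sa: "sa ^ 2 = a" and nz: "sa \<noteq> 0" "b \<noteq> 0" "c \<noteq> 0" "h \<noteq> 0" "z \<noteq> 0"
    and z: "norm z < 1" and w: "w = b * c * z / (q * a)" and generic: "generic w"
    and s: "P (sq * sa) \<noteq> 0" "P (- (sq * sa)) \<noteq> 0" "P (q * sa) \<noteq> 0" "P (- (q * sa)) \<noteq> 0"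
    and ws: "P (b * c * z / (sq * sa)) \<noteq> 0" "P (- (b * c * z / (sq * sa))) \<noteq> 0"
      "P (b * c * z / sa) \<noteq> 0" "P (- (b * c * z / sa)) \<noteq> 0"
    and u: "P (- 1) \<noteq> 0" "P sq \<noteq> 0" "P (- sq) \<noteq> 0" "P (1 / sq) \<noteq> 0" "P (- (1 / sq)) \<noteq> 0"
    and s5: "P (sq * sa / (b * c)) \<noteq> 0" "P (- (sq * sa / (b * c))) \<noteq> 0" "P (sa / (b * c)) \<noteq> 0" "P (- (sa / (b * c))) \<noteq> 0"
    and t5: "P (sq * b * c / sa) \<noteq> 0" "P (- (sq * b * c / sa)) \<noteq> 0" "P (q * b * c / sa) \<noteq> 0" "P (- (q * b * c / sa)) \<noteq> 0"
    and bc: "P (q * a / (b * c)) \<noteq> 0" "P (q * a / b) \<noteq> 0" "P (q * a / c) \<noteq> 0" "P sa \<noteq> 0" "P (- sa) \<noteq> 0"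
  shows "theta h q * theta (h / w) q * (P (q * a / b) * P (q * a / c)) * W54 a sa b c q z =
      P (q * a) * P (q * a / (b * c)) * (1 - q * a * w ^ 2) *
      (half_summand sq sa b c h z + half_summand sq (- sa) b c h z + whole_summand sq sa b c h z +
       whole_summand sq (- sa) b c h z + last_summand sq sa a b c h z)"
proof -
  have q: "q = sq * sq" and a: "a = sa * sa" using sq sa by (simp_all add: power2_eq_square)
  have sq0: "sq \<noteq> 0" using q q_nz by auto
  have a0: "a \<noteq> 0" using nz by (simp add: a)
  have w0: "w \<noteq> 0" and w1: "w \<noteq> 1" and Pw: "P w \<noteq> 0" "P (1 / w) \<noteq> 0"
    using generic generic_inverse [OF generic] P_step [of 1] by (auto simp: generic_def)
  define s1 s2 s3 s4 s5 where s_defs: "s1 = sq * sa" "s2 = - (sq * sa)" "s3 = q * sa" "s4 = - (q * sa)" "s5 = q * a / (b * c)"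
  define D where "D = {s1, s2, s3, s4, s5}"
  define A where "A = [h, q * w / h]"
  define B where "B = [q / h, h / w, q * a / b, q * a / c, q ^ 2 * a * w]"
  \<comment> \<open>With \<open>x = sq * sa / (b * c)\<close> the number \<open>q / x\<close> is the
    lower parameter \<open>sq * b * c / sa\<close> of the series in \<open>S1\<close>. So a
    denominator factor and a lower parameter together say that \<open>x\<close> is no integer power
    of \<open>q\<close>.\<close>
  have t5': "P (b * c / (sq * sa)) \<noteq> 0" "P (- (b * c / (sq * sa))) \<noteq> 0"
    using P_inverse_nonzero [of "sq * sa / (b * c)"] P_inverse_nonzero [of "- (sq * sa / (b * c))"] s5 t5 nz sq0
    by (simp_all add: q mult.assoc)
  have t5'': "P (b * c / sa) \<noteq> 0" "P (- (b * c / sa)) \<noteq> 0"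
    using P_inverse_nonzero [of "sa / (b * c)"] P_inverse_nonzero [of "- (sa / (b * c))"] s5 t5 nz
    by (simp_all add: mult.assoc)
  have ratio: "s1 / s2 = - 1" "s2 / s1 = - 1" "s3 / s4 = - 1" "s4 / s3 = - 1"
    "s1 / s3 = 1 / sq" "s2 / s4 = 1 / sq" "s1 / s4 = - (1 / sq)" "s2 / s3 = - (1 / sq)"
    "s3 / s1 = sq" "s4 / s2 = sq" "s3 / s2 = - sq" "s4 / s1 = - sq"
    "s5 / s1 = sq * sa / (b * c)" "s5 / s2 = - (sq * sa / (b * c))" "s5 / s3 = sa / (b * c)" "s5 / s4 = - (sa / (b * c))"
    "s1 / s5 = b * c / (sq * sa)" "s2 / s5 = - (b * c / (sq * sa))" "s3 / s5 = b * c / sa" "s4 / s5 = - (b * c / sa)"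
    unfolding s_defs q a using nz sq0 by simp_all
  have s0: "s1 \<noteq> 0" "s2 \<noteq> 0" "s3 \<noteq> 0" "s4 \<noteq> 0" "s5 \<noteq> 0" using nz sq0 a0 by (auto simp: s_defs q)
  have P_ratio: "P (s1 / s2) \<noteq> 0" "P (s2 / s1) \<noteq> 0" "P (s3 / s4) \<noteq> 0" "P (s4 / s3) \<noteq> 0"
    "P (s1 / s3) \<noteq> 0" "P (s2 / s4) \<noteq> 0" "P (s1 / s4) \<noteq> 0" "P (s2 / s3) \<noteq> 0"
    "P (s3 / s1) \<noteq> 0" "P (s4 / s2) \<noteq> 0" "P (s3 / s2) \<noteq> 0" "P (s4 / s1) \<noteq> 0"
    "P (s5 / s1) \<noteq> 0" "P (s5 / s2) \<noteq> 0" "P (s5 / s3) \<noteq> 0" "P (s5 / s4) \<noteq> 0"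
    "P (s1 / s5) \<noteq> 0" "P (s2 / s5) \<noteq> 0" "P (s3 / s5) \<noteq> 0" "P (s4 / s5) \<noteq> 0"
    unfolding ratio by (fact u s5 t5' t5'')+
  have neq: "x \<noteq> y" if "P (x / y) \<noteq> 0" "x \<noteq> 0" for x y
    using that P_step [of 1] by auto
  have dist: "distinct [s1, s2, s3, s4, s5]"
    using P_ratio neq s0 by simp
  have s_nz: "P d \<noteq> 0" if "d \<in> D" for d
    using that s bc unfolding D_def s_defs by auto
  have wd: "w * s1 = b * c * z / (sq * sa)" "w * s2 = - (b * c * z / (sq * sa))" "w * s3 = b * c * z / sa"
    "w * s4 = - (b * c * z / sa)" "w * s5 = z"
    unfolding w s_defs q a using nz sq0 by simp_all
  have ws_nz: "P (w * d) \<noteq> 0" if "d \<in> D" for d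
    using that ws P_nonzero_if_norm_less [OF z] unfolding D_def by (auto simp: wd)
  have sp: "simple_poles {1, w} D"
    unfolding simple_poles_def
  proof (intro conjI)
    show "\<forall>d\<in>D. \<forall>d'\<in>D. d \<noteq> d' \<longrightarrow> P (d / d') \<noteq> 0"
      using P_ratio unfolding D_def by simp
    show "\<forall>c\<in>{1, w}. \<forall>d\<in>D. P (c * d) \<noteq> 0" using s_nz ws_nz by simp
  qed (use w0 s0 Pw in \<open>auto simp: D_def\<close>)
  have cards: "card {1, w} = 2" "card D = 5"
    using w1 distinct_card [OF dist] by (auto simp: D_def)
  have ratio_B: "prod_list B / \<Prod>D = q"
    by (rule pole_ratio [OF q a sq0 nz w w1 _ _ A_def B_def]) (use dist in \<open>simp_all only: D_def s_defs\<close>)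
  have B0: "prod_list B \<noteq> 0" using nz w0 a0 by (simp add: B_def)
  then have D0: "\<Prod>D \<noteq> 0" using ratio_B q_nz by auto
  have ltB: "norm (prod_list B) < norm (\<Prod>D)"
  proof -
    have "prod_list B = q * \<Prod>D" using ratio_B D0 by (simp add: field_simps)
    then show ?thesis using q_less D0 by (simp add: norm_mult)
  qed
  have ltA: "norm (prod_list A) < norm (\<Prod>{1, w})"
    using q_less w0 w1 nz by (simp add: A_def norm_mult)
  have sm: "summable (\<lambda>k. res_term A B {1, w} D d k)" if "d \<in> D" for d
  proof (rule summable_norm_cancel, rule res_term_summable [OF _ _ that _ _ _ ltB])
    show "P (d / d') \<noteq> 0" if "d' \<in> D" "d' \<noteq> d" for d'
      using sp \<open>d \<in> D\<close> that unfolding simple_poles_def by metis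
    show "P (c * d) \<noteq> 0" if "c \<in> {1, w}" for c
      using that s_nz [OF \<open>d \<in> D\<close>] ws_nz [OF \<open>d \<in> D\<close>] by auto
  qed (use sp in \<open>auto simp: simple_poles_def\<close>)
  have inner: "P q * (\<Sum>d\<in>D. res_pref B D d * (\<Sum>k. res_term A B {1, w} D d k)) =
    half_summand sq sa b c h z + half_summand sq (- sa) b c h z + whole_summand sq sa b c h z +
       whole_summand sq (- sa) b c h z + last_summand sq sa a b c h z"
  proof -
    define G where "G d = P q * (res_pref B D d * (\<Sum>k. res_term A B {1, w} D d k))" for d
    have "P q * (\<Sum>d\<in>D. res_pref B D d * (\<Sum>k. res_term A B {1, w} D d k)) = (\<Sum>d\<in>D. G d)"
      by (simp add: G_def sum_distrib_left)
    also have "\<dots> = G s1 + G s2 + G s3 + G s4 + G s5"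
      using dist by (simp add: D_def add_ac)
    also have "G s1 = half_summand sq sa b c h z"
      using half_side [OF q a sq0 nz w w1 _ _ A_def B_def, of D] dist s_nz [of s1] ws_nz [of s1] sm [of s1]
      unfolding G_def by (simp add: D_def s_defs)
    also have "G s3 = whole_summand sq sa b c h z"
      using whole_side [OF q a sq0 nz w w1 _ _ A_def B_def, of D] dist s_nz [of s3] ws_nz [of s3] sm [of s3]
      unfolding G_def by (simp add: D_def s_defs)
    also have "G s5 = last_summand sq sa a b c h z"
      using last_side [OF q a sq0 nz w w1 _ _ A_def B_def, of D] dist s_nz [of s5] P_nonzero_if_norm_less [OF z] sm [of s5]
      unfolding G_def by (simp add: D_def s_defs)
    also have "G s2 = half_summand sq (- sa) b c h z"
    proof -
      have a': "a = - sa * - sa" and sa': "- sa \<noteq> 0" using a nz by auto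
      show ?thesis
        using half_side [OF q a' sq0 sa' nz(2-) w w1 _ _ A_def B_def, of D] dist s_nz [of s2] ws_nz [of s2] sm [of s2]
        unfolding G_def by (simp add: D_def s_defs insert_commute)
    qed
    also have "G s4 = whole_summand sq (- sa) b c h z"
    proof -
      have a': "a = - sa * - sa" and sa': "- sa \<noteq> 0" using a nz by auto
      show ?thesis
        using whole_side [OF q a' sq0 sa' nz(2-) w w1 _ _ A_def B_def, of D] dist s_nz [of s4] ws_nz [of s4] sm [of s4]
        unfolding G_def by (simp add: D_def s_defs insert_commute)
    qed
    finally show ?thesis by (simp add: add_ac)
  qed
  define \<Phi> where "\<Phi> = (\<lambda>y. P (q * a * (1 / b) * y) * P (q * a * (1 / c) * y) * P (q ^ 2 * a * w * y) /
        (P (q * a * (1 / b) * (1 / c) * y) * P (q * a * y ^ 2)))"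
  \<comment> \<open>Duplication read backwards: four of the five progressions are the zeros of a
    single product in \<open>1 / x\<^sup>2\<close>.\<close>
  have sqr: "P (q * a * y ^ 2) = P (s1 * y) * P (s2 * y) * P (s3 * y) * P (s4 * y)" for y
    using P_square [OF sq, of "s1 * y"] by (simp add: s_defs q a power2_eq_square mult_ac)
  have qa: "P (q * a) \<noteq> 0" and qaw: "P (q * a * w ^ 2) \<noteq> 0"
    using sqr [of 1] sqr [of w] s ws wd by (simp_all add: s_defs mult.commute [of _ w])
  have zw: "q * a * (1 / b) * (1 / c) * w = z" using nz a0 by (simp add: w)
  have \<Phi>_bdd: "lat_bdd w \<Phi>"
    unfolding \<Phi>_def divide_divide_eq_left [symmetric]
    using bc P_nonzero_if_norm_less [OF z] qa qaw zw
    by (intro lat_bdd_div_P_square lat_bdd_div_P lat_bdd_mult lat_bdd_P) (auto simp: zw)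
  have outer: "P q * (\<Sum>c'\<in>{1, w}. res_pref A {1, w} c' * (\<Sum>k. res_term B A D {1, w} c' k)) =
    theta h q * theta (h / w) q * lat_sum w \<Phi>"
    unfolding A_def B_def \<Phi>_def
  proof (rule outer_side_eq [OF nz(4) a0 nz(2,3) generic \<Phi>_bdd [unfolded \<Phi>_def]])
    show "(\<Prod>d\<in>D. P (d * y)) = P (q * a * y ^ 2) * P (q * a / (b * c) * y)" for y
      unfolding D_def prod5 [OF dist] sqr by (simp add: s_defs)
  qed
  have "(\<Sum>d\<in>D. res_pref B D d * (\<Sum>k. res_term A B {1, w} D d k)) =
      (\<Sum>c\<in>{1, w}. res_pref A {1, w} c * (\<Sum>k. res_term B A D {1, w} c k))"
    by (rule sum_of_residues [OF sp _ _ _ _ ltA ltB]) (use nz w0 a0 cards in \<open>simp_all add: A_def B_def\<close>)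
  then have sum_eq: "half_summand sq sa b c h z + half_summand sq (- sa) b c h z + whole_summand sq sa b c h z +
       whole_summand sq (- sa) b c h z + last_summand sq sa a b c h z = theta h q * theta (h / w) q * lat_sum w \<Phi>"
    using inner outer by simp
  have a1: "a \<noteq> 1" using bc(4,5) P_step [of sa] P_step [of "- sa"] by (auto simp: a square_eq_1_iff)
  have "P (q * a * (1 / b)) * P (q * a * (1 / c)) * (\<Sum>k. wp_coeff a (1 / b) (1 / c) k * w ^ k) =
    P (q * a) * P (q * a * (1 / b) * (1 / c)) * ((1 - q * a * w ^ 2) * lat_sum w \<Phi>)"
    unfolding \<Phi>_def
  proof (rule wp_two_series [OF a1 _ _ _ _ generic qa qaw])
    show "norm (q * a * (1 / b) * (1 / c) * w) < 1" unfolding zw by (rule z)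
  qed (use nz bc in simp_all)
  then have "P (q * a / b) * P (q * a / c) * W54 a sa b c q z =
    P (q * a) * P (q * a / (b * c)) * ((1 - q * a * w ^ 2) * lat_sum w \<Phi>)"
    using W54_eq_suminf [OF sa [symmetric] nz(2,3) a0 bc(4,5) zw [symmetric]] by simp
  then show ?thesis unfolding sum_eq by (simp add: mult_ac)
qed

end

section \<open>The theorem\<close>

context nome
begin

text \<open>Tannery's theorem with a geometric majorant. The lower parameters stay fixed because in
  none of the series concerned do they involve \<open>z\<close>, so the reciprocals have bounds
  independent of \<open>n\<close>.\<close>

lemma phi_tendsto:
  assumes x: "x1 \<longlonglongrightarrow> l1" "x2 \<longlonglongrightarrow> l2" "x3 \<longlonglongrightarrow> l3" "x4 \<longlonglongrightarrow> l4" "x5 \<longlonglongrightarrow> l5"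
    and bs: "P b1 \<noteq> 0" "P b2 \<noteq> 0" "P b3 \<noteq> 0" "P b4 \<noteq> 0"
    and \<zeta>: "\<zeta> \<longlonglongrightarrow> l" "\<And>n. norm (\<zeta> n) \<le> r" "r < 1"
  shows "(\<lambda>n. phi [x1 n, x2 n, x3 n, x4 n, x5 n] [b1, b2, b3, b4] q (\<zeta> n)) \<longlonglongrightarrow>
    phi [l1, l2, l3, l4, l5] [b1, b2, b3, b4] q l"
proof -
  have bounded: "\<exists>C. \<forall>n k. norm (poch (x n) k) \<le> C" if x: "x \<longlonglongrightarrow> y" for x :: "nat \<Rightarrow> complex" and y
  proof -
    have "Bseq x" using x by (intro convergent_imp_Bseq) (auto simp: convergent_def)
    then obtain M where "\<And>n. norm (x n) \<le> M" unfolding Bseq_def by blast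
    then have "norm (poch (x n) k) \<le> pbound M" for n k by (intro norm_poch_le)
    then show ?thesis by blast
  qed
  obtain C1 where C1: "\<And>n k. norm (poch (x1 n) k) \<le> C1" using bounded [OF x(1)] by blast
  obtain C2 where C2: "\<And>n k. norm (poch (x2 n) k) \<le> C2" using bounded [OF x(2)] by blast
  obtain C3 where C3: "\<And>n k. norm (poch (x3 n) k) \<le> C3" using bounded [OF x(3)] by blast
  obtain C4 where C4: "\<And>n k. norm (poch (x4 n) k) \<le> C4" using bounded [OF x(4)] by blast
  obtain C5 where C5: "\<And>n k. norm (poch (x5 n) k) \<le> C5" using bounded [OF x(5)] by blast
  note C = C1 C2 C3 C4 C5
  obtain E0 where E0: "\<And>k. norm (inverse (poch q k)) \<le> E0" using inverse_poch_bounded [OF P_q_nonzero] by blast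
  obtain E1 where E1: "\<And>k. norm (inverse (poch b1 k)) \<le> E1" using inverse_poch_bounded [OF bs(1)] by blast
  obtain E2 where E2: "\<And>k. norm (inverse (poch b2 k)) \<le> E2" using inverse_poch_bounded [OF bs(2)] by blast
  obtain E3 where E3: "\<And>k. norm (inverse (poch b3 k)) \<le> E3" using inverse_poch_bounded [OF bs(3)] by blast
  obtain E4 where E4: "\<And>k. norm (inverse (poch b4 k)) \<le> E4" using inverse_poch_bounded [OF bs(4)] by blast
  have C0: "0 \<le> C1" "0 \<le> C2" "0 \<le> C3" "0 \<le> C4" "0 \<le> C5"
    by (rule order_trans [OF norm_ge_zero C(1)] order_trans [OF norm_ge_zero C(2)] order_trans [OF norm_ge_zero C(3)]
      order_trans [OF norm_ge_zero C(4)] order_trans [OF norm_ge_zero C(5)])+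
  have E0': "0 \<le> E0" "0 \<le> E1" "0 \<le> E2" "0 \<le> E3" "0 \<le> E4"
    by (rule order_trans [OF norm_ge_zero E0] order_trans [OF norm_ge_zero E1] order_trans [OF norm_ge_zero E2]
      order_trans [OF norm_ge_zero E3] order_trans [OF norm_ge_zero E4])+
  have r: "0 \<le> r" using \<zeta>(2) [of 0] norm_ge_zero order_trans by blast
  define K where "K = C1 * C2 * C3 * C4 * C5 * E0 * E1 * E2 * E3 * E4"
  show ?thesis
    unfolding phi_def
  proof (intro tannerys_theorem [THEN conjunct2, THEN conjunct2])
    have nz: "qpochs [q, b1, b2, b3, b4] q k \<noteq> 0" for k
      using bs by (simp add: qpochs_def poch_nonzero)
    show "(\<lambda>n. qpochs [x1 n, x2 n, x3 n, x4 n, x5 n] q k / qpochs [q, b1, b2, b3, b4] q k * \<zeta> n ^ k) \<longlonglongrightarrow>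
      qpochs [l1, l2, l3, l4, l5] q k / qpochs [q, b1, b2, b3, b4] q k * l ^ k" for k
      using nz [of k] unfolding qpochs_def by (auto intro!: tendsto_intros x \<zeta>)
    show "summable (\<lambda>k. K * r ^ k)"
      using r \<zeta>(3) by (intro summable_mult summable_geometric) auto
    have "norm (qpochs [x1 n, x2 n, x3 n, x4 n, x5 n] q k / qpochs [q, b1, b2, b3, b4] q k * \<zeta> n ^ k) \<le> K * r ^ k" for n k
    proof -
      have "norm (qpochs [x1 n, x2 n, x3 n, x4 n, x5 n] q k / qpochs [q, b1, b2, b3, b4] q k * \<zeta> n ^ k) =
        norm (poch (x1 n) k) * norm (poch (x2 n) k) * norm (poch (x3 n) k) * norm (poch (x4 n) k) * norm (poch (x5 n) k) *
        norm (inverse (poch q k)) * norm (inverse (poch b1 k)) * norm (inverse (poch b2 k)) *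
        norm (inverse (poch b3 k)) * norm (inverse (poch b4 k)) * norm (\<zeta> n) ^ k"
        by (simp add: qpochs_def norm_mult norm_divide norm_power norm_inverse divide_inverse mult_ac)
      also have "\<dots> \<le> K * r ^ k"
        unfolding K_def using C0 E0' r by (intro mult_mono C E0 E1 E2 E3 E4 power_mono \<zeta>) auto
      finally show ?thesis .
    qed
    then show "\<forall>\<^sub>F (k, n) in sequentially \<times>\<^sub>F sequentially.
      norm (qpochs [x1 n, x2 n, x3 n, x4 n, x5 n] q k / qpochs [q, b1, b2, b3, b4] q k * \<zeta> n ^ k) \<le> K * r ^ k"
      by (intro always_eventually) auto
  qed auto
qed

lemmas phi_q_tendsto = phi_tendsto [OF _ _ _ _ _ _ _ _ _ tendsto_const order_refl q_less]

section \<open>Continuity of the five summands in \<open>z\<close>\<close>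

lemma half_summand_tendsto:
  assumes zs: "zs \<longlonglongrightarrow> z" and nz: "z \<noteq> 0" "b \<noteq> 0" "c \<noteq> 0" "sa \<noteq> 0" "sq \<noteq> 0" "h \<noteq> 0"
    and den: "qpochs_inf [-1, sq, - sq, sq * sa, sq * sa / (b * c), b * c * z / (sq * sa)] q \<noteq> 0"
    and adm: "P (- q) \<noteq> 0" "P sq \<noteq> 0" "P (- sq) \<noteq> 0" "P (sq * b * c / sa) \<noteq> 0"
  shows "(\<lambda>n. half_summand sq sa b c h (zs n)) \<longlonglongrightarrow> half_summand sq sa b c h z"
  unfolding half_summand_def
  using den unfolding thetas_def theta_eq qpochs_inf_def list.map prod_list.Cons prod_list.Nil
  by (intro tendsto_intros zs phi_q_tendsto adm) (assumption | simp (no_asm) add: nz)+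

lemma whole_summand_tendsto:
  assumes zs: "zs \<longlonglongrightarrow> z" and nz: "z \<noteq> 0" "b \<noteq> 0" "c \<noteq> 0" "sa \<noteq> 0" "sq \<noteq> 0" "h \<noteq> 0"
    and den: "qpochs_inf [-1, 1 / sq, - (1 / sq), q * sa, sa / (b * c), b * c * z / sa] q \<noteq> 0"
    and adm: "P (- q) \<noteq> 0" "P (sq ^ 3) \<noteq> 0" "P (- (sq ^ 3)) \<noteq> 0" "P (q * b * c / sa) \<noteq> 0"
  shows "(\<lambda>n. whole_summand sq sa b c h (zs n)) \<longlonglongrightarrow> whole_summand sq sa b c h z"
  unfolding whole_summand_def
  using den unfolding thetas_def theta_eq qpochs_inf_def list.map prod_list.Cons prod_list.Nil
  by (intro tendsto_intros zs phi_q_tendsto adm) (assumption | simp (no_asm) add: nz)+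

lemma last_summand_tendsto:
  assumes zs: "zs \<longlonglongrightarrow> z" and nz: "z \<noteq> 0" "b \<noteq> 0" "c \<noteq> 0" "sa \<noteq> 0" "sq \<noteq> 0" "h \<noteq> 0" "a \<noteq> 0"
    and den: "qpochs_inf [z, q * a / (b * c), b ^ 2 * c ^ 2 / (q * a)] q \<noteq> 0"
    and adm: "P (q * sa / (b * c)) \<noteq> 0" "P (- (q * sa / (b * c))) \<noteq> 0"
      "P (sq ^ 3 * sa / (b * c)) \<noteq> 0" "P (- (sq ^ 3 * sa / (b * c))) \<noteq> 0"
  shows "(\<lambda>n. last_summand sq sa a b c h (zs n)) \<longlonglongrightarrow> last_summand sq sa a b c h z"
  unfolding last_summand_def
  using den unfolding thetas_def theta_eq qpochs_inf_def list.map prod_list.Cons prod_list.Nil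
  by (intro tendsto_intros zs phi_q_tendsto adm) (assumption | simp (no_asm) add: nz)+

end

theorem theorem5p2:
  fixes q z a b c h sq sa S1 S2 S3 S4 S5 :: complex
  assumes nonzero: "q \<noteq> 0" "z \<noteq> 0" "a \<noteq> 0" "b \<noteq> 0" "c \<noteq> 0" "h \<noteq> 0"
    and norms: "norm q < 1" "norm z < 1"
    and roots: "sq ^ 2 = q" "sa ^ 2 = a"
    and denominators:
      "thetas [h, h * (q * a / (b * c * z))] q \<noteq> 0"
      "qpochs_inf [b^2 * c^2 * z^2 / a, q * a / b, q * a / c] q \<noteq> 0"
      "qpochs_inf [-1, sq, - sq, sq * sa, sq * sa / (b * c), b * c * z / (sq * sa)] q \<noteq> 0"
      "qpochs_inf [-1, sq, - sq, - (sq * sa), - (sq * sa / (b * c)), - (b * c * z / (sq * sa))] q \<noteq> 0"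
      "qpochs_inf [-1, 1 / sq, - (1 / sq), q * sa, sa / (b * c), b * c * z / sa] q \<noteq> 0"
      "qpochs_inf [-1, 1 / sq, - (1 / sq), - (q * sa), - (sa / (b * c)), - (b * c * z / sa)] q \<noteq> 0"
      "qpochs_inf [z, q * a / (b * c), b^2 * c^2 / (q * a)] q \<noteq> 0"
    and series_parameters:
      "admissible [sa, - sa, q * a / b, q * a / c] q"
      "admissible [- q, sq, - sq, sq * b * c / sa] q"
      "admissible [- q, sq, - sq, - (sq * b * c / sa)] q"
      "admissible [- q, sq ^ 3, - (sq ^ 3), q * b * c / sa] q"
      "admissible [- q, sq ^ 3, - (sq ^ 3), - (q * b * c / sa)] q"
      "admissible [q * sa / (b * c), - (q * sa / (b * c)),
                   sq ^ 3 * sa / (b * c), - (sq ^ 3 * sa / (b * c))] q"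
    and S1: "S1 =
      thetas [h * (sq * sa), h * (sq * sa / (b * c * z))] q
        * qpochs_inf [sq * sa / b, sq * sa / c, b * c * z * (sq / sa)] q
      / qpochs_inf [-1, sq, - sq, sq * sa, sq * sa / (b * c), b * c * z / (sq * sa)] q
      * phi [sq * sa, q * b / (sq * sa), q * c / (sq * sa),
             b * c * z / (sq * sa), sq * sa / (b * c * z)]
            [- q, sq, - sq, sq * b * c / sa] q q"
    and S2: "S2 =
      thetas [- (h * (sq * sa)), - (h * (sq * sa / (b * c * z)))] q
        * qpochs_inf [- (sq * sa / b), - (sq * sa / c), - (b * c * z * (sq / sa))] q
      / qpochs_inf [-1, sq, - sq, - (sq * sa), - (sq * sa / (b * c)), - (b * c * z / (sq * sa))] q
      * phi [- (sq * sa), - (sq * b / sa), - (sq * c / sa),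
             - (b * c * z / (sq * sa)), - (sq * sa / (b * c * z))]
            [- q, sq, - sq, - (sq * b * c / sa)] q q"
    and S3: "S3 =
      thetas [h * q * sa, h * (sa / (b * c * z))] q
        * qpochs_inf [sa / b, sa / c, b * c * z / sa] q
      / qpochs_inf [-1, 1 / sq, - (1 / sq), q * sa, sa / (b * c), b * c * z / sa] q
      * phi [q * sa, q * b / sa, q * c / sa, b * c * z / sa, q * sa / (b * c * z)]
            [- q, sq ^ 3, - (sq ^ 3), q * b * c / sa] q q"
    and S4: "S4 =
      thetas [- (h * q * sa), - (h * (sa / (b * c * z)))] q
        * qpochs_inf [- (sa / b), - (sa / c), - (b * c * z / sa)] q
      / qpochs_inf [-1, 1 / sq, - (1 / sq), - (q * sa), - (sa / (b * c)), - (b * c * z / sa)] q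
      * phi [- (q * sa), - (q * b / sa), - (q * c / sa),
             - (b * c * z / sa), - (q * sa / (b * c * z))]
            [- q, sq ^ 3, - (sq ^ 3), - (q * b * c / sa)] q q"
    and S5: "S5 =
      thetas [h / z, h * (q * a / (b * c))] q
        * qpochs_inf [b, c, b^2 * c^2 * z / a] q
      / qpochs_inf [z, q * a / (b * c), b^2 * c^2 / (q * a)] q
      * phi [q / b, q / c, q * a / (b * c), z, q * a / (b^2 * c^2 * z)]
            [q * sa / (b * c), - (q * sa / (b * c)),
             sq ^ 3 * sa / (b * c), - (sq ^ 3 * sa / (b * c))] q q"
  shows "W54 a sa b c q z =
      qpochs_inf [q * a, b^2 * c^2 * z^2 / (q * a), q * a / (b * c)] q
      / (thetas [h, h * (q * a / (b * c * z))] q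
           * qpochs_inf [b^2 * c^2 * z^2 / a, q * a / b, q * a / c] q)
      * (S1 + S2 + S3 + S4 + S5)"
proof -
  interpret nome q using nonzero norms by unfold_locales
  have nz: "z \<noteq> 0" "a \<noteq> 0" "b \<noteq> 0" "c \<noteq> 0" "h \<noteq> 0" "sq \<noteq> 0" "sa \<noteq> 0" using nonzero roots by auto
  have bcq: "P (b^2 * c^2 * z^2 / a) \<noteq> 0" "P (q * a / b) \<noteq> 0" "P (q * a / c) \<noteq> 0" "P (q * a / (b * c)) \<noteq> 0"
    using denominators(2,7) by (auto simp: qpochs_inf_def)
  have s: "P (sq * sa) \<noteq> 0" "P (- (sq * sa)) \<noteq> 0" "P (q * sa) \<noteq> 0" "P (- (q * sa)) \<noteq> 0"
    and ws: "P (b * c * z / (sq * sa)) \<noteq> 0" "P (- (b * c * z / (sq * sa))) \<noteq> 0"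
      "P (b * c * z / sa) \<noteq> 0" "P (- (b * c * z / sa)) \<noteq> 0"
    and u: "P (- 1) \<noteq> 0" "P sq \<noteq> 0" "P (- sq) \<noteq> 0" "P (1 / sq) \<noteq> 0" "P (- (1 / sq)) \<noteq> 0"
    and s5: "P (sq * sa / (b * c)) \<noteq> 0" "P (- (sq * sa / (b * c))) \<noteq> 0" "P (sa / (b * c)) \<noteq> 0" "P (- (sa / (b * c))) \<noteq> 0"
    using denominators(3-6) by (auto simp: qpochs_inf_def)
  have t5: "P (sq * b * c / sa) \<noteq> 0" "P (- (sq * b * c / sa)) \<noteq> 0" "P (q * b * c / sa) \<noteq> 0" "P (- (q * b * c / sa)) \<noteq> 0"
    and sa: "P sa \<noteq> 0" "P (- sa) \<noteq> 0" and pq: "P (- q) \<noteq> 0" "P (sq ^ 3) \<noteq> 0" "P (- (sq ^ 3)) \<noteq> 0"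
    and v5: "P (q * sa / (b * c)) \<noteq> 0" "P (- (q * sa / (b * c))) \<noteq> 0"
      "P (sq ^ 3 * sa / (b * c)) \<noteq> 0" "P (- (sq ^ 3 * sa / (b * c))) \<noteq> 0"
    using series_parameters by (simp_all add: admissible_iff)
  have th: "theta h q \<noteq> 0" "theta (h / (b * c * z / (q * a))) q \<noteq> 0"
    using denominators(1) by (auto simp: thetas_def)
  define R where "R x = half_summand sq sa b c h x + half_summand sq (- sa) b c h x + whole_summand sq sa b c h x +
       whole_summand sq (- sa) b c h x + last_summand sq sa a b c h x" for x
  have halfq: "q * x / (sq * sa) = sq * x / sa" for x
    using nz roots(1) by (simp add: power2_eq_square field_simps)
  have S: "S1 = half_summand sq sa b c h z" "S2 = half_summand sq (- sa) b c h z" "S3 = whole_summand sq sa b c h z"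
    "S4 = whole_summand sq (- sa) b c h z" "S5 = last_summand sq sa a b c h z"
    unfolding S1 S2 S3 S4 S5 half_summand_def whole_summand_def last_summand_def
    using halfq by (simp_all add: mult.assoc)
  \<comment> \<open>\<open>X\<close> and \<open>Y\<close> are the two sides as functions of
    \<open>z\<close>, multiplied by the denominators of the prefactor, so that equality passes to
    the limit without any division.\<close>
  define X where "X x = theta h q * theta (h / (b * c * x / (q * a))) q * (P (q * a / b) * P (q * a / c)) * W54 a sa b c q x" for x
  define Y where "Y x = P (q * a) * P (q * a / (b * c)) * (1 - q * a * (b * c * x / (q * a)) ^ 2) * R x" for x
  \<comment> \<open>Apart from 0, the arguments for which \<open>w\<close> is an integer power of
    \<open>q\<close>.\<close>
  define bad where "bad = {0} \<union> {x. P (b * c / (q * a) * x) = 0} \<union> {x. P (q * (q * a / (b * c)) / x) = 0}"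
  have "countable bad"
    unfolding bad_def using nz by (intro countable_Un countable_zeros_mult countable_zeros_div) auto
  then obtain s0 where s0: "s0 \<longlonglongrightarrow> z" "\<And>n. s0 n \<notin> bad"
    using sequence_avoiding_countable by metis
  \<comment> \<open>A radius strictly between \<open>norm z\<close> and 1 gives the geometric
    majorant for the left-hand series along the whole sequence.\<close>
  obtain r where r: "norm z < r" "r < 1" using norms(2) dense by blast
  have "\<forall>\<^sub>F n in sequentially. norm (s0 n) < r"
    using order_tendstoD(2) [OF tendsto_norm [OF s0(1)] r(1)] .
  moreover have "\<forall>\<^sub>F n in sequentially. P (b * c * s0 n / (sq * sa)) \<noteq> 0"
      "\<forall>\<^sub>F n in sequentially. P (- (b * c * s0 n / (sq * sa))) \<noteq> 0"
      "\<forall>\<^sub>F n in sequentially. P (b * c * s0 n / sa) \<noteq> 0" "\<forall>\<^sub>F n in sequentially. P (- (b * c * s0 n / sa)) \<noteq> 0"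
    using nz by (intro tendsto_imp_eventually_ne [OF _ ws(1)] tendsto_imp_eventually_ne [OF _ ws(2)]
      tendsto_imp_eventually_ne [OF _ ws(3)] tendsto_imp_eventually_ne [OF _ ws(4)] tendsto_intros s0; simp)+
  ultimately have "\<forall>\<^sub>F n in sequentially. norm (s0 n) < r \<and> P (b * c * s0 n / (sq * sa)) \<noteq> 0 \<and>
      P (- (b * c * s0 n / (sq * sa))) \<noteq> 0 \<and> P (b * c * s0 n / sa) \<noteq> 0 \<and> P (- (b * c * s0 n / sa)) \<noteq> 0"
    by eventually_elim simp
  then obtain N where N: "\<And>n. n \<ge> N \<Longrightarrow> norm (s0 n) < r \<and> P (b * c * s0 n / (sq * sa)) \<noteq> 0 \<and>
      P (- (b * c * s0 n / (sq * sa))) \<noteq> 0 \<and> P (b * c * s0 n / sa) \<noteq> 0 \<and> P (- (b * c * s0 n / sa)) \<noteq> 0"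
    by (auto simp: eventually_sequentially)
  \<comment> \<open>The first \<open>N\<close> members are dropped so that every condition that
    holds near \<open>z\<close> holds for all members.\<close>
  define zs where "zs n = s0 (n + N)" for n
  have zs: "zs \<longlonglongrightarrow> z" unfolding zs_def by (rule LIMSEQ_ignore_initial_segment [OF s0(1)])
  have XY: "X (zs n) = Y (zs n)" for n
  proof -
    define w where "w = b * c * zs n / (q * a)"
    have n: "zs n \<noteq> 0" "norm (zs n) < 1" and P: "P (b * c / (q * a) * zs n) \<noteq> 0" "P (q * (q * a / (b * c)) / zs n) \<noteq> 0"
      using s0(2) [of "n + N"] N [of "n + N"] r(2) by (auto simp: zs_def bad_def)
    have "b * c / (q * a) * zs n = w" "q * (q * a / (b * c)) / zs n = q / w"
      by (simp_all add: w_def)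
    then have "generic w" using P n(1) nz by (simp add: generic_def w_def)
    then show ?thesis
      using five_summands_generic [OF roots nz(7,3,4,5) n w_def _ s _ _ _ _ u s5 t5 bcq(4,2,3) sa] N [of "n + N"]
      unfolding X_def Y_def R_def w_def [symmetric] by (simp add: zs_def)
  qed
  have d: "qpochs_inf [-1, sq, - sq, sq * (- sa), sq * (- sa) / (b * c), b * c * z / (sq * (- sa))] q \<noteq> 0"
    "qpochs_inf [-1, 1 / sq, - (1 / sq), q * (- sa), (- sa) / (b * c), b * c * z / (- sa)] q \<noteq> 0"
    using denominators(4,6) by simp_all
  have "(\<lambda>n. R (zs n)) \<longlonglongrightarrow> R z"
    unfolding R_def using nz t5 pq u(2,3) v5
    by (intro tendsto_add half_summand_tendsto whole_summand_tendsto last_summand_tendsto zs denominators(3,5,7) d) auto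
  then have "(\<lambda>n. Y (zs n)) \<longlonglongrightarrow> Y z"
    unfolding Y_def using nz by (intro tendsto_intros zs) auto
  moreover have "(\<lambda>n. W54 a sa b c q (zs n)) \<longlonglongrightarrow> W54 a sa b c q z"
    unfolding W54_def
  proof (rule phi_tendsto)
    show "norm (zs n) \<le> r" for n using N [of "n + N"] by (simp add: zs_def less_imp_le)
  qed (use zs r sa bcq in auto)
  then have "(\<lambda>n. X (zs n)) \<longlonglongrightarrow> X z"
    unfolding X_def theta_eq using nz by (intro tendsto_intros zs) auto
  ultimately have "X z = Y z" unfolding XY using LIMSEQ_unique by blast
  \<comment> \<open>Since \<open>k = q * a * w ^ 2\<close>, the factor
    \<open>1 - q * a * w ^ 2\<close> is the quotient \<open>P k / P (q * k)\<close>; this is the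
    origin of the pair \<open>b^2 * c^2 * z^2 / (q * a)\<close> and
    \<open>b^2 * c^2 * z^2 / a\<close> in the prefactor.\<close>
  define k where "k = b^2 * c^2 * z^2 / (q * a)"
  have k: "P k = (1 - k) * P (b^2 * c^2 * z^2 / a)" "q * a * (b * c * z / (q * a)) ^ 2 = k"
    using P_step [of k] nz by (simp_all add: k_def power2_eq_square)
  have arg: "h / (b * c * z / (q * a)) = h * (q * a / (b * c * z))" by simp
  have "W54 a sa b c q z = P (q * a) * P (q * a / (b * c)) * (1 - k) * R z /
      (theta h q * theta (h * (q * a / (b * c * z))) q * (P (q * a / b) * P (q * a / c)))"
    using \<open>X z = Y z\<close> th bcq unfolding X_def Y_def k arg by (simp add: eq_divide_eq mult.commute)
  also have "\<dots> = qpochs_inf [q * a, k, q * a / (b * c)] q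
      / (thetas [h, h * (q * a / (b * c * z))] q * qpochs_inf [b^2 * c^2 * z^2 / a, q * a / b, q * a / c] q) * R z"
    using bcq(1) by (simp add: thetas_def qpochs_inf_def k(1) mult_ac)
  finally show ?thesis unfolding R_def S k_def .
qed

end
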